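(* Let $a,b\in\mathbb{Q}$ with $a\ne0$, let $S_{a,b}=\{p_1,\dots,p_s\}$ be the finite set of primes defined in the context, and for $x\in\mathbb{R}$ and real $r_1,\dots,r_s>0$ put $$\Gamma_{a,b}(x,r_1,\dots,r_s)=\sum_{i=1}^s\Big(\log^+r_i+\log^+\max\{|a|_{p_i}r_i,|b|_{p_i}\}\Big)+\frac1{2\pi}\int_0^{2\pi}\left(\log^+\left|\frac{e^{i\theta}}{r_1r_2\cdots r_s}+x\right|+\log^+\left|\frac{ae^{i\theta}}{r_1r_2\cdots r_s}+b+ax\right|\right)d\theta .$$ Then for each $x\in\mathbb{R}$ and all real $r_1,\dots,r_s>0$, the image of $h_{a,b}$ is dense in the interval $[\Gamma_{a,b}(x,r_1,\dots,r_s),\infty)$. In particular, $$\mu^{ess}(h_{a,b})\le\Gamma_{a,b}(x,r_1,\dots,r_s).$$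
   Context: $\log^+x=\max(\log x,0)$, $\log^+0=0$; $|\cdot|_p$ is the standard $p$-adic absolute value on $\mathbb{Q}$ with $|p|_p=1/p$. Write $a=a_1/a_2$ and, if $b\neq0$, $b=b_1/b_2$ in lowest terms. If $b\ne0$, $S_{a,b}$ is the set of primes $p$ with $p\mid a_2$ or $p\mid b_2$; if $b=0$, $S_{a,0}$ is the set of primes dividing $a_2$. Set $s=|S_{a,b}|$ (if $s=0$ the empty product $r_1\cdots r_s$ is $1$). $h$ is the absolute logarithmic Weil height on $\overline{\mathbb{Q}}$: $h(\alpha)=\frac{1}{[K:\mathbb{Q}]}\sum_{\nu\in M_K}\log^+|\alpha|_\nu$ for any number field $K\ni\alpha$, with absolute values normalized so that the product formula holds; $h_{a,b}(\alpha)=h(\alpha)+h(a\alpha+b)$ for $\alpha\in\overline{\mathbb{Q}}$. For $f:\overline{\mathbb{Q}}\to\mathbb{R}$, $\mu^{ess}(f)=\inf\{\theta\in\mathbb{R}:\{\alpha\in\overline{\mathbb{Q}}:f(\alpha)\le\theta\}\text{ is infinite}\}$. *)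

theory Defs
  imports
    "HOL-Analysis.Analysis"
    "HOL-Algebra.Algebra"
    "HOL-Algebra.Algebraic_Closure_Type"
begin

hide_const (open) Divisibility.prime

definition log_plus :: "real \<Rightarrow> real" where
  "log_plus x = (if x = 0 then 0 else max (ln x) 0)"

definition padic_abs :: "nat \<Rightarrow> rat \<Rightarrow> real" where
  "padic_abs p q =
     (if q = 0 then 0
      else real p powi (int (multiplicity (int p) (snd (quotient_of q)))
                        - int (multiplicity (int p) (fst (quotient_of q)))))"

text \<open>Number fields are taken as subfields of the complex numbers, so that the algebraic
  closure of the rationals is the set of algebraic complex numbers.\<close>

abbreviation complex_ring :: "complex ring" where
  "complex_ring \<equiv> ring_of_type_algebra"

abbreviation subfield_ring :: "complex set \<Rightarrow> complex ring" where
  "subfield_ring K \<equiv> complex_ring \<lparr>carrier := K\<rparr>"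

definition field_degree :: "complex set \<Rightarrow> nat" where
  "field_degree K = ring.dim complex_ring \<rat> K"

definition integers_ring :: "complex set \<Rightarrow> complex ring" where
  "integers_ring K = complex_ring \<lparr>carrier := {x \<in> K. algebraic_int x}\<rparr>"

definition finite_primes :: "complex set \<Rightarrow> complex set set" where
  "finite_primes K = {P. primeideal P (integers_ring K) \<and> P \<noteq> {0}}"

text \<open>The order of a nonzero integer at a prime: the exponent of the prime in the factorization
  of the principal ideal, that is, the largest power of the prime containing the integer.\<close>

definition int_ord :: "complex set \<Rightarrow> complex set \<Rightarrow> complex \<Rightarrow> nat" where
  "int_ord K P x = (GREATEST n. x \<in> P [^]\<^bsub>ideals_set (integers_ring K)\<^esub> n)"

definition prime_ord :: "complex set \<Rightarrow> complex set \<Rightarrow> complex \<Rightarrow> int" where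
  "prime_ord K P x =
     (THE k. \<exists>y \<in> carrier (integers_ring K) - {0}. \<exists>z \<in> carrier (integers_ring K) - {0}.
        x = y / z \<and> k = int (int_ord K P y) - int (int_ord K P z))"

text \<open>The normalized absolute values of K, for which the product formula holds without
  weights: the absolute value of a uniformizer at a finite prime is the inverse of the size of
  the residue field, and the absolute value at a complex place is the square of the modulus.
  They are set to 0 outside K, so that each place is represented by exactly one function;
  in particular, two complex conjugate embeddings give the same place.\<close>

definition prime_abs :: "complex set \<Rightarrow> complex set \<Rightarrow> complex \<Rightarrow> real" where
  "prime_abs K P x =
     (if x \<in> K - {0}
      then real (card (carrier (integers_ring K Quot P))) powi (- prime_ord K P x) else 0)"

definition embedding_abs :: "complex set \<Rightarrow> (complex \<Rightarrow> complex) \<Rightarrow> complex \<Rightarrow> real" where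
  "embedding_abs K \<sigma> x =
     (if x \<in> K then (if \<sigma> ` K \<subseteq> \<real> then cmod (\<sigma> x) else (cmod (\<sigma> x))\<^sup>2) else 0)"

definition places :: "complex set \<Rightarrow> (complex \<Rightarrow> real) set" where
  "places K = prime_abs K ` finite_primes K
              \<union> embedding_abs K ` ring_hom (subfield_ring K) complex_ring"

text \<open>The sum below has only finitely many nonzero terms if K is a number field.\<close>

definition height_over :: "complex set \<Rightarrow> complex \<Rightarrow> real" where
  "height_over K \<alpha> = (\<Sum>\<^sub>\<infinity>\<nu>\<in>places K. log_plus (\<nu> \<alpha>)) / real (field_degree K)"

text \<open>The value of the height over K is the same for all number fields containing the given
  number; the definition uses the smallest one.\<close>

definition weil_height :: "complex \<Rightarrow> real" where
  "weil_height \<alpha> = height_over (generate_field complex_ring {\<alpha>}) \<alpha>"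

definition height_ab :: "rat \<Rightarrow> rat \<Rightarrow> complex \<Rightarrow> real" where
  "height_ab a b \<alpha> = weil_height \<alpha> + weil_height (of_rat a * \<alpha> + of_rat b)"

text \<open>Extended real values, so that the infimum of the empty set is infinite.\<close>

definition mu_ess :: "(complex \<Rightarrow> real) \<Rightarrow> ereal" where
  "mu_ess f = Inf (ereal ` {\<theta>. infinite {\<alpha>. algebraic \<alpha> \<and> f \<alpha> \<le> \<theta>}})"

definition S_ab :: "rat \<Rightarrow> rat \<Rightarrow> nat set" where
  "S_ab a b = {p. prime p \<and> (int p dvd snd (quotient_of a)
                             \<or> b \<noteq> 0 \<and> int p dvd snd (quotient_of b))}"

text \<open>The radii are indexed by the primes themselves; only their values on the finite set above
  matter.\<close>

definition Gamma_ab :: "rat \<Rightarrow> rat \<Rightarrow> real \<Rightarrow> (nat \<Rightarrow> real) \<Rightarrow> real" where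
  "Gamma_ab a b x r =
     (\<Sum>p\<in>S_ab a b. log_plus (r p) + log_plus (max (padic_abs p a * r p) (padic_abs p b)))
     + 1 / (2 * pi) * integral {0..2 * pi} (\<lambda>\<theta>.
         log_plus (cmod (exp (\<i> * of_real \<theta>) / of_real (\<Prod>p\<in>S_ab a b. r p) + of_real x))
         + log_plus (cmod (of_rat a * exp (\<i> * of_real \<theta>) / of_real (\<Prod>p\<in>S_ab a b. r p)
                           + of_rat b + of_rat a * of_real x)))"

end

theory Submission
  imports Defs "HOL-Real_Asymp.Real_Asymp" "Jordan_Normal_Form.Char_Poly" "Berlekamp_Zassenhaus.Mahler_Measure"
begin

text \<open>By continuity in x and the growth of the bound as x tends to infinity, it suffices to find,
  for given x and radii, algebraic numbers whose heights approximate the bound itself.  For a large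
  prime n choose integers \<open>k p\<close> prime to n with \<open>p powr (k p / n)\<close> close to the radius at p.  Expand
  polynomials around x: rounding the coefficients of \<open>(z - x) ^ n\<close> from the top down, one obtains a
  monic polynomial of degree n, integral outside the chosen primes, whose Newton polygon at each
  chosen p is a single segment of slope \<open>k p / n\<close>, while after rescaling by the radius R, the
  product of the \<open>p powr (- k p / n)\<close>, its coefficients stay bounded independently of n.

  At the chosen primes the roots are then totally ramified, which forces irreducibility and gives
  all finite contributions to the height.  Indeed, the residue ring of the integers modulo p has at
  most \<open>p ^ d\<close> elements in degree d, whereas the slope makes the ramification index a multiple of n.

  The archimedean part is a mean over the roots.  Bounded coefficients and a constant term bounded
  below bring almost all rescaled roots close to the unit circle (Landau's inequality), and by
  Newton's identities their power sums stay bounded; by the Stone-Weierstrass theorem the rescaled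
  roots are equidistributed on the unit circle.\<close>

text \<open>The prime n has two uses. As \<open>n\<close> does not divide \<open>k p\<close>, the
  slope \<open>k p / n\<close> has exact denominator n, which makes n divide the ramification index.
  Moreover the order of a rational at a prime above p is then a multiple of n, while that of
  \<alpha> is not; so a \<alpha> and a nonzero b never have equal absolute values there, and the
  local height is exactly the maximum in the bound.

  The slopes allow as coefficient of z^i only integer multiples of a number \<open>D i\<close>, the
  product of the prescribed powers of the primes. With Q the product of the chosen primes, the
  multipliers are taken congruent to 1 modulo Q, so the rounding error can be placed between Q
  \<open>D i\<close> and 2 Q \<open>D i\<close>. The lower end keeps the constant term away from 0,
  the upper end leads to a bound 2 Q^2 that does not involve n.

  Unique factorization of ideals is bypassed. Finiteness of O/mO and the pigeonhole principle
  provide maximality of primes and an element inverting a given prime; the order function is built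
  on that element. In place of the fundamental identity for ramification and residue degrees,
  incongruent elements modulo powers of P are counted against the classes modulo p.\<close>

hide_const (open) Polynomials.degree Polynomials.lead_coeff up_ring.coeff up_ring.monom
  Ring_Hom.ring_hom

subsection \<open>Algebraic integers\<close>

text \<open>The additive group generated by a family. Indexing by I rather than taking a set of
  generators keeps coincidences among the \<open>e i\<close> harmless.\<close>

definition zspan :: "('i \<Rightarrow> complex) \<Rightarrow> 'i set \<Rightarrow> complex set" where
  "zspan e I = range (\<lambda>c. \<Sum>i\<in>I. of_int (c i) * e i)"

lemma zspanI: "x = (\<Sum>i\<in>I. of_int (c i) * e i) \<Longrightarrow> x \<in> zspan e I"
  by (auto simp: zspan_def)

lemma zspan_gen:
  assumes "finite I" "i \<in> I" shows "e i \<in> zspan e I"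
  unfolding zspan_def
proof (rule range_eqI[where x = "\<lambda>j. if j = i then 1 else 0"])
  have "(\<Sum>j\<in>I. of_int (if j = i then 1 else 0) * e j) = (\<Sum>j\<in>I. if j = i then e j else 0)"
    by (rule sum.cong) auto
  then show "e i = (\<Sum>j\<in>I. of_int (if j = i then 1 else 0) * e j)"
    using assms by simp
qed

lemma zspan_add:
  assumes "x \<in> zspan e I" "y \<in> zspan e I" shows "x + y \<in> zspan e I"
proof -
  obtain c d where "x = (\<Sum>i\<in>I. of_int (c i) * e i)" "y = (\<Sum>i\<in>I. of_int (d i) * e i)"
    using assms by (auto simp: zspan_def)
  then have "x + y = (\<Sum>i\<in>I. of_int (c i + d i) * e i)"
    by (simp add: sum.distrib ring_distribs)
  then show ?thesis by (rule zspanI)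
qed

lemma zspan_of_int_mult:
  assumes "x \<in> zspan e I" shows "of_int k * x \<in> zspan e I"
proof -
  obtain c where "x = (\<Sum>i\<in>I. of_int (c i) * e i)" using assms by (auto simp: zspan_def)
  then have "of_int k * x = (\<Sum>i\<in>I. of_int (k * c i) * e i)"
    by (simp add: sum_distrib_left mult.assoc)
  then show ?thesis by (rule zspanI)
qed

lemma zspan_0: "0 \<in> zspan e I"
  unfolding zspan_def by (rule range_eqI[where x = "\<lambda>_. 0"]) simp

lemma zspan_sum:
  "(\<And>j. j \<in> J \<Longrightarrow> x j \<in> zspan e I) \<Longrightarrow> (\<Sum>j\<in>J. of_int (k j) * x j) \<in> zspan e I"
  by (induction J rule: infinite_finite_induct) (auto simp: zspan_0 intro!: zspan_add zspan_of_int_mult)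

text \<open>The vector of the \<open>e i\<close>, nonzero because of \<open>e i0\<close>, is an
  eigenvector of an integer matrix for the eigenvalue x, and the characteristic polynomial of that
  matrix is monic with integer coefficients.\<close>

lemma algebraic_int_of_int_matrix:
  fixes x :: complex and A :: "nat \<Rightarrow> nat \<Rightarrow> int"
  assumes rel: "\<And>i. i < n \<Longrightarrow> x * e i = (\<Sum>j<n. of_int (A i j) * e j)"
    and i0: "i0 < n" "e i0 \<noteq> 0"
  shows "algebraic_int x"
proof -
  define M where "M = Matrix.mat n n (\<lambda>(i, j). A i j)"
  define v where "v = Matrix.vec n e"
  have M: "M \<in> carrier_mat n n" by (simp add: M_def)
  define MC where "MC = (map_mat of_int M :: complex mat)"
  have MC: "MC \<in> carrier_mat n n" using M by (simp add: MC_def)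
  have "MC *\<^sub>v v = x \<cdot>\<^sub>v v"
  proof (rule eq_vecI)
    show "dim_vec (MC *\<^sub>v v) = dim_vec (x \<cdot>\<^sub>v v)" using M by (simp add: MC_def v_def)
    fix i assume "i < dim_vec (x \<cdot>\<^sub>v v)"
    then have i: "i < n" by (simp add: v_def)
    show "(MC *\<^sub>v v) $ i = (x \<cdot>\<^sub>v v) $ i"
      using i M rel[OF i] by (simp add: MC_def M_def v_def scalar_prod_def lessThan_atLeast0)
  qed
  moreover have "v \<noteq> 0\<^sub>v n"
  proof
    assume "v = 0\<^sub>v n"
    then have "v $ i0 = (0\<^sub>v n :: complex vec) $ i0" by simp
    then show False using i0 by (simp add: v_def)
  qed
  ultimately have "eigenvalue MC x"
    unfolding eigenvalue_def eigenvector_def using M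
    by (intro exI[of _ v]) (auto simp: MC_def v_def)
  then have "poly (char_poly MC) x = 0"
    using eigenvalue_root_char_poly[OF MC] by simp
  moreover have "char_poly MC = map_poly of_int (char_poly M)"
    unfolding MC_def using of_int_hom.char_poly_hom[OF M] by simp
  moreover have "lead_coeff (char_poly M) = 1"
    using degree_monic_char_poly[OF M] by simp
  ultimately have "poly (map_poly of_int (char_poly M)) x = 0 \<and> lead_coeff (char_poly M) = 1" by simp
  then show ?thesis unfolding algebraic_int_altdef_ipoly by (rule exI)
qed

lemma algebraic_int_of_stable_zspan:
  fixes x :: complex
  assumes fin: "finite I" and st: "\<And>i. i \<in> I \<Longrightarrow> x * e i \<in> zspan e I"
    and i0: "i0 \<in> I" "e i0 \<noteq> 0"
  shows "algebraic_int x"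
proof -
  obtain h where h: "bij_betw h {..<card I} I"
    using ex_bij_betw_nat_finite[OF fin] by (auto simp: lessThan_atLeast0)
  have "\<forall>i\<in>I. \<exists>c. x * e i = (\<Sum>j\<in>I. of_int (c j) * e j)"
    using st by (auto simp: zspan_def)
  then obtain A where A: "\<And>i. i \<in> I \<Longrightarrow> x * e i = (\<Sum>j\<in>I. of_int (A i j) * e j)" by metis
  obtain k where k: "k < card I" "h k = i0" using h i0(1) unfolding bij_betw_def by (metis imageE lessThan_iff)
  show ?thesis
  proof (rule algebraic_int_of_int_matrix[where e = "e \<circ> h" and A = "\<lambda>i j. A (h i) (h j)"])
    show "k < card I" "(e \<circ> h) k \<noteq> 0" using k i0 by auto
    fix i assume "i < card I"
    then have "h i \<in> I" using h by (auto simp: bij_betw_def)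
    then have "x * e (h i) = (\<Sum>j\<in>I. of_int (A (h i) j) * e j)" by (rule A)
    also have "\<dots> = (\<Sum>j<card I. of_int (A (h i) (h j)) * e (h j))"
      by (rule sum.reindex_bij_betw[OF h, symmetric])
    finally show "x * (e \<circ> h) i = (\<Sum>j<card I. of_int (A (h i) (h j)) * (e \<circ> h) j)" by simp
  qed
qed

text \<open>Expressing the top power by the lower ones makes these span a module stable under x;
  sums and products are treated in this form.\<close>

lemma algebraic_int_iff_power_relation:
  fixes x :: complex
  shows "algebraic_int x \<longleftrightarrow> (\<exists>m>0. \<exists>c. x ^ m = (\<Sum>k<m. of_int (c k) * x ^ k))"
proof
  assume "algebraic_int x"
  then obtain p :: "int poly" where p: "poly (map_poly of_int p) x = 0" "lead_coeff p = 1"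
    unfolding algebraic_int_altdef_ipoly by blast
  have d: "degree (map_poly of_int p :: complex poly) = degree p" by (simp add: degree_map_poly)
  have "poly (map_poly of_int p) x = (\<Sum>k\<le>degree p. of_int (coeff p k) * x ^ k)"
    unfolding poly_altdef d by (simp add: coeff_map_poly)
  also have "\<dots> = (\<Sum>k<degree p. of_int (coeff p k) * x ^ k) + x ^ degree p"
    using p(2) by (simp add: lessThan_Suc_atMost[symmetric])
  finally have e: "x ^ degree p = (\<Sum>k<degree p. of_int (- coeff p k) * x ^ k)"
    using p(1) by (simp add: sum_negf eq_neg_iff_add_eq_0 add.commute)
  moreover have "degree p > 0"
  proof (rule ccontr)
    assume "\<not> ?thesis"
    then show False using e by simp
  qed
  ultimately show "\<exists>m>0. \<exists>c. x ^ m = (\<Sum>k<m. of_int (c k) * x ^ k)"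
    by (intro exI[of _ "degree p"] conjI exI[of _ "\<lambda>k. - coeff p k"])
next
  assume "\<exists>m>0. \<exists>c. x ^ m = (\<Sum>k<m. of_int (c k) * x ^ k)"
  then obtain m c where m: "m > 0" and e: "x ^ m = (\<Sum>k<m. of_int (c k) * x ^ k)" by blast
  show "algebraic_int x"
  proof (rule algebraic_int_of_stable_zspan[of "{..<m}" x "\<lambda>i. x ^ i" 0])
    fix i assume i: "i \<in> {..<m}"
    show "x * x ^ i \<in> zspan (\<lambda>i. x ^ i) {..<m}"
    proof (cases "Suc i = m")
      case True
      then have "x * x ^ i = x ^ m" by auto
      then show ?thesis unfolding e by (rule zspanI)
    next
      case False
      then show ?thesis using i zspan_gen[of "{..<m}" "Suc i" "\<lambda>i. x ^ i"] by simp
    qed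
  qed (use m in auto)
qed

text \<open>The products \<open>x ^ i * y ^ j\<close>, with exponents below those of the two
  relations, span a module stable under x and y, hence under their sum and product.\<close>

lemma
  fixes x y :: complex
  assumes "algebraic_int x" "algebraic_int y"
  shows algebraic_int_add: "algebraic_int (x + y)"
    and algebraic_int_mult: "algebraic_int (x * y)"
proof -
  obtain m c where m: "m > 0" and c: "x ^ m = (\<Sum>k<m. of_int (c k) * x ^ k)"
    using assms(1) unfolding algebraic_int_iff_power_relation by blast
  obtain n d where n: "n > 0" and d: "y ^ n = (\<Sum>k<n. of_int (d k) * y ^ k)"
    using assms(2) unfolding algebraic_int_iff_power_relation by blast
  define e where "e = (\<lambda>(i, j). x ^ i * y ^ j)"
  define I where "I = {..<m} \<times> {..<n}"
  have fin: "finite I" by (simp add: I_def)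
  have gx: "x * e i \<in> zspan e I" if i: "i \<in> I" for i
  proof -
    obtain u v where uv: "i = (u, v)" "u < m" "v < n" using i by (auto simp: I_def)
    show ?thesis
    proof (cases "Suc u = m")
      case True
      then have "x * e i = x ^ m * y ^ v" by (auto simp: e_def uv)
      also have "\<dots> = (\<Sum>k<m. of_int (c k) * e (k, v))"
        unfolding c by (simp add: e_def sum_distrib_right mult.assoc)
      also have "\<dots> \<in> zspan e I"
        by (rule zspan_sum) (use uv in \<open>auto simp: I_def intro!: zspan_gen\<close>)
      finally show ?thesis .
    next
      case False
      then have "(Suc u, v) \<in> I" using uv by (auto simp: I_def)
      from zspan_gen[OF fin this, of e] show ?thesis by (simp add: e_def uv mult.assoc)
    qed
  qed
  have gy: "y * e i \<in> zspan e I" if i: "i \<in> I" for i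
  proof -
    obtain u v where uv: "i = (u, v)" "u < m" "v < n" using i by (auto simp: I_def)
    show ?thesis
    proof (cases "Suc v = n")
      case True
      then have "y * e i = x ^ u * y ^ n" by (auto simp: e_def uv)
      also have "\<dots> = (\<Sum>k<n. of_int (d k) * e (u, k))"
        unfolding d by (simp add: e_def sum_distrib_left mult_ac)
      also have "\<dots> \<in> zspan e I"
        by (rule zspan_sum) (use uv in \<open>auto simp: I_def intro!: zspan_gen\<close>)
      finally show ?thesis .
    next
      case False
      then have "(u, Suc v) \<in> I" using uv by (auto simp: I_def)
      from zspan_gen[OF fin this, of e] show ?thesis by (simp add: e_def uv mult_ac)
    qed
  qed
  have st: "x * z \<in> zspan e I" if z: "z \<in> zspan e I" for z
  proof -
    obtain c where "z = (\<Sum>i\<in>I. of_int (c i) * e i)" using z by (auto simp: zspan_def)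
    then have "x * z = (\<Sum>i\<in>I. of_int (c i) * (x * e i))" by (simp add: sum_distrib_left mult_ac)
    then show ?thesis using gx by (simp add: zspan_sum)
  qed
  have e00: "(0, 0) \<in> I" "e (0, 0) \<noteq> 0" using m n by (auto simp: I_def e_def)
  show "algebraic_int (x + y)"
    by (rule algebraic_int_of_stable_zspan[where I = I and e = e, OF fin _ e00])
       (use gx gy in \<open>auto simp: ring_distribs intro: zspan_add\<close>)
  show "algebraic_int (x * y)"
    by (rule algebraic_int_of_stable_zspan[where I = I and e = e, OF fin _ e00])
       (use gy st in \<open>auto simp: mult.assoc\<close>)
qed

text \<open>Multiplying an integer relation with leading coefficient c by \<open>c ^ (n - 1)\<close>
  turns it into a monic relation for c x.\<close>

lemma algebraic_imp_multiple_algebraic_int: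
  fixes x :: complex
  assumes "algebraic x"
  obtains m :: nat where "m > 0" "algebraic_int (of_nat m * x)"
proof -
  obtain q :: "complex poly" where q: "\<And>i. coeff q i \<in> \<int>" "q \<noteq> 0" "poly q x = 0"
    using algebraicE[OF assms] by blast
  define p where "p = map_poly (\<lambda>z. \<lfloor>Re z\<rfloor>) q"
  have qp: "q = map_poly of_int p"
  proof (rule poly_eqI)
    fix i
    obtain k where "coeff q i = of_int k" using q(1)[of i] by (auto elim: Ints_cases)
    then show "coeff q i = coeff (map_poly of_int p) i" by (simp add: p_def coeff_map_poly)
  qed
  have p: "poly (map_poly of_int p) x = 0" "p \<noteq> 0" using q qp by auto
  define n where "n = degree p"
  define c where "c = lead_coeff p"
  have c: "c \<noteq> 0" using p by (simp add: c_def)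
  have n: "n > 0"
  proof (rule ccontr)
    assume "\<not> n > 0"
    then obtain a where "p = [:a:]" by (auto simp: n_def elim: degree_eq_zeroE)
    then show False using p by auto
  qed
  have d: "degree (map_poly of_int p :: complex poly) = n" by (simp add: degree_map_poly n_def)
  have "poly (map_poly of_int p) x = (\<Sum>k\<le>n. of_int (coeff p k) * x ^ k)"
    unfolding poly_altdef d by (simp add: coeff_map_poly)
  also have "\<dots> = (\<Sum>k<n. of_int (coeff p k) * x ^ k) + of_int c * x ^ n"
    by (simp add: lessThan_Suc_atMost[symmetric] c_def n_def)
  finally have e: "of_int c * x ^ n = (\<Sum>k<n. of_int (- coeff p k) * x ^ k)"
    using p(1) by (simp add: sum_negf eq_neg_iff_add_eq_0 add.commute)
  have "(of_int c * x) ^ n = of_int c ^ (n - 1) * (of_int c * x ^ n)"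
    using n by (cases n) (auto simp: power_mult_distrib)
  also have "\<dots> = (\<Sum>k<n. of_int (- coeff p k * c ^ (n - 1 - k)) * (of_int c * x) ^ k)"
    unfolding e sum_distrib_left
  proof (rule sum.cong)
    fix k assume "k \<in> {..<n}"
    then have "n - 1 = k + (n - 1 - k)" by auto
    then have "of_int c ^ (n - 1) = (of_int c ^ k * of_int c ^ (n - 1 - k) :: complex)"
      by (metis power_add)
    then show "of_int c ^ (n - 1) * (of_int (- coeff p k) * x ^ k) =
        of_int (- coeff p k * c ^ (n - 1 - k)) * (of_int c * x) ^ k"
      by (simp add: power_mult_distrib mult_ac)
  qed simp
  finally have ai: "algebraic_int (of_int c * x)"
    unfolding algebraic_int_iff_power_relation using n
    by (intro exI[of _ n] conjI exI[of _ "\<lambda>k. - coeff p k * c ^ (n - 1 - k)"])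
  have "algebraic_int (of_nat (nat \<bar>c\<bar>) * x)"
  proof (cases "c > 0")
    case True
    then show ?thesis using ai by simp
  next
    case False
    then have "of_nat (nat \<bar>c\<bar>) * x = - (of_int c * x)" by simp
    then show ?thesis using ai by (metis algebraic_int_minus)
  qed
  then show ?thesis using that[of "nat \<bar>c\<bar>"] c by auto
qed

subsection \<open>Number fields and the finiteness of residue rings\<close>

global_interpretation ratc: vector_space "\<lambda>(q::rat) (z::complex). of_rat q * z"
  by unfold_locales (auto simp: algebra_simps of_rat_add of_rat_mult)

lemma finite_common_denominator:
  fixes c :: "'a \<Rightarrow> rat"
  assumes "finite B"
  obtains m :: int where "m > 0" "\<And>v. v \<in> B \<Longrightarrow> \<exists>k. of_int m * c v = of_int k"
proof -
  have "\<exists>m::int. m > 0 \<and> (\<forall>v\<in>B. \<exists>k. of_int m * c v = of_int k)"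
    using assms
  proof (induction B)
    case (insert v B)
    then obtain m :: int where m: "m > 0" "\<forall>v\<in>B. \<exists>k. of_int m * c v = of_int k" by auto
    obtain a b where ab: "quotient_of (c v) = (a, b)" by (cases "quotient_of (c v)")
    have b: "b > 0" "c v = of_int a / of_int b"
      using ab quotient_of_denom_pos quotient_of_div by auto
    show ?case
    proof (rule exI[of _ "m * b"], intro conjI ballI)
      show "m * b > 0" using m b by simp
      fix w assume "w \<in> insert v B"
      then consider "w = v" | "w \<in> B" by blast
      then show "\<exists>k. of_int (m * b) * c w = of_int k"
      proof cases
        case 1
        then have "of_int (m * b) * c w = of_int (m * a)" using b by simp
        then show ?thesis by (rule exI)
      next
        case 2
        then obtain k where "of_int m * c w = of_int k" using m by auto
        then have "of_int (m * b) * c w = of_int (b * k)" by (simp add: mult_ac)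
        then show ?thesis by (rule exI)
      qed
    qed
  qed (rule exI[of _ 1], simp)
  then show ?thesis using that by blast
qed

lemma dependent_imp_int_relation:
  assumes "finite B" "ratc.dependent B"
  obtains c :: "complex \<Rightarrow> int" where "(\<Sum>v\<in>B. of_int (c v) * v) = 0" "\<exists>v\<in>B. c v \<noteq> 0"
proof -
  obtain c where c: "(\<Sum>v\<in>B. of_rat (c v) * v) = 0" "\<exists>v\<in>B. c v \<noteq> 0"
    using assms by (auto simp: ratc.dependent_finite)
  obtain m :: int where m: "m > 0" "\<And>v. v \<in> B \<Longrightarrow> \<exists>k. of_int m * c v = of_int k"
    using finite_common_denominator[OF assms(1), of c] by metis
  then obtain k where k: "\<And>v. v \<in> B \<Longrightarrow> of_int m * c v = of_int (k v)" by metis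
  have "(\<Sum>v\<in>B. of_int (k v) * v) = (\<Sum>v\<in>B. of_int m * (of_rat (c v) * v))"
  proof (rule sum.cong)
    fix v assume "v \<in> B"
    then have "of_rat (of_int m * c v) = (of_rat (of_int (k v)) :: complex)" using k by metis
    then show "of_int (k v) * v = of_int m * (of_rat (c v) * v)"
      by (simp add: of_rat_mult mult.assoc[symmetric])
  qed simp
  also have "\<dots> = 0" using c(1) by (simp add: sum_distrib_left[symmetric])
  finally have "(\<Sum>v\<in>B. of_int (k v) * v) = 0" .
  moreover obtain v where "v \<in> B" "c v \<noteq> 0" using c(2) by blast
  then have "k v \<noteq> 0" using k[of v] m(1) by auto
  then have "\<exists>v\<in>B. k v \<noteq> 0" using \<open>v \<in> B\<close> by blast
  ultimately show ?thesis by (rule that)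
qed

text \<open>Descent on the sum of the absolute values: as long as p divides every coefficient,
  dividing by p leaves a smaller nonzero relation.\<close>

lemma int_relation_primitive:
  fixes c :: "complex \<Rightarrow> int" and p :: nat
  assumes p: "p > 1" and fin: "finite B"
  shows "(\<Sum>v\<in>B. of_int (c v) * v) = 0 \<Longrightarrow> \<exists>v\<in>B. c v \<noteq> 0 \<Longrightarrow>
    \<exists>d. (\<Sum>v\<in>B. of_int (d v) * v) = 0 \<and> (\<exists>v\<in>B. \<not> int p dvd d v)"
proof (induction "\<Sum>v\<in>B. nat \<bar>c v\<bar>" arbitrary: c rule: less_induct)
  case less
  show ?case
  proof (cases "\<forall>v\<in>B. int p dvd c v")
    case False
    then show ?thesis using less by blast
  next
    case True
    define d where "d = (\<lambda>v. c v div int p)"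
    have cd: "c v = int p * d v" if "v \<in> B" for v using True that by (simp add: d_def)
    have "(\<Sum>v\<in>B. of_int (c v) * v) = of_nat p * (\<Sum>v\<in>B. of_int (d v) * v)"
      unfolding sum_distrib_left by (rule sum.cong) (simp_all add: cd mult.assoc)
    then have s: "(\<Sum>v\<in>B. of_int (d v) * v) = 0" using less.prems p by auto
    obtain w where w: "w \<in> B" "c w \<noteq> 0" using less.prems by blast
    have nz: "\<exists>v\<in>B. d v \<noteq> 0" using w cd by (intro bexI[of _ w]) auto
    have "(\<Sum>v\<in>B. nat \<bar>d v\<bar>) < (\<Sum>v\<in>B. nat \<bar>c v\<bar>)"
    proof (rule sum_strict_mono_ex1[OF fin])
      have le: "nat \<bar>d v\<bar> \<le> nat \<bar>c v\<bar> \<and> (d v \<noteq> 0 \<longrightarrow> nat \<bar>d v\<bar> < nat \<bar>c v\<bar>)" if "v \<in> B" for v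
      proof -
        have "\<bar>c v\<bar> = int p * \<bar>d v\<bar>" using cd[OF that] by (simp add: abs_mult)
        moreover have "int p * \<bar>d v\<bar> \<ge> 2 * \<bar>d v\<bar>" using p by (intro mult_right_mono) auto
        ultimately show ?thesis by auto
      qed
      show "\<forall>v\<in>B. nat \<bar>d v\<bar> \<le> nat \<bar>c v\<bar>" using le by blast
      show "\<exists>v\<in>B. nat \<bar>d v\<bar> < nat \<bar>c v\<bar>" using le nz by blast
    qed
    from less.hyps[OF this s nz] show ?thesis .
  qed
qed

text \<open>Since more than \<open>card T\<close> elements of M satisfy a primitive integer relation, M/pM has
  dimension at most \<open>card T\<close> over the field with p elements.\<close>

lemma residues_mod_prime:
  fixes M :: "complex set" and p :: nat
  assumes p: "prime p" and T: "finite T" "M \<subseteq> ratc.span T"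
    and M: "0 \<in> M" "\<And>x y. x \<in> M \<Longrightarrow> y \<in> M \<Longrightarrow> x + y \<in> M" "\<And>x. x \<in> M \<Longrightarrow> - x \<in> M"
  obtains F where "finite F" "F \<subseteq> M" "card F \<le> p ^ card T"
    "\<And>x. x \<in> M \<Longrightarrow> \<exists>y\<in>F. \<exists>z\<in>M. x = y + of_nat p * z"
proof -
  have Mn: "of_nat k * x \<in> M" if "x \<in> M" for k x
    by (induction k) (use that M in \<open>auto simp: ring_distribs\<close>)
  have Mi: "of_int k * x \<in> M" if "x \<in> M" for k x
    using Mn[OF that, of "nat k"] M(3)[OF Mn[OF that, of "nat (- k)"]] by (cases "k \<ge> 0") auto
  have Ms: "(\<Sum>i\<in>I. f i) \<in> M" if "\<And>i. i \<in> I \<Longrightarrow> f i \<in> M" for f :: "complex \<Rightarrow> complex" and I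
    using that by (induction I rule: infinite_finite_induct) (auto intro: M)
  \<comment> \<open>\<open>ind B\<close> expresses that the classes of B are linearly independent in
    M/pM over the field with p elements.\<close>
  define ind where "ind = (\<lambda>B. finite B \<and> B \<subseteq> M \<and>
    (\<forall>c z. z \<in> M \<longrightarrow> (\<Sum>v\<in>B. of_int (c v) * v) = of_nat p * z \<longrightarrow> (\<forall>v\<in>B. int p dvd c v)))"
  have bound: "card B \<le> card T" if B: "ind B" for B
  proof -
    have fin: "finite B" using B by (simp add: ind_def)
    have "ratc.independent B"
    proof
      assume "ratc.dependent B"
      then obtain c :: "complex \<Rightarrow> int"
        where c: "(\<Sum>v\<in>B. of_int (c v) * v) = 0" "\<exists>v\<in>B. c v \<noteq> 0"
        using dependent_imp_int_relation[OF fin] by blast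
      obtain d :: "complex \<Rightarrow> int"
        where d: "(\<Sum>v\<in>B. of_int (d v) * v) = 0" "\<exists>v\<in>B. \<not> int p dvd d v"
        using int_relation_primitive[OF prime_gt_1_nat[OF p] fin c] by blast
      then have "(\<Sum>v\<in>B. of_int (d v) * v) = of_nat p * 0" by simp
      then show False using B d(2) M(1) unfolding ind_def by blast
    qed
    moreover have "B \<subseteq> ratc.span T" using B T by (auto simp: ind_def)
    ultimately show ?thesis using ratc.independent_span_bound[OF T(1)] by blast
  qed
  have "ind {}" by (simp add: ind_def)
  then obtain B where B: "ind B" and max: "\<And>B'. ind B' \<Longrightarrow> card B' \<le> card B"
    using ex_has_greatest_nat[of ind "{}" card "Suc (card T)"] bound by (metis le_imp_less_Suc less_imp_le)
  have fin: "finite B" and BM: "B \<subseteq> M" using B by (auto simp: ind_def)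
  define F where "F = (\<lambda>d. \<Sum>v\<in>B. of_nat (d v) * v) ` (B \<rightarrow>\<^sub>E {..<p})"
  have finE: "finite (B \<rightarrow>\<^sub>E {..<p})" using fin by (simp add: finite_PiE)
  show ?thesis
  proof (rule that[of F])
    show "finite F" using finE by (simp add: F_def)
    have "card F \<le> card (B \<rightarrow>\<^sub>E {..<p})" unfolding F_def by (rule card_image_le[OF finE])
    also have "\<dots> = p ^ card B" using fin by (simp add: card_PiE)
    also have "\<dots> \<le> p ^ card T" using bound[OF B] prime_gt_0_nat[OF p] by (intro power_increasing) auto
    finally show "card F \<le> p ^ card T" .
    show "F \<subseteq> M" unfolding F_def using BM by (auto intro!: Ms Mn)
    fix x assume x: "x \<in> M"
    \<comment> \<open>A maximal independent B generates M modulo p. For x outside B the dependence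
      relation has a coefficient of x prime to p, since otherwise it would restrict to B; Bezout
      inverts this coefficient.\<close>
    have "\<exists>c z. z \<in> M \<and> x = (\<Sum>v\<in>B. of_int (c v) * v) + of_nat p * z"
    proof (cases "x \<in> B")
      case True
      have "x = (\<Sum>v\<in>B. of_int (if v = x then 1 else 0) * v) + of_nat p * 0"
      proof -
        have "(\<Sum>v\<in>B. of_int (if v = x then 1 else 0) * v) = (\<Sum>v\<in>B. if v = x then v else 0)"
          by (rule sum.cong) auto
        then show ?thesis using True fin by simp
      qed
      then show ?thesis
        by (intro exI[of _ "\<lambda>v. if v = x then 1 else 0"] exI[of _ 0] conjI M(1))
    next
      case False
      have "\<not> ind (insert x B)" using max[of "insert x B"] False fin by auto
      then obtain c z where cz: "z \<in> M" "(\<Sum>v\<in>insert x B. of_int (c v) * v) = of_nat p * z"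
        and nd: "\<not> (\<forall>v\<in>insert x B. int p dvd c v)"
        using fin BM x unfolding ind_def by blast
      have s: "of_int (c x) * x + (\<Sum>v\<in>B. of_int (c v) * v) = of_nat p * z"
        using cz False fin by simp
      have "\<not> int p dvd c x"
      proof
        assume "int p dvd c x"
        then obtain k where k: "c x = int p * k" by blast
        have "(\<Sum>v\<in>B. of_int (c v) * v) = of_nat p * (z - of_int k * x)"
          using s by (simp add: k algebra_simps)
        moreover have "z - of_int k * x \<in> M" using M(2)[OF cz(1) M(3)[OF Mi[OF x]]] by simp
        ultimately have "\<forall>v\<in>B. int p dvd c v" using B unfolding ind_def by blast
        then show False using nd \<open>int p dvd c x\<close> by blast
      qed
      then have "gcd (int p) (c x) = 1"
        using prime_imp_coprime[of "int p" "c x"] p by simp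
      then have "gcd (c x) (int p) = 1" by (simp add: gcd.commute)
      then obtain u w where uw: "u * c x + w * int p = 1"
        using bezout_int[of "c x" "int p"] by auto
      have "x = of_int (u * c x + w * int p) * x" using uw by simp
      also have "\<dots> = of_int u * (of_int (c x) * x) + of_nat p * (of_int w * x)"
        by (simp add: algebra_simps)
      also have "of_int (c x) * x = of_nat p * z - (\<Sum>v\<in>B. of_int (c v) * v)"
        using s by (simp add: algebra_simps)
      finally have "x = (\<Sum>v\<in>B. of_int (- u * c v) * v) + of_nat p * (of_int u * z + of_int w * x)"
        by (simp add: algebra_simps sum_distrib_left sum_negf)
      moreover have "of_int u * z + of_int w * x \<in> M" using M(2) Mi x cz(1) by blast
      ultimately show ?thesis
        by (intro exI[of _ "\<lambda>v. - u * c v"] exI[of _ "of_int u * z + of_int w * x"] conjI)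
    qed
    then obtain c z where cz: "z \<in> M" "x = (\<Sum>v\<in>B. of_int (c v) * v) + of_nat p * z" by blast
    \<comment> \<open>Reduction of the coefficients to the digits below p lands in F; the quotients
      go into the multiple of p.\<close>
    define d where "d = (\<lambda>v\<in>B. nat (c v mod int p))"
    have p0: "int p > 0" using prime_gt_0_nat[OF p] by simp
    have "d \<in> B \<rightarrow>\<^sub>E {..<p}" using p0 by (auto simp: d_def nat_less_iff)
    then have "(\<Sum>v\<in>B. of_nat (d v) * v) \<in> F" unfolding F_def by blast
    moreover have "x = (\<Sum>v\<in>B. of_nat (d v) * v) + of_nat p * ((\<Sum>v\<in>B. of_int (c v div int p) * v) + z)"
    proof -
      have "(\<Sum>v\<in>B. of_int (c v) * v) =
          (\<Sum>v\<in>B. of_nat (d v) * v + of_nat p * (of_int (c v div int p) * v))"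
      proof (rule sum.cong)
        fix v assume v: "v \<in> B"
        have "c v = int (d v) + int p * (c v div int p)" using p0 v by (simp add: d_def)
        then have "(of_int (c v) :: complex) = of_int (int (d v) + int p * (c v div int p))" by (rule arg_cong)
        then show "of_int (c v) * v = of_nat (d v) * v + of_nat p * (of_int (c v div int p) * v)"
          by (simp only: of_int_add of_int_mult of_int_of_nat_eq ring_distribs mult.assoc)
      qed simp
      then show ?thesis by (simp add: cz(2) sum.distrib sum_distrib_left[symmetric] ring_distribs)
    qed
    moreover have "(\<Sum>v\<in>B. of_int (c v div int p) * v) + z \<in> M"
      using BM cz(1) by (intro M(2) Ms Mi) auto
    ultimately show "\<exists>y\<in>F. \<exists>z\<in>M. x = y + of_nat p * z" by blast
  qed
qed

subsection \<open>Orders at the primes of a number field\<close>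

text \<open>The number d is only an upper bound for the degree; irreducibility of the defining
  polynomial comes out later by comparing this bound with a ramification index.\<close>

locale number_field =
  fixes K :: "complex set" and d :: nat
  assumes zero_in: "0 \<in> K" and one_in: "1 \<in> K"
    and add_in: "\<And>x y. x \<in> K \<Longrightarrow> y \<in> K \<Longrightarrow> x + y \<in> K"
    and mult_in: "\<And>x y. x \<in> K \<Longrightarrow> y \<in> K \<Longrightarrow> x * y \<in> K"
    and minus_in: "\<And>x. x \<in> K \<Longrightarrow> - x \<in> K"
    and inverse_in: "\<And>x. x \<in> K \<Longrightarrow> inverse x \<in> K"
    and ex_span: "\<exists>T. finite T \<and> card T \<le> d \<and> K \<subseteq> ratc.span T"
begin

definition "OK = {x \<in> K. algebraic_int x}"

lemma divide_in: "x \<in> K \<Longrightarrow> y \<in> K \<Longrightarrow> x / y \<in> K"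
  by (simp add: divide_inverse mult_in inverse_in)

lemma power_in: "x \<in> K \<Longrightarrow> x ^ k \<in> K"
  by (induction k) (auto intro: one_in mult_in)

lemma of_nat_in: "of_nat k \<in> K"
  by (induction k) (auto intro: zero_in one_in add_in)

lemma of_int_in: "of_int k \<in> K"
  using of_nat_in[of "nat k"] minus_in[OF of_nat_in[of "nat (- k)"]] by (cases "k \<ge> 0") auto

lemma of_rat_in: "of_rat q \<in> K"
proof (cases q)
  case (Fract a b)
  then show ?thesis by (simp add: of_rat_rat divide_in of_int_in)
qed

text \<open>The powers up to exponent d either repeat or are d + 1 vectors in a space of dimension
  at most d; both cases yield a nonzero integer polynomial vanishing at x.\<close>

lemma algebraic_in: assumes "x \<in> K" shows "algebraic x"
proof -
  obtain T where T: "finite T" "card T \<le> d" "K \<subseteq> ratc.span T" using ex_span by blast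
  show ?thesis
  proof (cases "inj_on (\<lambda>i. x ^ i) {..d}")
    case True
    define B where "B = (\<lambda>i. x ^ i) ` {..d}"
    have "card B = Suc d" using True by (simp add: B_def card_image)
    moreover have "B \<subseteq> ratc.span T" using T(3) assms by (auto simp: B_def power_in)
    ultimately have "ratc.dependent B"
      using ratc.independent_span_bound[OF T(1), of B] T(2) by auto
    then obtain c :: "complex \<Rightarrow> int"
      where c: "(\<Sum>v\<in>B. of_int (c v) * v) = 0" "\<exists>v\<in>B. c v \<noteq> 0"
      using dependent_imp_int_relation[of B] by (auto simp: B_def)
    define p where "p = (\<Sum>i\<le>d. monom (of_int (c (x ^ i)) :: complex) i)"
    have cf: "coeff p k = (if k \<le> d then of_int (c (x ^ k)) else 0)" for k
      by (simp add: p_def coeff_sum)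
    have "poly p x = (\<Sum>i\<le>d. of_int (c (x ^ i)) * x ^ i)"
      by (simp add: p_def poly_sum poly_monom)
    also have "\<dots> = 0" using c(1) True by (simp add: B_def sum.reindex)
    finally have "poly p x = 0" .
    moreover have "p \<noteq> 0"
    proof -
      obtain k where "k \<le> d" "c (x ^ k) \<noteq> 0" using c(2) by (auto simp: B_def)
      then have "coeff p k \<noteq> 0" by (simp add: cf)
      then show ?thesis by auto
    qed
    ultimately show ?thesis by (intro algebraicI[of p]) (auto simp: cf)
  next
    case False
    then obtain i j where ij: "i < j" "x ^ i = x ^ j"
      by (auto simp: inj_on_def) (metis linorder_neqE_nat)
    define p where "p = monom (1 :: complex) j - monom 1 i"
    have "coeff p j = 1" using ij by (simp add: p_def)
    then have "p \<noteq> 0" by auto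
    moreover have "poly p x = 0" using ij by (simp add: p_def poly_monom)
    ultimately show ?thesis by (intro algebraicI[of p]) (auto simp: p_def)
  qed
qed

lemma OK_in: "x \<in> OK \<Longrightarrow> x \<in> K"
  by (simp add: OK_def)

lemma OK_0: "0 \<in> OK" and OK_1: "1 \<in> OK"
  by (auto simp: OK_def zero_in one_in)

lemma OK_add: "x \<in> OK \<Longrightarrow> y \<in> OK \<Longrightarrow> x + y \<in> OK"
  by (auto simp: OK_def add_in algebraic_int_add)

lemma OK_mult: "x \<in> OK \<Longrightarrow> y \<in> OK \<Longrightarrow> x * y \<in> OK"
  by (auto simp: OK_def mult_in algebraic_int_mult)

lemma OK_minus: "x \<in> OK \<Longrightarrow> - x \<in> OK"
  by (auto simp: OK_def minus_in)

lemma OK_diff: "x \<in> OK \<Longrightarrow> y \<in> OK \<Longrightarrow> x - y \<in> OK"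
  using OK_add[OF _ OK_minus] by fastforce

lemma OK_power: "x \<in> OK \<Longrightarrow> x ^ k \<in> OK"
  by (induction k) (auto intro: OK_1 OK_mult)

lemma OK_of_nat: "of_nat k \<in> OK"
  by (auto simp: OK_def of_nat_in intro!: int_imp_algebraic_int)

lemma OK_of_int: "of_int k \<in> OK"
  by (auto simp: OK_def of_int_in intro!: int_imp_algebraic_int)

lemma multiple_in_OK:
  assumes "x \<in> K" obtains m :: nat where "m > 0" "of_nat m * x \<in> OK"
  using algebraic_imp_multiple_algebraic_int[OF algebraic_in[OF assms]] assms
  by (auto simp: OK_def mult_in of_nat_in)

text \<open>A substitute for the norm: any denominator of the inverse of x serves as m.\<close>

lemma OK_dvd_of_nat:
  assumes "x \<in> OK" "x \<noteq> 0"
  obtains m :: nat and y where "m > 0" "y \<in> OK" "x * y = of_nat m"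
proof -
  obtain m :: nat where "m > 0" "of_nat m * inverse x \<in> OK"
    using multiple_in_OK[OF inverse_in[OF OK_in[OF assms(1)]]] by blast
  then show ?thesis using that[of m "of_nat m * inverse x"] assms by simp
qed

text \<open>The explicit bound \<open>p ^ d\<close>, beyond finiteness, is one side of the count
  that proves total ramification.\<close>

lemma residues_OK_prime:
  fixes p :: nat
  assumes "prime p"
  shows "\<exists>F. finite F \<and> F \<subseteq> OK \<and> card F \<le> p ^ d \<and> (\<forall>x\<in>OK. \<exists>y\<in>F. \<exists>z\<in>OK. x = y + of_nat p * z)"
proof -
  obtain T where T: "finite T" "card T \<le> d" "K \<subseteq> ratc.span T" using ex_span by blast
  have "OK \<subseteq> ratc.span T" using T(3) OK_in by blast
  have "p ^ card T \<le> p ^ d"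
    using T(2) prime_gt_0_nat[OF assms] by (intro power_increasing) auto
  note le = le_trans[OF _ this]
  show ?thesis
    by (rule residues_mod_prime[OF assms T(1) \<open>OK \<subseteq> ratc.span T\<close> OK_0 OK_add OK_minus])
       (use le in blast)+
qed

text \<open>Residues are composed as digits: for m = p k, a residue modulo p plus p times a residue
  modulo k represents each class modulo m.\<close>

lemma residues_OK:
  fixes m :: nat
  assumes "m > 0"
  shows "\<exists>F. finite F \<and> F \<subseteq> OK \<and> (\<forall>x\<in>OK. \<exists>y\<in>F. \<exists>z\<in>OK. x = y + of_nat m * z)"
  using assms
proof (induction m rule: less_induct)
  case (less m)
  show ?case
  proof (cases "m = 1")
    case True
    show ?thesis
    proof (intro exI[of _ "{0}"] conjI ballI)
      fix x assume "x \<in> OK"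
      then show "\<exists>y\<in>{0}. \<exists>z\<in>OK. x = y + of_nat m * z" using True by simp
    qed (auto simp: OK_0)
  next
    case False
    then obtain p where p: "prime p" "p dvd m" using prime_factor_nat by blast
    then obtain k where k: "m = p * k" by blast
    have "k > 0" using k less.prems by (cases k) auto
    moreover from this have "k < m" using k prime_gt_1_nat[OF p(1)] by simp
    ultimately obtain G where G: "finite G" "G \<subseteq> OK" "\<forall>x\<in>OK. \<exists>y\<in>G. \<exists>z\<in>OK. x = y + of_nat k * z"
      using less.IH[of k] by auto
    obtain F where F: "finite F" "F \<subseteq> OK" "\<forall>x\<in>OK. \<exists>y\<in>F. \<exists>z\<in>OK. x = y + of_nat p * z"
      using residues_OK_prime[OF p(1)] by blast
    show ?thesis
    proof (intro exI[of _ "(\<lambda>(y, z). y + of_nat p * z) ` (F \<times> G)"] conjI ballI)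
      show "finite ((\<lambda>(y, z). y + of_nat p * z) ` (F \<times> G))" using F G by blast
      show "(\<lambda>(y, z). y + of_nat p * z) ` (F \<times> G) \<subseteq> OK"
        using F(2) G(2) by (auto intro!: OK_add OK_mult OK_of_nat)
      fix x assume "x \<in> OK"
      then obtain y z where yz: "y \<in> F" "z \<in> OK" "x = y + of_nat p * z" using F(3) by blast
      obtain y' z' where yz': "y' \<in> G" "z' \<in> OK" "z = y' + of_nat k * z'" using G(3) yz(2) by blast
      have "x = (y + of_nat p * y') + of_nat m * z'" using yz yz' k by (simp add: algebra_simps)
      then show "\<exists>y\<in>(\<lambda>(y, z). y + of_nat p * z) ` (F \<times> G). \<exists>z\<in>OK. x = y + of_nat m * z"
        using yz yz' by (intro bexI[of _ "y + of_nat p * y'"] bexI[of _ z']) auto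
    qed
  qed
qed

text \<open>Applied to the powers of one element, finiteness of O/mO yields integrality, inverses
  modulo a prime, and nilpotence in a localization.\<close>

lemma OK_pigeonhole:
  fixes m :: nat and f :: "nat \<Rightarrow> complex"
  assumes "m > 0" "\<And>k. f k \<in> OK"
  obtains i j z where "i < j" "z \<in> OK" "f j - f i = of_nat m * z"
proof -
  obtain F where F: "finite F" "\<forall>x\<in>OK. \<exists>y\<in>F. \<exists>z\<in>OK. x = y + of_nat m * z"
    using residues_OK[OF assms(1)] by blast
  have "\<forall>k. \<exists>y. \<exists>z. y \<in> F \<and> z \<in> OK \<and> f k = y + of_nat m * z" using F(2) assms(2) by blast
  then obtain g where "\<forall>k. \<exists>z. g k \<in> F \<and> z \<in> OK \<and> f k = g k + of_nat m * z"
    unfolding choice_iff by blast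
  then obtain h where gh: "\<And>k. g k \<in> F" "\<And>k. h k \<in> OK" "\<And>k. f k = g k + of_nat m * h k"
    unfolding choice_iff by blast
  have "\<not> inj g"
    using F(1) gh(1) by (meson finite_subset image_subsetI infinite_UNIV_nat finite_imageD)
  then obtain i j where "i < j" "g i = g j" by (auto simp: inj_on_def) (metis linorder_neqE_nat)
  then have "f j - f i = of_nat m * (h j - h i)" using gh(3) by (simp add: algebra_simps)
  then show ?thesis using that[OF \<open>i < j\<close> OK_diff[OF gh(2) gh(2)]] by blast
qed

text \<open>A natural multiple m of x bounds the denominators of all powers of g. If
  \<open>m * g ^ j\<close> and \<open>m * g ^ i\<close> agree modulo m, then
  \<open>g ^ j - g ^ i\<close> is an algebraic integer z, and g is a root of the monic equation X^j
  - X^i = z.\<close>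

lemma algebraic_int_of_bounded_powers:
  assumes "x \<in> OK" "x \<noteq> 0" "\<And>k. g ^ k * x \<in> OK"
  shows "algebraic_int g"
proof -
  obtain m y where m: "m > 0" "y \<in> OK" "x * y = of_nat m" using OK_dvd_of_nat[OF assms(1,2)] by blast
  have mem: "of_nat m * g ^ k \<in> OK" for k
  proof -
    have "of_nat m * g ^ k = (g ^ k * x) * y" using m(3) by (metis mult.assoc mult.commute)
    then show ?thesis using OK_mult[OF assms(3) m(2)] by (simp only:)
  qed
  obtain i j z where ij: "i < j" "z \<in> OK" "of_nat m * g ^ j - of_nat m * g ^ i = of_nat m * z"
    using OK_pigeonhole[of m "\<lambda>k. of_nat m * g ^ k"] m(1) mem by blast
  then have "of_nat m * (g ^ j - g ^ i) = of_nat m * z" by (simp add: algebra_simps)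
  then have z: "z = g ^ j - g ^ i" using m(1) by simp
  define p where "p = monom (1 :: complex) j - monom 1 i"
  have dp: "degree p = j"
  proof (rule antisym)
    show "degree p \<le> j" by (rule degree_le) (use ij(1) in \<open>auto simp: p_def\<close>)
    show "j \<le> degree p" by (rule le_degree) (use ij(1) in \<open>auto simp: p_def\<close>)
  qed
  show ?thesis
  proof (rule algebraic_int_root[of z p g])
    show "algebraic_int z" using ij(2) by (simp add: OK_def)
    show "poly p g = z" by (simp add: p_def z poly_monom)
    show "\<forall>i. coeff p i \<in> \<int>" by (auto simp: p_def)
    show "lead_coeff p = 1" unfolding dp using ij(1) by (simp add: p_def)
    show "degree p > 0" using dp ij(1) by simp
  qed
qed

section \<open>The ring of integers and its ideals\<close>

abbreviation "R \<equiv> integers_ring K"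

lemma R_simps: "carrier R = OK" "x \<otimes>\<^bsub>R\<^esub> y = x * y" "x \<oplus>\<^bsub>R\<^esub> y = x + y" "\<one>\<^bsub>R\<^esub> = 1" "\<zero>\<^bsub>R\<^esub> = 0"
  by (auto simp: integers_ring_def ring_of_type_algebra_def OK_def)

lemma R_cring: "cring R"
proof (rule cringI)
  show "abelian_group R"
  proof (rule abelian_groupI)
    fix x assume "x \<in> carrier R"
    then show "\<exists>y\<in>carrier R. y \<oplus>\<^bsub>R\<^esub> x = \<zero>\<^bsub>R\<^esub>"
      by (intro bexI[of _ "- x"]) (auto simp: R_simps OK_minus)
  qed (auto simp: R_simps OK_add OK_0)
  show "comm_monoid R"
    by (rule comm_monoidI) (auto simp: R_simps OK_mult OK_1)
qed (auto simp: R_simps ring_distribs)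

lemma ideal_facts:
  assumes "ideal I R"
  shows "I \<subseteq> OK" "0 \<in> I" "\<And>x y. x \<in> I \<Longrightarrow> y \<in> I \<Longrightarrow> x + y \<in> I"
    "\<And>x y. x \<in> OK \<Longrightarrow> y \<in> I \<Longrightarrow> x * y \<in> I"
  using ideal.Icarr[OF assms] additive_subgroup.zero_closed[OF ideal.axioms(1)[OF assms]]
    additive_subgroup.a_closed[OF ideal.axioms(1)[OF assms]] ideal.I_l_closed[OF assms]
  by (auto simp: R_simps)

end

section \<open>Nonzero primes: maximality and an element inverting the prime\<close>

locale prime_place = number_field +
  fixes P :: "complex set"
  assumes finite_prime: "P \<in> finite_primes K"
begin

lemma primeideal_P: "primeideal P R" and nonzero_P: "P \<noteq> {0}"
  using finite_prime by (auto simp: finite_primes_def)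

lemma ideal_P: "ideal P R"
  using primeideal.axioms(1)[OF primeideal_P] .

lemmas P_OK = ideal_facts(1)[OF ideal_P] and P_0 = ideal_facts(2)[OF ideal_P]
  and P_add = ideal_facts(3)[OF ideal_P] and P_mult = ideal_facts(4)[OF ideal_P]

lemma P_mult': "x \<in> P \<Longrightarrow> y \<in> OK \<Longrightarrow> x * y \<in> P"
  using P_mult by (metis mult.commute)

lemma P_minus: "x \<in> P \<Longrightarrow> - x \<in> P"
  using P_mult[OF OK_minus[OF OK_1]] by fastforce

lemma P_diff: "x \<in> P \<Longrightarrow> y \<in> P \<Longrightarrow> x - y \<in> P"
  using P_add[OF _ P_minus] by fastforce

lemma P_prime: "x \<in> OK \<Longrightarrow> y \<in> OK \<Longrightarrow> x * y \<in> P \<Longrightarrow> x \<in> P \<or> y \<in> P"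
  using primeideal.I_prime[OF primeideal_P, of x y] by (simp add: R_simps)

lemma one_notin_P: "1 \<notin> P"
proof
  assume "1 \<in> P"
  then have "OK \<subseteq> P" using P_mult[of _ 1] by auto
  then show False using primeideal.I_notcarr[OF primeideal_P] P_OK by (auto simp: R_simps)
qed

lemma P_power: "x \<in> OK \<Longrightarrow> x ^ k \<in> P \<Longrightarrow> x \<in> P"
  by (induction k) (use one_notin_P P_prime OK_power in auto)

lemma nat_in_P: obtains m :: nat where "m > 0" "of_nat m \<in> P"
proof -
  obtain x where x: "x \<in> P" "x \<noteq> 0" using nonzero_P P_0 by blast
  then obtain m y where "m > 0" "y \<in> OK" "x * y = of_nat m"
    using OK_dvd_of_nat[of x] P_OK by blast
  then show ?thesis using that P_mult'[OF x(1)] by metis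
qed

text \<open>Prime factors are split off a positive integer in P until one of them lies in P; the
  descent cannot end at 1.\<close>

lemma rational_prime_in_P: obtains p :: nat where "prime p" "of_nat p \<in> P"
proof -
  have "m > 0 \<Longrightarrow> of_nat m \<in> P \<Longrightarrow> \<exists>p. prime p \<and> of_nat p \<in> P" for m :: nat
  proof (induction m rule: less_induct)
    case (less m)
    have "m \<noteq> 1" using less.prems one_notin_P by auto
    then obtain p where p: "prime p" "p dvd m" using prime_factor_nat by blast
    then obtain k where k: "m = p * k" by blast
    have "of_nat p \<in> P \<or> of_nat k \<in> P"
      using P_prime[OF OK_of_nat OK_of_nat, of p k] less.prems(2) k by simp
    moreover have "k > 0" using k less.prems by (cases k) auto
    moreover from this have "k < m" using k prime_gt_1_nat[OF p(1)] by simp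
    ultimately show ?case using less.IH p(1) by blast
  qed
  then show ?thesis using that nat_in_P by metis
qed

lemma coprime_notin_P:
  fixes p :: nat and k :: int
  assumes "prime p" "of_nat p \<in> P" "\<not> int p dvd k"
  shows "of_int k \<notin> P"
proof
  assume k: "of_int k \<in> P"
  have "gcd (int p) k = 1"
    using prime_imp_coprime[of "int p" k] assms by simp
  then obtain u w where uw: "u * int p + w * k = 1"
    using bezout_int[of "int p" k] by auto
  then have "of_int (u * int p + w * k) = (1 :: complex)" by simp
  then have "of_int u * of_nat p + of_int w * of_int k = (1 :: complex)" by simp
  then show False using P_add[OF P_mult[OF OK_of_int assms(2)] P_mult[OF OK_of_int k]] one_notin_P by metis
qed

text \<open>Two powers of a agree modulo an integer of P; cancelling \<open>a ^ i\<close>, which is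
  outside P, leaves a positive power of a congruent to 1.\<close>

lemma P_maximal:
  assumes "a \<in> OK" "a \<notin> P" obtains b where "b \<in> OK" "1 - a * b \<in> P"
proof -
  obtain m :: nat where m: "m > 0" "of_nat m \<in> P" using nat_in_P by blast
  obtain i j z where ij: "i < j" "z \<in> OK" "a ^ j - a ^ i = of_nat m * z"
    using OK_pigeonhole[of m "\<lambda>k. a ^ k"] m(1) OK_power[OF assms(1)] by blast
  obtain l where l: "j = i + Suc l" using ij(1) less_imp_Suc_add by fastforce
  have "a ^ i * (1 - a * a ^ l) = - (of_nat m * z)" using ij(3) by (simp add: l algebra_simps power_add)
  then have "a ^ i * (1 - a * a ^ l) \<in> P" using P_minus[OF P_mult'[OF m(2) ij(2)]] by simp
  then have "a ^ i \<in> P \<or> 1 - a * a ^ l \<in> P"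
    using P_prime OK_power OK_diff OK_1 OK_mult assms(1) by presburger
  then show ?thesis using that[of "a ^ l"] P_power assms OK_power by blast
qed

text \<open>The element b constructed below is nonzero in the localization of O/mO at P and is killed
  by P there; it exists because every element of P is nilpotent in this localization.\<close>

lemma annihilator:
  fixes m :: nat
  assumes m: "m > 0" "of_nat m \<in> P" and F: "finite F" "F \<subseteq> P"
  shows "\<exists>b\<in>OK. (\<forall>u\<in>OK - P. \<forall>z\<in>OK. b * u \<noteq> of_nat m * z) \<and>
    (\<forall>f\<in>F. \<exists>z\<in>OK. b * f = of_nat m * z)"
  using F
proof (induction F)
  case empty
  have "1 * u \<noteq> of_nat m * z" if "u \<in> OK - P" "z \<in> OK" for u z
    using P_mult'[OF m(2) that(2)] that(1) by auto
  then show ?case using OK_1 by blast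
next
  case (insert a F)
  then obtain b where b: "b \<in> OK" "\<forall>u\<in>OK - P. \<forall>z\<in>OK. b * u \<noteq> of_nat m * z"
    "\<forall>f\<in>F. \<exists>z\<in>OK. b * f = of_nat m * z" by auto
  have a: "a \<in> P" "a \<in> OK" using insert.prems P_OK by auto
  define good where "good = (\<lambda>b. \<forall>u\<in>OK - P. \<forall>z\<in>OK. b * u \<noteq> of_nat m * z)"
  obtain i j z where ij: "i < j" "z \<in> OK" "a ^ j - a ^ i = of_nat m * z"
    using OK_pigeonhole[of m "\<lambda>k. a ^ k"] m(1) OK_power[OF a(2)] by blast
  obtain l where l: "j = i + Suc l" using ij(1) less_imp_Suc_add by fastforce
  \<comment> \<open>This factor is a unit in the localization because a lies in P, so the congruence
    between powers of a makes \<open>b * a ^ i\<close> vanish there.\<close>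
  have u0: "1 - a ^ Suc l \<in> OK - P"
  proof -
    have "a ^ Suc l \<in> P" using P_mult'[OF a(1) OK_power[OF a(2)]] by simp
    then show ?thesis using P_add[of "1 - a ^ Suc l" "a ^ Suc l"] one_notin_P OK_diff[OF OK_1 OK_power[OF a(2)]]
      by fastforce
  qed
  have "b * a ^ i * (1 - a ^ Suc l) = of_nat m * (- (b * z))"
    using arg_cong[OF ij(3), of "\<lambda>t. - (b * t)"] by (simp add: l algebra_simps power_add)
  then have ng: "\<not> good (b * a ^ i)" using u0 OK_minus[OF OK_mult[OF b(1) ij(2)]] unfolding good_def by blast
  have g0: "good (b * a ^ 0)" using b(2) by (simp add: good_def)
  \<comment> \<open>The last multiple of b by a power of a that is still nonzero in the
    localization. The factor u from outside P, obtained next, turns the vanishing of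
    \<open>b * a ^ Suc k\<close> there into divisibility by m in O.\<close>
  obtain k where k: "good (b * a ^ k)" "\<not> good (b * a ^ Suc k)"
  proof -
    have "\<exists>k. good (b * a ^ k) \<and> \<not> good (b * a ^ Suc k)"
    proof (rule ccontr)
      assume "\<not> ?thesis"
      then have "good (b * a ^ k)" for k using g0 by (induction k) auto
      then show False using ng by blast
    qed
    then show ?thesis using that by blast
  qed
  then obtain u z' where u: "u \<in> OK - P" "z' \<in> OK" "b * a ^ Suc k * u = of_nat m * z'"
    unfolding good_def by blast
  define b' where "b' = b * a ^ k * u"
  have "b' \<in> OK" using b(1) OK_power[OF a(2)] u(1) by (auto simp: b'_def intro!: OK_mult)
  moreover have "b' * u' \<noteq> of_nat m * w" if "u' \<in> OK - P" "w \<in> OK" for u' w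
  proof -
    have "u * u' \<in> OK - P" using u(1) that(1) P_prime OK_mult by blast
    then have "(b * a ^ k) * (u * u') \<noteq> of_nat m * w" using k(1) that(2) unfolding good_def by blast
    then show ?thesis by (simp add: b'_def mult_ac)
  qed
  moreover have "\<exists>z\<in>OK. b' * f = of_nat m * z" if f: "f \<in> insert a F" for f
  proof -
    consider "f = a" | "f \<in> F" using f by blast
    then show ?thesis
    proof cases
      case 1
      then have "b' * f = of_nat m * z'" using u(3) by (simp add: b'_def mult_ac)
      then show ?thesis using u(2) by blast
    next
      case 2
      then obtain w where w: "w \<in> OK" "b * f = of_nat m * w" using b(3) by blast
      have "b' * f = of_nat m * (w * (a ^ k * u))"
        using arg_cong[OF w(2), of "\<lambda>t. t * (a ^ k * u)"] by (simp add: b'_def mult_ac)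
      moreover have "w * (a ^ k * u) \<in> OK" using w(1) u(1) OK_power[OF a(2)] by (auto intro!: OK_mult)
      ultimately show ?thesis by blast
    qed
  qed
  ultimately show ?case by blast
qed

text \<open>With b from the annihilator and g = b / m, multiplication by g maps P into O although g
  is not integral. If g mapped P into itself, all \<open>g ^ k * m\<close> would be integral and so
  would g; hence some w in P has g w outside P.\<close>

lemma ex_inverse_uniformizer:
  "\<exists>g w. g \<in> K \<and> (\<forall>x\<in>P. g * x \<in> OK) \<and> w \<in> P \<and> g * w \<notin> P"
proof -
  obtain m :: nat where m: "m > 0" "of_nat m \<in> P" using nat_in_P by blast
  obtain F0 where F0: "finite F0" "F0 \<subseteq> OK" "\<forall>x\<in>OK. \<exists>y\<in>F0. \<exists>z\<in>OK. x = y + of_nat m * z"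
    using residues_OK[OF m(1)] by blast
  have "finite (F0 \<inter> P)" "F0 \<inter> P \<subseteq> P" using F0(1) by auto
  then obtain b where b: "b \<in> OK" "\<forall>u\<in>OK - P. \<forall>z\<in>OK. b * u \<noteq> of_nat m * z"
    "\<forall>f\<in>F0 \<inter> P. \<exists>z\<in>OK. b * f = of_nat m * z"
    using annihilator[OF m] by metis
  define g where "g = b / of_nat m"
  have mg: "of_nat m * g = b" using m(1) by (simp add: g_def)
  have gK: "g \<in> K" unfolding g_def by (intro divide_in OK_in b(1) OK_of_nat)
  \<comment> \<open>Modulo m every element of P agrees with one of finitely many representatives in
    P, and b sends these into mO.\<close>
  have gP: "g * x \<in> OK" if x: "x \<in> P" for x
  proof -
    obtain y z where yz: "y \<in> F0" "z \<in> OK" "x = y + of_nat m * z" using F0(3) x P_OK by blast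
    have "y \<in> P" using P_diff[OF x P_mult'[OF m(2) yz(2)]] yz(3) by simp
    then obtain w where w: "w \<in> OK" "b * y = of_nat m * w" using b(3) yz(1) by blast
    have "g * x = w + b * z" using w(2) m(1) by (simp add: yz(3) g_def field_simps)
    then show ?thesis using w(1) b(1) yz(2) by (simp add: OK_add OK_mult)
  qed
  have "g \<notin> OK"
  proof
    assume "g \<in> OK"
    then have "b * 1 \<noteq> of_nat m * g" using b(2) OK_1 one_notin_P by blast
    then show False using mg by simp
  qed
  have "\<exists>w\<in>P. g * w \<notin> P"
  proof (rule ccontr)
    assume "\<not> ?thesis"
    then have st: "g * w \<in> P" if "w \<in> P" for w using that by blast
    have "g ^ k * of_nat m \<in> P" for k
      by (induction k) (use m(2) st in \<open>auto simp: mult.assoc\<close>)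
    then have "algebraic_int g"
      using algebraic_int_of_bounded_powers[OF OK_of_nat, of m g] m(1) P_OK by auto
    then show False using gK \<open>g \<notin> OK\<close> by (simp add: OK_def)
  qed
  then obtain w where "w \<in> P" "g * w \<notin> P" by blast
  then show ?thesis using gK gP by (intro exI[of _ g] exI[of _ w]) simp
qed

end

section \<open>Powers of a prime and the order of an algebraic integer\<close>

context prime_place
begin

text \<open>\<open>inv_gen\<close> carries all of P into O, which the inverse of a uniformizer may
  fail to do because of other primes. Powers of P can therefore be recognized by integrality
  alone.\<close>

definition "inv_gen = (SOME g. \<exists>w. g \<in> K \<and> (\<forall>x\<in>P. g * x \<in> OK) \<and> w \<in> P \<and> g * w \<notin> P)"
definition "unif = (SOME w. w \<in> P \<and> inv_gen * w \<notin> P)"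

lemma inv_gen_ex: "\<exists>w. inv_gen \<in> K \<and> (\<forall>x\<in>P. inv_gen * x \<in> OK) \<and> w \<in> P \<and> inv_gen * w \<notin> P"
  unfolding inv_gen_def by (rule someI_ex) (rule ex_inverse_uniformizer)

lemma inv_gen_in: "inv_gen \<in> K" and inv_gen_P: "x \<in> P \<Longrightarrow> inv_gen * x \<in> OK"
  using inv_gen_ex by auto

lemma unif: "unif \<in> P" "inv_gen * unif \<notin> P"
proof -
  have "\<exists>w. w \<in> P \<and> inv_gen * w \<notin> P" using inv_gen_ex by blast
  then have "unif \<in> P \<and> inv_gen * unif \<notin> P" unfolding unif_def by (rule someI_ex)
  then show "unif \<in> P" "inv_gen * unif \<notin> P" by auto
qed

lemma unif_OK: "unif \<in> OK" using unif(1) P_OK by blast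

definition "Pw k = P [^]\<^bsub>ideals_set R\<^esub> (k :: nat)"

lemma Pw_0: "Pw 0 = OK" and Pw_Suc: "Pw (Suc k) = ideal_prod R (Pw k) P"
  by (simp_all add: Pw_def nat_pow_def ideals_set_def R_simps)

lemma ideal_Pw: "ideal (Pw k) R"
proof (induction k)
  case 0
  have "ideal (carrier R) R" using ring.oneideal[OF cring.axioms(1)[OF R_cring]] .
  then show ?case by (simp only: Pw_0 R_simps)
next
  case (Suc k)
  show ?case unfolding Pw_Suc
    by (rule ring.ideal_prod_is_ideal[OF cring.axioms(1)[OF R_cring] Suc ideal_P])
qed

lemmas Pw_OK = ideal_facts(1)[OF ideal_Pw] and Pw_add = ideal_facts(3)[OF ideal_Pw]
  and Pw_mult = ideal_facts(4)[OF ideal_Pw]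

lemma Pw_prod: "x \<in> Pw k \<Longrightarrow> y \<in> P \<Longrightarrow> x * y \<in> Pw (Suc k)"
  unfolding Pw_Suc using ideal_prod.prod[of x "Pw k" y P R] by (simp add: R_simps)

text \<open>With s an inverse of t modulo P, x = x (1 - t s) + s (t x); in the first summand the
  factor from P adds one to the exponent known by induction.\<close>

lemma Pw_cancel:
  assumes t: "t \<in> OK" "t \<notin> P"
  shows "x \<in> OK \<Longrightarrow> t * x \<in> Pw k \<Longrightarrow> x \<in> Pw k"
proof (induction k)
  case (Suc k)
  obtain s where s: "s \<in> OK" "1 - t * s \<in> P" using P_maximal[OF t] by blast
  have "Pw (Suc k) \<subseteq> Pw k"
    unfolding Pw_Suc
    using ring.ideal_prod_inter[OF cring.axioms(1)[OF R_cring] ideal_Pw ideal_P] by blast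
  then have "x \<in> Pw k" using Suc by blast
  then have "x * (1 - t * s) \<in> Pw (Suc k)" using s(2) by (rule Pw_prod)
  moreover have "s * (t * x) \<in> Pw (Suc k)" using Pw_mult[OF s(1) Suc.prems(2)] .
  ultimately have "x * (1 - t * s) + s * (t * x) \<in> Pw (Suc k)" by (rule Pw_add)
  then show ?case by (simp add: algebra_simps)
qed (simp add: Pw_0)

text \<open>In a product of k elements of P each factor absorbs one \<open>inv_gen\<close>.
  Conversely, \<open>unif ^ k\<close> times the integer \<open>inv_gen ^ k * x\<close> lies in
  \<open>Pw k\<close> and differs from x by a factor outside P, which can be cancelled.\<close>

lemma Pw_iff: "x \<in> Pw k \<longleftrightarrow> x \<in> OK \<and> inv_gen ^ k * x \<in> OK"
proof
  show "x \<in> Pw k \<Longrightarrow> x \<in> OK \<and> inv_gen ^ k * x \<in> OK"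
  proof (induction k arbitrary: x)
    case 0
    then show ?case by (simp add: Pw_0)
  next
    case (Suc k)
    have "inv_gen ^ Suc k * x \<in> OK"
      using Suc.prems unfolding Pw_Suc
    proof (induction rule: ideal_prod.induct)
      case (prod i j)
      have "(inv_gen ^ k * i) * (inv_gen * j) \<in> OK"
        using Suc.IH[OF prod(1)] inv_gen_P[OF prod(2)] by (simp add: OK_mult)
      then show ?case by (simp add: R_simps mult_ac)
    next
      case (sum a b)
      then show ?case by (simp add: R_simps ring_distribs OK_add)
    qed
    then show ?case using Suc.prems Pw_OK by blast
  qed
next
  assume x: "x \<in> OK \<and> inv_gen ^ k * x \<in> OK"
  have "unif ^ k \<in> Pw k" for k
  proof (induction k)
    case (Suc k)
    show ?case using Pw_prod[OF Suc unif(1)] by (simp only: power_Suc2)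
  qed (simp add: Pw_0 OK_1)
  then have "(inv_gen ^ k * x) * unif ^ k \<in> Pw k" using x Pw_mult by blast
  then have "(inv_gen * unif) ^ k * x \<in> Pw k" by (simp add: power_mult_distrib mult_ac)
  moreover have "inv_gen * unif \<in> OK" by (rule inv_gen_P[OF unif(1)])
  then have "(inv_gen * unif) ^ k \<in> OK" "(inv_gen * unif) ^ k \<notin> P"
    using P_power[of "inv_gen * unif" k] OK_power unif(2) by auto
  ultimately show "x \<in> Pw k" using Pw_cancel x by metis
qed

lemma Pw_1: "Pw 1 = P"
proof -
  have "P \<subseteq> Pw 1" using inv_gen_P P_OK by (auto simp: Pw_iff)
  moreover have "Pw (Suc 0) \<subseteq> P"
    unfolding Pw_Suc
    using ring.ideal_prod_inter[OF cring.axioms(1)[OF R_cring] ideal_Pw ideal_P] by blast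
  ultimately show ?thesis by auto
qed

lemma mem_P_iff: "x \<in> P \<longleftrightarrow> x \<in> OK \<and> inv_gen * x \<in> OK"
  using Pw_iff[of x 1] Pw_1 by simp

lemma Pw_antimono: "i \<le> j \<Longrightarrow> Pw j \<subseteq> Pw i"
proof (induction rule: dec_induct)
  case (step n)
  have "Pw (Suc n) \<subseteq> Pw n"
    unfolding Pw_Suc
    using ring.ideal_prod_inter[OF cring.axioms(1)[OF R_cring] ideal_Pw ideal_P] by blast
  then show ?case using step by blast
qed simp

text \<open>Since \<open>inv_gen\<close> is not integral, its powers cannot all keep x integral; the
  exponent just before the first failure is the order.\<close>

lemma ex_ord:
  assumes "x \<in> OK" "x \<noteq> 0"
  shows "\<exists>n. inv_gen ^ n * x \<in> OK - P"
proof -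
  have "inv_gen \<notin> OK"
    using P_mult'[OF unif(1)] unif(2) by (auto simp: mult.commute)
  then have "\<not> algebraic_int inv_gen" using inv_gen_in by (simp add: OK_def)
  then obtain k where k: "inv_gen ^ k * x \<notin> OK"
    using algebraic_int_of_bounded_powers[OF assms] by blast
  define n where "n = (LEAST k. inv_gen ^ k * x \<notin> OK)"
  have n: "inv_gen ^ n * x \<notin> OK" unfolding n_def using k by (rule LeastI)
  have "n \<noteq> 0" using n assms(1) by (metis mult_1 power_0)
  then obtain l where l: "n = Suc l" by (cases n) auto
  have "inv_gen ^ l * x \<in> OK" using not_less_Least[of l "\<lambda>k. inv_gen ^ k * x \<notin> OK"] l n_def by auto
  moreover have "inv_gen ^ l * x \<notin> P"
    using n inv_gen_P[of "inv_gen ^ l * x"] by (auto simp: l mult.assoc)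
  ultimately show ?thesis by blast
qed

text \<open>The greatest power of P containing x is exchanged for a condition on a single product,
  which is multiplicative because P is prime.\<close>

lemma int_ord_eqI:
  assumes "x \<in> OK" "inv_gen ^ n * x \<in> OK - P"
  shows "int_ord K P x = n"
  unfolding int_ord_def Pw_def[symmetric]
proof (rule Greatest_equality)
  show "x \<in> Pw n" using assms by (simp add: Pw_iff)
  fix k assume k: "x \<in> Pw k"
  show "k \<le> n"
  proof (rule ccontr)
    assume "\<not> k \<le> n"
    then have "x \<in> Pw (Suc n)" using k Pw_antimono[of "Suc n" k] by auto
    then have "inv_gen * (inv_gen ^ n * x) \<in> OK" by (simp add: Pw_iff mult.assoc)
    then show False using assms(2) mem_P_iff by blast
  qed
qed

lemma int_ord_unit: "x \<in> OK \<Longrightarrow> x \<noteq> 0 \<Longrightarrow> inv_gen ^ int_ord K P x * x \<in> OK - P"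
  using ex_ord int_ord_eqI by metis

lemma int_ord_mult:
  assumes "x \<in> OK" "y \<in> OK" "x \<noteq> 0" "y \<noteq> 0"
  shows "int_ord K P (x * y) = int_ord K P x + int_ord K P y"
proof (rule int_ord_eqI)
  show "x * y \<in> OK" using assms by (simp add: OK_mult)
  have "inv_gen ^ int_ord K P x * x * (inv_gen ^ int_ord K P y * y) \<in> OK - P"
    using int_ord_unit[OF assms(1,3)] int_ord_unit[OF assms(2,4)] P_prime OK_mult by blast
  then show "inv_gen ^ (int_ord K P x + int_ord K P y) * (x * y) \<in> OK - P"
    by (simp add: power_add mult_ac)
qed

lemma le_int_ord_iff:
  assumes "x \<in> OK" "x \<noteq> 0"
  shows "k \<le> int_ord K P x \<longleftrightarrow> x \<in> Pw k"
proof
  have "x \<in> Pw (int_ord K P x)" using int_ord_unit[OF assms] assms(1) by (simp add: Pw_iff)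
  then show "k \<le> int_ord K P x \<Longrightarrow> x \<in> Pw k" using Pw_antimono by blast
  assume k: "x \<in> Pw k"
  show "k \<le> int_ord K P x"
  proof (rule ccontr)
    assume "\<not> k \<le> int_ord K P x"
    then have "x \<in> Pw (Suc (int_ord K P x))" using k Pw_antimono[of "Suc (int_ord K P x)" k] by auto
    then have "inv_gen * (inv_gen ^ int_ord K P x * x) \<in> OK" by (simp add: Pw_iff mult.assoc)
    then show False using int_ord_unit[OF assms] mem_P_iff by blast
  qed
qed

section \<open>The valuation on the field\<close>

abbreviation "v \<equiv> prime_ord K P"

lemma carrier_R': "carrier (integers_ring K) = OK" by (rule R_simps)

text \<open>The definite description is legitimate: two fractions for one element have equal cross
  products, and orders of integers are additive.\<close>

lemma v_divide:
  assumes "y \<in> OK" "z \<in> OK" "y \<noteq> 0" "z \<noteq> 0"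
  shows "v (y / z) = int (int_ord K P y) - int (int_ord K P z)"
  unfolding prime_ord_def carrier_R'
proof (rule the_equality)
  show "\<exists>ya\<in>OK - {0}. \<exists>za\<in>OK - {0}. y / z = ya / za \<and>
      int (int_ord K P y) - int (int_ord K P z) = int (int_ord K P ya) - int (int_ord K P za)"
    using assms by (intro bexI[of _ y] bexI[of _ z]) auto
  fix k assume "\<exists>ya\<in>OK - {0}. \<exists>za\<in>OK - {0}. y / z = ya / za \<and>
      k = int (int_ord K P ya) - int (int_ord K P za)"
  then obtain a b where ab: "a \<in> OK" "b \<in> OK" "a \<noteq> 0" "b \<noteq> 0" "y / z = a / b"
    "k = int (int_ord K P a) - int (int_ord K P b)" by blast
  then have "y * b = a * z" using assms by (simp add: field_simps)
  then have "int_ord K P y + int_ord K P b = int_ord K P a + int_ord K P z"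
    using int_ord_mult ab assms by metis
  then show "k = int (int_ord K P y) - int (int_ord K P z)" using ab(6) by simp
qed

lemma v_OK: "y \<in> OK \<Longrightarrow> y \<noteq> 0 \<Longrightarrow> v y = int (int_ord K P y)"
proof -
  assume y: "y \<in> OK" "y \<noteq> 0"
  have "int_ord K P 1 = 0" by (rule int_ord_eqI) (auto simp: OK_1 one_notin_P)
  then show ?thesis using v_divide[OF y(1) OK_1 y(2)] by simp
qed

lemma v_OK_nonneg: "y \<in> OK \<Longrightarrow> y \<noteq> 0 \<Longrightarrow> v y \<ge> 0"
  by (simp add: v_OK)

lemma v_unit: "y \<in> OK \<Longrightarrow> y \<notin> P \<Longrightarrow> v y = 0"
  using v_OK[of y] int_ord_eqI[of y 0] P_0 by (cases "y = 0") auto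

lemma v_pos: "y \<in> P \<Longrightarrow> y \<noteq> 0 \<Longrightarrow> v y > 0"
  using v_OK[of y] le_int_ord_iff[of y 1] Pw_1 P_OK by force

lemma frac_K:
  assumes "x \<in> K" obtains y z where "y \<in> OK" "z \<in> OK" "z \<noteq> 0" "x = y / z"
proof -
  obtain m :: nat where "m > 0" "of_nat m * x \<in> OK" using multiple_in_OK[OF assms] by blast
  then show ?thesis using that[of "of_nat m * x" "of_nat m"] OK_of_nat by simp
qed

lemma v_mult:
  assumes "x \<in> K" "y \<in> K" "x \<noteq> 0" "y \<noteq> 0"
  shows "v (x * y) = v x + v y"
proof -
  obtain a b where x: "a \<in> OK" "b \<in> OK" "b \<noteq> 0" "x = a / b" using frac_K[OF assms(1)] by blast
  obtain c e where y: "c \<in> OK" "e \<in> OK" "e \<noteq> 0" "y = c / e" using frac_K[OF assms(2)] by blast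
  have nz: "a \<noteq> 0" "c \<noteq> 0" using assms x y by auto
  have "v (x * y) = v ((a * c) / (b * e))" by (simp add: x y)
  also have "\<dots> = int (int_ord K P (a * c)) - int (int_ord K P (b * e))"
    using x y nz by (intro v_divide OK_mult) auto
  also have "\<dots> = v x + v y" using x y nz by (simp add: int_ord_mult v_divide)
  finally show ?thesis .
qed

lemma v_1: "v 1 = 0"
  using v_unit[OF OK_1 one_notin_P] .

lemma v_power: "x \<in> K \<Longrightarrow> x \<noteq> 0 \<Longrightarrow> v (x ^ k) = int k * v x"
  by (induction k) (auto simp: v_1 v_mult power_in ring_distribs)

lemma v_inverse: "x \<in> K \<Longrightarrow> x \<noteq> 0 \<Longrightarrow> v (inverse x) = - v x"
  using v_mult[of x "inverse x"] by (simp add: inverse_in v_1)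

lemma v_quotient: "x \<in> K \<Longrightarrow> y \<in> K \<Longrightarrow> x \<noteq> 0 \<Longrightarrow> y \<noteq> 0 \<Longrightarrow> v (x / y) = v x - v y"
  by (simp add: divide_inverse v_mult v_inverse inverse_in)

lemma v_power_int: "x \<in> K \<Longrightarrow> x \<noteq> 0 \<Longrightarrow> v (x powi k) = k * v x"
  by (simp add: power_int_def v_power v_inverse inverse_in)

lemma v_minus:
  assumes "x \<in> K" "x \<noteq> 0" shows "v (- x) = v x"
proof -
  have "v (- 1) + v (- 1) = 0" using v_mult[of "- 1" "- 1"] v_1 minus_in[OF one_in] by simp
  then have "v (- 1) = 0" by simp
  then show ?thesis using v_mult[of "- 1" x] minus_in[OF one_in] assms by simp
qed

text \<open>The value of \<open>v\<close> at 0 is unspecified; admitting 0 here stands for infinite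
  order.\<close>

definition "vge k x \<longleftrightarrow> x \<in> K \<and> (x = 0 \<or> v x \<ge> k)"

text \<open>Over a common denominator this is closure of a power of P under addition.\<close>

lemma vge_add:
  assumes "vge k x" "vge k y" shows "vge k (x + y)"
proof -
  have xy: "x \<in> K" "y \<in> K" using assms by (auto simp: vge_def)
  show ?thesis
  proof (cases "x = 0 \<or> y = 0 \<or> x + y = 0")
    case True
    then show ?thesis using assms zero_in by (auto simp: vge_def)
  next
    case False
    obtain a b where x: "a \<in> OK" "b \<in> OK" "b \<noteq> 0" "x = a / b" using frac_K[OF xy(1)] by blast
    obtain c e where y: "c \<in> OK" "e \<in> OK" "e \<noteq> 0" "y = c / e" using frac_K[OF xy(2)] by blast
    have be: "b * e \<in> OK" "b * e \<noteq> 0" using x y by (auto simp: OK_mult)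
    have ae: "a * e \<in> OK" "a * e \<noteq> 0" "c * b \<in> OK" "c * b \<noteq> 0"
      using x y False by (auto simp: OK_mult)
    have xe: "x = (a * e) / (b * e)" "y = (c * b) / (b * e)" using x y by auto
    have s: "x + y = (a * e + c * b) / (b * e)" by (simp only: xe add_divide_distrib)
    have s0: "a * e + c * b \<noteq> 0" using s False by auto
    \<comment> \<open>Truncation at 0 is harmless because the numerators have nonnegative
      order.\<close>
    define l where "l = nat (k + int (int_ord K P (b * e)))"
    have "l \<le> int_ord K P (a * e)" "l \<le> int_ord K P (c * b)"
      using assms False xe v_divide[OF ae(1) be(1) ae(2) be(2)] v_divide[OF ae(3) be(1) ae(4) be(2)]
      by (auto simp: vge_def l_def)
    then have "a * e \<in> Pw l" "c * b \<in> Pw l" using le_int_ord_iff ae by auto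
    then have "a * e + c * b \<in> Pw l" by (rule Pw_add)
    then have "l \<le> int_ord K P (a * e + c * b)" using le_int_ord_iff ae s0 OK_add by blast
    then have "v (x + y) \<ge> k"
      unfolding s using v_divide[of "a * e + c * b" "b * e"] ae be s0 OK_add
      by (auto simp: l_def)
    then show ?thesis using xy by (simp add: vge_def add_in)
  qed
qed

lemma vge_sum: "(\<And>i. i \<in> I \<Longrightarrow> vge k (f i)) \<Longrightarrow> vge k (\<Sum>i\<in>I. f i)"
  by (induction I rule: infinite_finite_induct) (auto simp: vge_add, auto simp: vge_def zero_in)

text \<open>Otherwise x = (x + y) - y would be a sum of two terms of order greater than that of
  x.\<close>

lemma v_add_dominant:
  assumes "x \<in> K" "x \<noteq> 0" "vge (v x + 1) y"
  shows "x + y \<noteq> 0" "v (x + y) = v x"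
proof -
  have y: "y \<in> K" using assms(3) by (simp add: vge_def)
  have my: "vge (v x + 1) (- y)" using assms(3) by (auto simp: vge_def minus_in v_minus)
  show nz: "x + y \<noteq> 0"
  proof
    assume "x + y = 0"
    then have "x = - y" by (simp add: eq_neg_iff_add_eq_0)
    then show False using my assms(2) by (auto simp: vge_def)
  qed
  have "vge (v x) y" using assms(3) by (auto simp: vge_def)
  then have "vge (v x) (x + y)" using assms(1) by (intro vge_add) (auto simp: vge_def)
  moreover have "\<not> v (x + y) \<ge> v x + 1"
  proof
    assume "v (x + y) \<ge> v x + 1"
    then have "vge (v x + 1) (x + y)" using assms(1) y by (simp add: vge_def add_in)
    then have "vge (v x + 1) (x + y + - y)" using my by (rule vge_add)
    then show False using assms(2) by (simp add: vge_def)
  qed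
  ultimately show "v (x + y) = v x" using nz by (auto simp: vge_def)
qed

lemma vge_mult: "vge k x \<Longrightarrow> vge l y \<Longrightarrow> vge (k + l) (x * y)"
  by (cases "x = 0 \<or> y = 0") (auto simp: vge_def mult_in zero_in v_mult)

lemma vge_OK: "x \<in> OK \<Longrightarrow> vge 0 x"
  using v_OK_nonneg OK_in by (auto simp: vge_def)

lemma v_unif: "v unif = 1"
proof -
  have "unif \<noteq> 0" using unif P_0 by auto
  moreover have "int_ord K P unif = 1"
    by (rule int_ord_eqI) (use unif inv_gen_P unif_OK in auto)
  ultimately show ?thesis using v_OK unif_OK by simp
qed

lemma mem_P_iff_v: "x \<in> OK \<Longrightarrow> x \<noteq> 0 \<Longrightarrow> x \<in> P \<longleftrightarrow> v x \<ge> 1"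
  using v_unit v_pos by force

lemma v_of_int_coprime:
  fixes p :: nat and k :: int
  assumes "prime p" "of_nat p \<in> P" "\<not> int p dvd k"
  shows "v (of_int k) = 0"
  using v_unit[OF OK_of_int coprime_notin_P[OF assms]] .

lemma v_of_int:
  fixes p :: nat and k :: int
  assumes p: "prime p" "of_nat p \<in> P" and k: "k \<noteq> 0"
  shows "v (of_int k) = int (multiplicity (int p) k) * v (of_nat p)"
proof -
  have pp: "prime (int p)" using p(1) by simp
  obtain l where l: "k = int p ^ multiplicity (int p) k * l" "\<not> int p dvd l"
    using multiplicity_decompose'[of k "int p"] k pp by (metis not_prime_unit)
  have l0: "l \<noteq> 0" using l k by auto
  have "(of_int k :: complex) = of_nat p ^ multiplicity (int p) k * of_int l"
    by (subst l(1)) simp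
  then have "v (of_int k) = v (of_nat p ^ multiplicity (int p) k) + v (of_int l)"
    using l0 p(1) by (simp add: v_mult power_in of_nat_in of_int_in prime_gt_0_nat)
  then show ?thesis using v_of_int_coprime[OF p l(2)] p(1)
    by (simp add: v_power of_nat_in prime_gt_0_nat)
qed

end

subsection \<open>Residue fields and total ramification\<close>

context prime_place
begin

lemma carrier_Quot: "carrier (R Quot P) = (\<lambda>a. (\<lambda>h. h + a) ` P) ` OK"
  by (auto simp: FactRing_def A_RCOSETS_def' a_r_coset_def' R_simps)

lemma coset_eq_iff:
  "(\<lambda>h. h + a) ` P = (\<lambda>h. h + b) ` P \<longleftrightarrow> a - b \<in> P"
proof
  assume "(\<lambda>h. h + a) ` P = (\<lambda>h. h + b) ` P"
  moreover have "a \<in> (\<lambda>h. h + a) ` P" using P_0 by force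
  ultimately obtain h where "h \<in> P" "a = h + b" by blast
  then show "a - b \<in> P" by simp
next
  assume ab: "a - b \<in> P"
  show "(\<lambda>h. h + a) ` P = (\<lambda>h. h + b) ` P"
  proof (intro Set.set_eqI iffI)
    fix y assume "y \<in> (\<lambda>h. h + a) ` P"
    then obtain h where "h \<in> P" "y = h + a" by blast
    then show "y \<in> (\<lambda>h. h + b) ` P" using P_add[OF _ ab, of h] by (intro image_eqI[of _ _ "h + (a - b)"]) auto
  next
    fix y assume "y \<in> (\<lambda>h. h + b) ` P"
    then obtain h where "h \<in> P" "y = h + b" by blast
    then show "y \<in> (\<lambda>h. h + a) ` P" using P_diff[OF _ ab, of h] by (intro image_eqI[of _ _ "h - (a - b)"]) auto
  qed
qed

abbreviation "residue_card \<equiv> card (carrier (R Quot P))"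

lemma finite_residue_field: "finite (carrier (R Quot P))"
proof -
  obtain m :: nat where m: "m > 0" "of_nat m \<in> P" using nat_in_P by blast
  obtain F where F: "finite F" "F \<subseteq> OK" "\<forall>x\<in>OK. \<exists>y\<in>F. \<exists>z\<in>OK. x = y + of_nat m * z"
    using residues_OK[OF m(1)] by blast
  have "carrier (R Quot P) \<subseteq> (\<lambda>a. (\<lambda>h. h + a) ` P) ` F"
  proof
    fix C assume "C \<in> carrier (R Quot P)"
    then obtain x where x: "x \<in> OK" "C = (\<lambda>h. h + x) ` P" by (auto simp: carrier_Quot)
    obtain y z where yz: "y \<in> F" "z \<in> OK" "x = y + of_nat m * z" using F(3) x(1) by blast
    have "x - y \<in> P" using P_mult'[OF m(2) yz(2)] yz(3) by simp
    then have "C = (\<lambda>h. h + y) ` P" using coset_eq_iff[of x y] x(2) by blast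
    then show "C \<in> (\<lambda>a. (\<lambda>h. h + a) ` P) ` F" using yz(1) by blast
  qed
  then show ?thesis using F(1) by (meson finite_imageI finite_subset)
qed

lemma residue_card_pos: "residue_card > 0"
  using finite_residue_field OK_0 by (auto simp: card_gt_0_iff carrier_Quot)

lemma residue_reps:
  "\<exists>F. finite F \<and> F \<subseteq> OK \<and> card F = residue_card \<and> (\<forall>x\<in>F. \<forall>y\<in>F. x - y \<in> P \<longrightarrow> x = y)"
proof -
  obtain F where F: "F \<subseteq> OK" "inj_on (\<lambda>a. (\<lambda>h. h + a) ` P) F"
    "carrier (R Quot P) = (\<lambda>a. (\<lambda>h. h + a) ` P) ` F"
    using subset_image_inj[of "carrier (R Quot P)" "\<lambda>a. (\<lambda>h. h + a) ` P" OK] carrier_Quot by auto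
  have "card F = residue_card" unfolding F(3) using F(2) by (simp add: card_image)
  moreover have "finite F" using finite_residue_field unfolding F(3) using F(2) by (rule finite_imageD)
  moreover have "\<forall>x\<in>F. \<forall>y\<in>F. x - y \<in> P \<longrightarrow> x = y"
    using F(2) coset_eq_iff by (auto simp: inj_on_def)
  ultimately show ?thesis using F(1) by blast
qed

text \<open>The integers from 0 to p - 1 are pairwise incongruent modulo P.\<close>

lemma residue_card_ge:
  fixes p :: nat
  assumes p: "prime p" "of_nat p \<in> P"
  shows "p \<le> residue_card"
proof -
  define f where "f = (\<lambda>k::nat. (\<lambda>h. h + (of_nat k :: complex)) ` P)"
  have "inj_on f {..<p}"
  proof (rule inj_onI)
    fix i j assume ij: "i \<in> {..<p}" "j \<in> {..<p}" "f i = f j"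
    then have "of_int (int i - int j) \<in> P" using coset_eq_iff by (simp add: f_def)
    then have "int p dvd int i - int j" using coprime_notin_P[OF p] by blast
    moreover have "\<bar>int i - int j\<bar> < int p" using ij by auto
    ultimately show "i = j" using dvd_imp_le_int[of "int i - int j" "int p"] by auto
  qed
  then have "card (f ` {..<p}) = p" by (simp add: card_image)
  moreover have "f ` {..<p} \<subseteq> carrier (R Quot P)" using OK_of_nat by (auto simp: f_def carrier_Quot)
  ultimately show ?thesis using card_mono[OF finite_residue_field] by metis
qed

text \<open>Digit expansions in powers of \<open>unif\<close>, with digits from a residue system.
  This bounds the number of classes modulo a power of P from below.\<close>

lemma Pw_reps:
  "\<exists>F. finite F \<and> F \<subseteq> OK \<and> card F = residue_card ^ k \<and> (\<forall>x\<in>F. \<forall>y\<in>F. x - y \<in> Pw k \<longrightarrow> x = y)"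
proof (induction k)
  case 0
  show ?case by (rule exI[of _ "{0}"]) (simp add: OK_0)
next
  case (Suc k)
  then obtain F where F: "finite F" "F \<subseteq> OK" "card F = residue_card ^ k"
    "\<forall>x\<in>F. \<forall>y\<in>F. x - y \<in> Pw k \<longrightarrow> x = y" by blast
  obtain G where G: "finite G" "G \<subseteq> OK" "card G = residue_card" "\<forall>x\<in>G. \<forall>y\<in>G. x - y \<in> P \<longrightarrow> x = y"
    using residue_reps by blast
  define f where "f = (\<lambda>(x, y). x + unif ^ k * y)"
  have u0: "unif \<noteq> 0" using unif P_0 by auto
  have ut: "unif ^ k \<in> Pw k" 
  proof (cases "k = 0")
    case False
    then show ?thesis
      using le_int_ord_iff[OF OK_power[OF unif_OK], of k k] u0 v_OK[OF OK_power[OF unif_OK], of k]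
        v_power[OF OK_in[OF unif_OK] u0, of k] v_unif by simp
  qed (simp add: Pw_0 OK_1)
  \<comment> \<open>Modulo \<open>Pw k\<close> the terms with \<open>unif ^ k\<close> disappear, so
    x and x' agree; what remains has order k plus the order of y - y'.\<close>
  have key: "x = x' \<and> y = y'" if h: "x \<in> F" "x' \<in> F" "y \<in> G" "y' \<in> G"
      and d: "(x + unif ^ k * y) - (x' + unif ^ k * y') \<in> Pw (Suc k)" for x x' y y'
  proof -
    have yy: "y' - y \<in> OK" "y - y' \<in> OK" using h G(2) OK_diff by blast+
    have dk: "(x + unif ^ k * y) - (x' + unif ^ k * y') \<in> Pw k" using d Pw_antimono[of k "Suc k"] by auto
    have "(x + unif ^ k * y) - (x' + unif ^ k * y') + (y' - y) * unif ^ k \<in> Pw k"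
      by (rule Pw_add[OF dk Pw_mult[OF yy(1) ut]])
    then have "x - x' \<in> Pw k" by (simp add: algebra_simps)
    then have xx: "x = x'" using F(4) h by blast
    have "y = y'"
    proof (rule ccontr)
      assume ne: "y \<noteq> y'"
      have "unif ^ k * (y - y') \<in> Pw (Suc k)" using d xx by (simp add: algebra_simps)
      then have "int (Suc k) \<le> v (unif ^ k * (y - y'))"
        using le_int_ord_iff[of "unif ^ k * (y - y')" "Suc k"] v_OK[of "unif ^ k * (y - y')"]
          OK_mult[OF OK_power[OF unif_OK] yy(2)] ne u0 by auto
      also have "v (unif ^ k * (y - y')) = int k + v (y - y')"
        using ne u0 yy unif_OK by (simp add: v_mult v_power v_unif OK_in power_in)
      finally have "y - y' \<in> P" using mem_P_iff_v[OF yy(2)] ne by simp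
      then show False using G(4) h ne by blast
    qed
    then show ?thesis using xx by blast
  qed
  have inj: "inj_on f (F \<times> G)"
  proof (rule inj_onI)
    fix a b assume ab: "a \<in> F \<times> G" "b \<in> F \<times> G" "f a = f b"
    have "0 \<in> Pw (Suc k)" using ideal_facts(2)[OF ideal_Pw] .
    then show "a = b" using key[of "fst a" "fst b" "snd a" "snd b"] ab
      by (cases a; cases b) (auto simp: f_def)
  qed
  show ?case
  proof (rule exI[of _ "f ` (F \<times> G)"], intro conjI)
    show "finite (f ` (F \<times> G))" using F G by blast
    show "f ` (F \<times> G) \<subseteq> OK"
      using F(2) G(2) unif_OK by (auto simp: f_def intro!: OK_add OK_mult OK_power)
    show "card (f ` (F \<times> G)) = residue_card ^ Suc k"
      using inj F(3) G(3) by (simp add: card_image card_cartesian_product)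
    show "\<forall>x\<in>f ` (F \<times> G). \<forall>y\<in>f ` (F \<times> G). x - y \<in> Pw (Suc k) \<longrightarrow> x = y"
    proof (intro ballI impI)
      fix s t assume st: "s \<in> f ` (F \<times> G)" "t \<in> f ` (F \<times> G)" "s - t \<in> Pw (Suc k)"
      then obtain x y x' y' where "x \<in> F" "y \<in> G" "x' \<in> F" "y' \<in> G" "s = f (x, y)" "t = f (x', y')"
        by auto
      then show "s = t" using key[of x x' y y'] st(3) by (simp add: f_def)
    qed
  qed
qed

text \<open>For k at most v(p), pO lies in \<open>Pw k\<close>, so \<open>residue_card ^ k\<close>
  incongruent elements are in different classes modulo p, of which there are at most
  \<open>p ^ d\<close>. As the residue field has at least p elements, k = d forces exactly p, k = d
  + 1 is impossible, and equality in the count identifies \<open>Pw d\<close> with pO.\<close>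

lemma total_ramification:
  fixes p :: nat
  assumes p: "prime p" "of_nat p \<in> P" and e: "v (of_nat p) \<ge> int d" and d: "d > 0"
  shows "v (of_nat p) = int d" "residue_card = p"
    "\<And>x. x \<in> Pw d \<Longrightarrow> \<exists>z\<in>OK. x = of_nat p * z"
proof -
  have p0: "(of_nat p :: complex) \<noteq> 0" using prime_gt_0_nat[OF p(1)] by simp
  obtain G where G: "finite G" "card G \<le> p ^ d"
    "\<forall>x\<in>OK. \<exists>y\<in>G. \<exists>z\<in>OK. x = y + of_nat p * z" using residues_OK_prime[OF p(1)] by blast
  then obtain h where "\<forall>x\<in>OK. h x \<in> G \<and> (\<exists>z\<in>OK. x = h x + of_nat p * z)"
    unfolding Bex_def[of G] bchoice_iff by blast
  then have h: "\<And>x. x \<in> OK \<Longrightarrow> h x \<in> G" "\<And>x. x \<in> OK \<Longrightarrow> \<exists>z\<in>OK. x = h x + of_nat p * z"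
    by blast+
  have hd: "\<exists>z\<in>OK. x - y = of_nat p * z" if xy: "x \<in> OK" "y \<in> OK" "h x = h y" for x y
  proof -
    obtain z w where "z \<in> OK" "w \<in> OK" "x = h x + of_nat p * z" "y = h y + of_nat p * w" using h xy by blast
    then have "x - y = of_nat p * (z - w)" using xy(3) by (simp add: algebra_simps)
    then show ?thesis using OK_diff \<open>z \<in> OK\<close> \<open>w \<in> OK\<close> by blast
  qed
  have pk: "of_nat p \<in> Pw k" if "int k \<le> v (of_nat p)" for k
    using that le_int_ord_iff[OF OK_of_nat p0] v_OK[OF OK_of_nat p0] by simp
  have inj: "inj_on h F" if F: "F \<subseteq> OK" "\<forall>x\<in>F. \<forall>y\<in>F. x - y \<in> Pw k \<longrightarrow> x = y"
    and k: "int k \<le> v (of_nat p)" for F k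
  proof (rule inj_onI)
    fix x y assume xy: "x \<in> F" "y \<in> F" "h x = h y"
    then obtain z where "z \<in> OK" "x - y = of_nat p * z" using hd F(1) by blast
    then have "x - y \<in> Pw k" using Pw_mult[OF _ pk[OF k], of z] by (simp add: mult.commute)
    then show "x = y" using F(2) xy by blast
  qed
  have bound: "residue_card ^ k \<le> p ^ d" if k: "int k \<le> v (of_nat p)" for k
  proof -
    obtain F where F: "finite F" "F \<subseteq> OK" "card F = residue_card ^ k"
      "\<forall>x\<in>F. \<forall>y\<in>F. x - y \<in> Pw k \<longrightarrow> x = y" using Pw_reps[of k] by blast
    have "card F = card (h ` F)" using inj[OF F(2,4) k] by (simp add: card_image)
    also have "\<dots> \<le> card G" using F(2) h(1) G(1) by (intro card_mono) auto
    finally show ?thesis using F(3) G(2) by simp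
  qed
  have ge: "p \<le> residue_card" by (rule residue_card_ge[OF p])
  show c: "residue_card = p"
  proof (rule ccontr)
    assume "residue_card \<noteq> p"
    then have "p ^ d < residue_card ^ d" using ge d by (intro power_strict_mono) auto
    then show False using bound[of d] e by simp
  qed
  show "v (of_nat p) = int d"
  proof (rule ccontr)
    assume "v (of_nat p) \<noteq> int d"
    then have "p ^ Suc d \<le> p ^ d" using bound[of "Suc d"] e c by simp
    then show False using prime_gt_1_nat[OF p(1)] power_strict_increasing[of d "Suc d" p] by simp
  qed
  fix x assume x: "x \<in> Pw d"
  then have xO: "x \<in> OK" using Pw_OK by blast
  obtain F where F: "finite F" "F \<subseteq> OK" "card F = residue_card ^ d"
    "\<forall>x\<in>F. \<forall>y\<in>F. x - y \<in> Pw d \<longrightarrow> x = y" using Pw_reps[of d] by blast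
  have "card (h ` F) = p ^ d" using inj[OF F(2,4)] e F(3) c by (simp add: card_image)
  then have hF: "h ` F = G" using F(2) h(1) G(1,2) by (intro card_seteq) auto
  \<comment> \<open>The representatives exhaust all classes modulo p, so each element of
    \<open>Pw d\<close> has the class of a representative in \<open>Pw d\<close>. There is only one
    such representative, hence only the class of 0.\<close>
  have lift: "\<exists>f\<in>F. h f = h w \<and> f \<in> Pw d" if w: "w \<in> Pw d" for w
  proof -
    have wO: "w \<in> OK" using w Pw_OK by blast
    then obtain f where f: "f \<in> F" "h f = h w" using hF h(1)[of w] by auto
    then obtain z where z: "z \<in> OK" "f - w = of_nat p * z" using hd[of f w] wO F(2) by blast
    then have "f - w \<in> Pw d" using Pw_mult[OF _ pk[OF e], of z] by (simp add: mult.commute)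
    then have "f \<in> Pw d" using Pw_add[OF _ w, of "f - w"] by simp
    then show ?thesis using f by blast
  qed
  obtain f where f: "f \<in> F" "h f = h x" "f \<in> Pw d" using lift[OF x] by blast
  obtain g where g: "g \<in> F" "h g = h 0" "g \<in> Pw d" using lift[of 0] ideal_facts(2)[OF ideal_Pw] by blast
  have "f + (- 1) * g \<in> Pw d" by (intro Pw_add Pw_mult f g OK_minus OK_1)
  then have "f = g" using F(4) f(1) g(1) by simp
  then have "h x = h 0" using f g by simp
  from hd[OF xO OK_0 this] show "\<exists>z\<in>OK. x = of_nat p * z" by simp
qed

text \<open>The d-th power of an element of P lies in pO and so in Q; thus Q contains P, which is
  maximal.\<close>

lemma prime_over_unique:
  fixes p :: nat
  assumes p: "prime p" "of_nat p \<in> P" and e: "v (of_nat p) \<ge> int d" and d: "d > 0"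
    and Q: "prime_place K d Q" "of_nat p \<in> Q"
  shows "Q = P"
proof -
  interpret Q: prime_place K d Q by fact
  have PQ: "P \<subseteq> Q"
  proof
    fix x assume x: "x \<in> P"
    then have xO: "x \<in> OK" using P_OK by blast
    show "x \<in> Q"
    proof (cases "x = 0")
      case False
      have "v x \<ge> 1" using v_pos[OF x False] by simp
      then have "v (x ^ d) \<ge> int d" using v_power[OF OK_in[OF xO] False, of d]
        mult_left_mono[of 1 "v x" "int d"] by simp
      then have "x ^ d \<in> Pw d" using le_int_ord_iff[OF OK_power[OF xO], of d d] v_OK[OF OK_power[OF xO]] False by simp
      then obtain z where "z \<in> OK" "x ^ d = of_nat p * z" using total_ramification(3)[OF p e d] by blast
      then have "x ^ d \<in> Q" using Q.P_mult'[OF Q(2)] by simp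
      then show ?thesis using Q.P_power[OF xO] by blast
    qed (simp add: Q.P_0)
  qed
  moreover have "Q \<subseteq> P"
  proof (rule ccontr)
    assume "\<not> Q \<subseteq> P"
    then obtain q where q: "q \<in> Q" "q \<notin> P" by blast
    then have qO: "q \<in> OK" using Q.P_OK by blast
    obtain b where b: "b \<in> OK" "1 - q * b \<in> P" using P_maximal[OF qO q(2)] by blast
    have "(1 - q * b) + q * b \<in> Q" using b PQ Q.P_mult'[OF q(1) b(1)] by (intro Q.P_add) auto
    then show False using Q.one_notin_P by simp
  qed
  ultimately show ?thesis by blast
qed

text \<open>If the order of \<open>\<alpha>\<close> differed from the common slope, one of the terms \<open>\<alpha> ^ n\<close> and \<open>c 0\<close> would
  strictly dominate all the others.\<close>

lemma newton_single_slope: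
  fixes c :: "nat \<Rightarrow> complex"
  assumes n: "n > 0" and \<alpha>: "\<alpha> \<in> K" and cK: "\<And>i. i < n \<Longrightarrow> c i \<in> K"
    and eq: "\<alpha> ^ n + (\<Sum>i<n. c i * \<alpha> ^ i) = 0" and c0: "c 0 \<noteq> 0"
    and slope: "\<And>i. i < n \<Longrightarrow> c i \<noteq> 0 \<Longrightarrow> int n * v (c i) \<ge> int (n - i) * v (c 0)"
  shows "\<alpha> \<noteq> 0" "int n * v \<alpha> = v (c 0)"
proof -
  have split0: "(\<Sum>i<n. c i * \<alpha> ^ i) = c 0 + (\<Sum>i\<in>{1..<n}. c i * \<alpha> ^ i)"
    using n by (simp add: lessThan_atLeast0 sum.atLeast_Suc_lessThan)
  show \<alpha>0: "\<alpha> \<noteq> 0"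
  proof
    assume "\<alpha> = 0"
    then have "(\<Sum>i\<in>{1..<n}. c i * \<alpha> ^ i) = 0" by (intro sum.neutral) auto
    then show False using eq split0 c0 \<open>\<alpha> = 0\<close> zero_power[OF n, where 'a = complex] by simp
  qed
  define l where "l = v \<alpha>"
  define s where "s = v (c 0)"
  have va: "v (\<alpha> ^ i) = int i * l" for i using v_power[OF \<alpha> \<alpha>0] by (simp add: l_def)
  \<comment> \<open>Orders are multiplied by n throughout, which keeps the comparison with the slope
    in the integers.\<close>
  have trm: "int n * v (c i * \<alpha> ^ i) \<ge> int (n - i) * s + int i * (int n * l)"
    if "i < n" "c i \<noteq> 0" for i
  proof -
    have "v (c i * \<alpha> ^ i) = v (c i) + int i * l"
      using that cK \<alpha> \<alpha>0 by (simp add: v_mult power_in va)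
    then show ?thesis using slope[OF that] by (simp add: algebra_simps s_def)
  qed
  have tK: "c i * \<alpha> ^ i \<in> K" if "i < n" for i using that cK \<alpha> by (simp add: mult_in power_in)
  have "\<not> int n * l < s"
  proof
    assume lt: "int n * l < s"
    have "vge (int n * l + 1) (c i * \<alpha> ^ i)" if i: "i < n" for i
    proof (cases "c i = 0")
      case False
      have "int (n - i) * (int n * l) < int (n - i) * s" using lt i by (intro mult_strict_left_mono) auto
      moreover have "int n * (int n * l) = int (n - i) * (int n * l) + int i * (int n * l)"
        using i by (simp flip: distrib_right of_nat_add)
      ultimately have "int n * (int n * l) < int n * v (c i * \<alpha> ^ i)"
        using trm[OF i False] by linarith
      then have "int n * l < v (c i * \<alpha> ^ i)" using n by simp
      then show ?thesis using tK[OF i] by (simp add: vge_def)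
    qed (simp add: vge_def zero_in)
    then have "vge (v (\<alpha> ^ n) + 1) (\<Sum>i<n. c i * \<alpha> ^ i)" unfolding va by (intro vge_sum) auto
    then show False using v_add_dominant(1)[OF power_in[OF \<alpha>]] \<alpha>0 eq by simp
  qed
  moreover have "\<not> int n * l > s"
  proof
    assume gt: "int n * l > s"
    have "vge (s + 1) (c i * \<alpha> ^ i)" if i: "i \<in> {1..<n}" for i
    proof (cases "c i = 0")
      case False
      have "int i * s < int i * (int n * l)" using gt i by (intro mult_strict_left_mono) auto
      moreover have "int n * s = int (n - i) * s + int i * s"
        using i by (simp flip: distrib_right of_nat_add)
      moreover have "int n * v (c i * \<alpha> ^ i) \<ge> int (n - i) * s + int i * (int n * l)"
        by (rule trm) (use False i in auto)
      ultimately have "int n * s < int n * v (c i * \<alpha> ^ i)" by linarith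
      then have "s < v (c i * \<alpha> ^ i)" using n by simp
      then show ?thesis using tK[of i] i by (simp add: vge_def)
    qed (simp add: vge_def zero_in)
    then have "vge (s + 1) (\<Sum>i\<in>{1..<n}. c i * \<alpha> ^ i)" by (intro vge_sum) auto
    moreover have "vge (s + 1) (\<alpha> ^ n)" using gt \<alpha> by (simp add: vge_def va power_in)
    ultimately have "vge (v (c 0) + 1) (\<alpha> ^ n + (\<Sum>i\<in>{1..<n}. c i * \<alpha> ^ i))"
      unfolding s_def using vge_add by blast
    from v_add_dominant(1)[OF cK[OF n] c0 this]
    have "c 0 + (\<alpha> ^ n + (\<Sum>i\<in>{1..<n}. c i * \<alpha> ^ i)) \<noteq> 0" .
    moreover have "c 0 + (\<alpha> ^ n + (\<Sum>i\<in>{1..<n}. c i * \<alpha> ^ i)) = 0"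
      using eq unfolding split0 by (simp only: add.left_commute)
    ultimately show False by contradiction
  qed
  ultimately show "int n * v \<alpha> = v (c 0)" by (simp add: l_def s_def)
qed

text \<open>If \<alpha> had negative order, \<open>\<alpha> ^ n\<close> would have strictly smaller
  order than every other term.\<close>

lemma vge_root:
  fixes c :: "nat \<Rightarrow> complex"
  assumes n: "n > 0" and \<alpha>: "\<alpha> \<in> K" and c: "\<And>i. i < n \<Longrightarrow> vge 0 (c i)"
    and eq: "\<alpha> ^ n + (\<Sum>i<n. c i * \<alpha> ^ i) = 0"
  shows "vge 0 \<alpha>"
proof (rule ccontr)
  assume "\<not> vge 0 \<alpha>"
  then have a: "\<alpha> \<noteq> 0" "v \<alpha> < 0" using \<alpha> by (auto simp: vge_def)
  have va: "v (\<alpha> ^ i) = int i * v \<alpha>" for i using v_power[OF \<alpha> a(1)] .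
  have "vge (v (\<alpha> ^ n) + 1) (c i * \<alpha> ^ i)" if i: "i < n" for i
  proof -
    have "(int i - int n) * v \<alpha> > 0" using i a(2) by (intro mult_neg_neg) auto
    then have "v (\<alpha> ^ n) + 1 \<le> 0 + v (\<alpha> ^ i)" unfolding va by (simp add: algebra_simps)
    moreover have "vge (0 + v (\<alpha> ^ i)) (c i * \<alpha> ^ i)"
      using c[OF i] \<alpha> by (intro vge_mult) (auto simp: vge_def power_in)
    ultimately show ?thesis by (auto simp: vge_def)
  qed
  then have "vge (v (\<alpha> ^ n) + 1) (\<Sum>i<n. c i * \<alpha> ^ i)" by (intro vge_sum) auto
  then show False using v_add_dominant(1)[OF power_in[OF \<alpha>]] a(1) eq by simp
qed

end

context number_field
begin

text \<open>An ideal containing p is determined by the representatives of O/pO that it contains. A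
  proper one with as many of them as possible is therefore maximal, hence prime.\<close>

lemma ex_prime_over:
  fixes p :: nat
  assumes p: "prime p"
  shows "\<exists>P. prime_place K d P \<and> of_nat p \<in> P"
proof -
  interpret R: cring R by (rule R_cring)
  obtain F where F: "finite F" "F \<subseteq> OK" "\<forall>x\<in>OK. \<exists>y\<in>F. \<exists>z\<in>OK. x = y + of_nat p * z"
    using residues_OK[OF prime_gt_0_nat[OF p]] by blast
  define proper where "proper = (\<lambda>I. ideal I R \<and> of_nat p \<in> I \<and> 1 \<notin> I)"
  define I0 where "I0 = {x * of_nat p | x. x \<in> OK}"
  have pR: "of_nat p \<in> carrier R" using OK_of_nat by (simp add: R_simps)
  have "I0 = cgenideal R (of_nat p)" by (simp add: cgenideal_def I0_def R_simps)
  then have "ideal I0 R" using R.cgenideal_ideal[OF pR] by simp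
  moreover have "of_nat p \<in> I0" unfolding I0_def using OK_1 by force
  \<comment> \<open>Otherwise 1 / p would be an algebraic integer.\<close>
  moreover have "1 \<notin> I0"
  proof
    assume "1 \<in> I0"
    then obtain x where x: "x \<in> OK" "1 = x * of_nat p" by (auto simp: I0_def)
    then have "x = of_rat (1 / of_nat p)" using prime_gt_0_nat[OF p] by (simp add: of_rat_divide field_simps)
    then have "x \<in> \<int>" using rational_algebraic_int_is_int[of x] x(1) by (auto simp: OK_def)
    then obtain k where "x = of_int k" by (auto elim: Ints_cases)
    then have "(of_int (k * int p) :: complex) = of_int 1" using x(2) by simp
    then have "k * int p = 1" unfolding of_int_eq_iff .
    then have "int p dvd 1" by (metis dvd_triv_right)
    then show False using prime_gt_1_nat[OF p] by simp
  qed
  ultimately have I0: "proper I0" by (simp add: proper_def)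
  have "\<exists>I. proper I \<and> (\<forall>J. proper J \<longrightarrow> card (J \<inter> F) \<le> card (I \<inter> F))"
    using ex_has_greatest_nat[of proper I0 "\<lambda>I. card (I \<inter> F)" "Suc (card F)"] I0 F(1)
    by (meson card_mono inf_le2 le_imp_less_Suc)
  then obtain I where I: "proper I" and max: "\<And>J. proper J \<Longrightarrow> card (J \<inter> F) \<le> card (I \<inter> F)" by blast
  have idI: "ideal I R" "of_nat p \<in> I" "1 \<notin> I" using I by (auto simp: proper_def)
  have "maximalideal I R"
  proof (rule maximalidealI[OF idI(1)])
    show "carrier R \<noteq> I" using idI(3) OK_1 by (auto simp: R_simps)
    fix J assume J: "ideal J R" "I \<subseteq> J" "J \<subseteq> carrier R"
    show "J = I \<or> J = carrier R"
    proof (cases "1 \<in> J")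
      case True
      have "carrier R \<subseteq> J"
      proof
        fix x assume "x \<in> carrier R"
        then have "x * 1 \<in> J" using ideal_facts(4)[OF J(1) _ True, of x] by (simp add: R_simps)
        then show "x \<in> J" by simp
      qed
      then show ?thesis using J(3) by blast
    next
      case False
      then have "proper J" using J idI(2) by (auto simp: proper_def)
      then have eq: "J \<inter> F = I \<inter> F"
        using max[of J] J(2) F(1) card_seteq[of "J \<inter> F" "I \<inter> F"] by auto
      have "J \<subseteq> I"
      proof
        fix x assume x: "x \<in> J"
        then obtain y z where yz: "y \<in> F" "z \<in> OK" "x = y + of_nat p * z"
          using F(3) ideal_facts(1)[OF J(1)] by blast
        have zI: "z * of_nat p \<in> I" by (rule ideal_facts(4)[OF idI(1) yz(2) idI(2)])
        have "- 1 * (z * of_nat p) \<in> J"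
          using ideal_facts(4)[OF J(1) OK_minus[OF OK_1]] zI J(2) by blast
        then have "x + - 1 * (z * of_nat p) \<in> J" using ideal_facts(3)[OF J(1) x] by blast
        then have "y \<in> J" using yz(3) by (simp add: algebra_simps)
        then have "y \<in> I" using eq yz(1) by blast
        then show "x \<in> I" using ideal_facts(3)[OF idI(1) _ zI] yz(3) by (simp add: mult.commute)
      qed
      then show ?thesis using J(2) by blast
    qed
  qed
  then have "primeideal I R" by (rule R.maximalideal_prime)
  moreover have "I \<noteq> {0}" using idI(2) prime_gt_0_nat[OF p] by auto
  ultimately have "prime_place K d I"
    by unfold_locales (simp add: finite_primes_def)
  then show ?thesis using idI(2) by blast
qed

end

subsection \<open>Simple extensions of the rationals\<close>

definition reval :: "rat poly \<Rightarrow> complex \<Rightarrow> complex" where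
  "reval g x = poly (map_poly of_rat g) x"

lemma reval_0 [simp]: "reval 0 x = 0"
  by (simp add: reval_def)

lemma reval_pCons [simp]: "reval (pCons a g) x = of_rat a + x * reval g x"
proof -
  have "map_poly (of_rat :: rat \<Rightarrow> complex) (pCons a g) = pCons (of_rat a) (map_poly of_rat g)"
    by (intro poly_eqI) (auto simp: coeff_map_poly coeff_pCons split: nat.split)
  then show ?thesis by (simp add: reval_def)
qed

lemma reval_add: "reval (g + h) x = reval g x + reval h x"
  by (induction g h rule: poly_induct2) (auto simp: of_rat_add algebra_simps)

lemma reval_smult: "reval (Polynomial.smult a g) x = of_rat a * reval g x"
  by (induction g) (auto simp: of_rat_mult algebra_simps)

lemma reval_minus: "reval (- g) x = - reval g x"
  by (induction g) (auto simp: of_rat_minus)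

lemma reval_diff: "reval (g - h) x = reval g x - reval h x"
  using reval_add[of g "- h" x] by (simp add: reval_minus)

lemma reval_mult: "reval (g * h) x = reval g x * reval h x"
proof (induction g)
  case (pCons a g)
  then show ?case by (simp add: mult_pCons_left reval_add reval_smult ring_distribs mult.assoc)
qed simp

lemma reval_1 [simp]: "reval 1 x = 1"
  using reval_pCons[of 1 0 x] by simp

lemma reval_monom: "reval (monom a k) x = of_rat a * x ^ k"
  by (induction k) (auto simp: monom_0 monom_Suc)

lemma reval_sum: "reval (\<Sum>i\<in>I. f i) x = (\<Sum>i\<in>I. reval (f i) x)"
  by (induction I rule: infinite_finite_induct) (auto simp: reval_add)

lemma reval_altdef: "reval g x = (\<Sum>i\<le>degree g. of_rat (coeff g i) * x ^ i)"
  by (subst poly_as_sum_of_monoms[of g, symmetric]) (simp add: reval_sum reval_monom del: poly_as_sum_of_monoms)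

lemma cnj_of_rat: "cnj (of_rat q) = of_rat q"
  by (cases q) (simp add: of_rat_rat)

lemma reval_cnj: "reval g (cnj x) = cnj (reval g x)"
  by (induction g) (auto simp: cnj_of_rat)

text \<open>Values of polynomials only; that they form a field is established within
  \<open>minimal_poly\<close>.\<close>

definition adjoin :: "complex \<Rightarrow> complex set" where
  "adjoin \<alpha> = range (\<lambda>g. reval g \<alpha>)"

lemma C_simps: "carrier complex_ring = UNIV" "x \<otimes>\<^bsub>complex_ring\<^esub> y = x * y"
  "x \<oplus>\<^bsub>complex_ring\<^esub> y = x + y" "\<one>\<^bsub>complex_ring\<^esub> = 1" "\<zero>\<^bsub>complex_ring\<^esub> = 0"
  by (auto simp: ring_of_type_algebra_def)

lemma C_field: "field complex_ring"
  by (rule field_from_type_algebra)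

lemma C_m_inv: "x \<noteq> 0 \<Longrightarrow> inv\<^bsub>complex_ring\<^esub> x = inverse x"
  unfolding m_inv_def C_simps by (rule the_equality) (auto simp: field_simps)

lemma C_a_inv: "\<ominus>\<^bsub>complex_ring\<^esub> x = - x"
proof -
  interpret field complex_ring by (rule C_field)
  have "\<ominus>\<^bsub>complex_ring\<^esub> x \<oplus>\<^bsub>complex_ring\<^esub> x = \<zero>\<^bsub>complex_ring\<^esub>" by (rule l_neg) (simp add: C_simps)
  then show ?thesis by (simp add: C_simps eq_neg_iff_add_eq_0)
qed

text \<open>Minimality is expressed by degrees, so that division with remainder takes the place of
  irreducibility, and comparison of degrees suffices to establish it.\<close>

locale minimal_poly =
  fixes \<alpha> :: complex and F :: "rat poly" and m :: nat
  assumes F: "lead_coeff F = 1" "degree F = m" "reval F \<alpha> = 0"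
    and minimal: "\<And>g. reval g \<alpha> = 0 \<Longrightarrow> g \<noteq> 0 \<Longrightarrow> m \<le> degree g"
begin

lemma F_nz: "F \<noteq> 0" using F(1) by auto

lemma m_pos: "m > 0"
proof (rule ccontr)
  assume "\<not> m > 0"
  then have "degree F = 0" using F(2) by simp
  then obtain a where "F = [:a:]" by (elim degree_eq_zeroE)
  then show False using F by simp
qed

lemma reval_mod: "reval g \<alpha> = reval (g mod F) \<alpha>"
proof -
  have "reval g \<alpha> = reval (g div F * F + g mod F) \<alpha>" by simp
  then show ?thesis by (simp only: reval_add reval_mult F(3)) simp
qed

lemma mod_cases: "g mod F = 0 \<or> degree (g mod F) < m"
  using degree_mod_less[OF F_nz] F(2) by blast

lemma reval_eq_0_imp_dvd: "reval g \<alpha> = 0 \<Longrightarrow> F dvd g"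
  using minimal[of "g mod F"] reval_mod mod_cases by (metis dvd_eq_mod_eq_0 leD)

text \<open>The gcd D of F and g does not vanish at \<alpha>, so the cofactor F / D does and has
  full degree by minimality. Hence D is constant, and a Bezout identity supplies the
  inverse.\<close>

lemma reval_inverse: "\<exists>h. inverse (reval g \<alpha>) = reval h \<alpha>"
proof (cases "reval g \<alpha> = 0")
  case True
  then show ?thesis by (metis inverse_zero reval_0)
next
  case False
  define D where "D = gcd F g"
  have "D dvd F" "D dvd g" by (auto simp: D_def)
  then obtain e where e: "F = D * e" by (elim dvdE)
  have "D \<noteq> 0" "e \<noteq> 0" using e F_nz by auto
  have Dn: "reval D \<alpha> \<noteq> 0"
  proof
    assume "reval D \<alpha> = 0"
    moreover obtain u where "g = D * u" using \<open>D dvd g\<close> by (elim dvdE)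
    ultimately show False using False by (simp add: reval_mult)
  qed
  then have "reval e \<alpha> = 0" using F(3) e by (simp add: reval_mult)
  then have "m \<le> degree e" using minimal \<open>e \<noteq> 0\<close> by blast
  moreover have "degree F = degree D + degree e" using e \<open>D \<noteq> 0\<close> \<open>e \<noteq> 0\<close> degree_mult_eq by metis
  ultimately have "degree D = 0" using F(2) by simp
  then obtain a where a: "D = [:a:]" by (elim degree_eq_zeroE)
  then have a0: "a \<noteq> 0" using \<open>D \<noteq> 0\<close> by auto
  obtain u w where uw: "u * F + w * g = D"
    using bezout_coefficients_fst_snd[of F g] D_def by metis
  have "reval w \<alpha> * reval g \<alpha> = of_rat a"
    using arg_cong[OF uw, of "\<lambda>p. reval p \<alpha>"] F(3) a by (simp add: reval_add reval_mult)
  then have "inverse (reval g \<alpha>) = of_rat (1 / a) * reval w \<alpha>"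
    using False a0 by (simp add: field_simps of_rat_divide)
  then have "inverse (reval g \<alpha>) = reval (Polynomial.smult (1 / a) w) \<alpha>" by (simp add: reval_smult)
  then show ?thesis by blast
qed

sublocale number_field "adjoin \<alpha>" m
proof
  show "0 \<in> adjoin \<alpha>" unfolding adjoin_def by (rule range_eqI[of _ _ 0]) simp
  show "1 \<in> adjoin \<alpha>" unfolding adjoin_def by (rule range_eqI[of _ _ 1]) simp
  fix x assume "x \<in> adjoin \<alpha>"
  then obtain g where g: "x = reval g \<alpha>" by (auto simp: adjoin_def)
  show "- x \<in> adjoin \<alpha>" unfolding adjoin_def by (rule range_eqI[of _ _ "- g"]) (simp add: g reval_minus)
  show "inverse x \<in> adjoin \<alpha>" using reval_inverse[of g] by (auto simp: g adjoin_def)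
  fix y assume "y \<in> adjoin \<alpha>"
  then obtain h where h: "y = reval h \<alpha>" by (auto simp: adjoin_def)
  show "x + y \<in> adjoin \<alpha>" unfolding adjoin_def by (rule range_eqI[of _ _ "g + h"]) (simp add: g h reval_add)
  show "x * y \<in> adjoin \<alpha>" unfolding adjoin_def by (rule range_eqI[of _ _ "g * h"]) (simp add: g h reval_mult)
next
  define T where "T = (\<lambda>i. \<alpha> ^ i) ` {..<m}"
  have "card T \<le> m" unfolding T_def using card_image_le[of "{..<m}"] by (metis card_lessThan finite_lessThan)
  moreover have "adjoin \<alpha> \<subseteq> ratc.span T"
  proof
    fix x assume "x \<in> adjoin \<alpha>"
    then obtain g where "x = reval g \<alpha>" by (auto simp: adjoin_def)
    then have x: "x = reval (g mod F) \<alpha>" using reval_mod by simp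
    have "reval (g mod F) \<alpha> \<in> ratc.span T"
      unfolding reval_altdef
    proof (rule ratc.span_sum)
      fix i assume "i \<in> {..degree (g mod F)}"
      then have "i < m" using mod_cases[of g] m_pos by auto
      then show "of_rat (coeff (g mod F) i) * \<alpha> ^ i \<in> ratc.span T"
        by (intro ratc.span_scale ratc.span_base) (auto simp: T_def)
    qed
    then show "x \<in> ratc.span T" by (simp add: x)
  qed
  ultimately show "\<exists>T. finite T \<and> card T \<le> m \<and> adjoin \<alpha> \<subseteq> ratc.span T"
    by (intro exI[of _ T]) (auto simp: T_def)
qed

lemma self_in_adjoin: "\<alpha> \<in> adjoin \<alpha>"
  unfolding adjoin_def by (rule range_eqI[of _ _ "[:0, 1:]"]) simp

lemma generate_field_subset:
  assumes "y \<in> adjoin \<alpha>"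
  shows "generate_field complex_ring {y} \<subseteq> adjoin \<alpha>"
proof
  fix x assume "x \<in> generate_field complex_ring {y}"
  then show "x \<in> adjoin \<alpha>"
    by (induction rule: generate_field.induct)
       (use assms in \<open>auto simp: C_simps C_a_inv C_m_inv one_in minus_in inverse_in add_in mult_in\<close>)
qed

end

lemma rat_in_generate_field: "of_rat q \<in> generate_field complex_ring H"
proof -
  have n: "of_nat k \<in> generate_field complex_ring H" for k
  proof (induction k)
    case 0
    show ?case using field.zero_in_generate[OF C_field, of H] by (simp add: C_simps)
  next
    case (Suc k)
    show ?case using generate_field.eng_add[OF generate_field.one[of complex_ring H] Suc]
      by (simp add: C_simps)
  qed
  have i: "of_int k \<in> generate_field complex_ring H" for k
    using n[of "nat k"] generate_field.a_inv[OF n[of "nat (- k)"]]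
    by (cases "k \<ge> 0") (auto simp: C_a_inv)
  show ?thesis
  proof (cases q)
    case (Fract a b)
    then have "(of_rat q :: complex) = of_int a * inverse (of_int b)"
      by (simp add: of_rat_rat divide_inverse)
    moreover have "inverse (of_int b) \<in> generate_field complex_ring H"
      using generate_field.m_inv[OF i[of b]] Fract(2) by (simp add: C_simps C_m_inv)
    ultimately show ?thesis using generate_field.eng_mult[OF i[of a]] by (simp add: C_simps)
  qed
qed

lemma adjoin_subset_generate_field:
  assumes "\<alpha> \<in> generate_field complex_ring H"
  shows "adjoin \<alpha> \<subseteq> generate_field complex_ring H"
proof -
  have "reval g \<alpha> \<in> generate_field complex_ring H" for g
  proof (induction g)
    case 0
    show ?case using rat_in_generate_field[of 0 H] by simp
  next
    case (pCons a g)
    show ?case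
      using generate_field.eng_add[OF rat_in_generate_field[of a H] generate_field.eng_mult[OF assms pCons(2)]]
      by (simp add: C_simps)
  qed
  then show ?thesis by (auto simp: adjoin_def)
qed

text \<open>\<alpha> is recovered from its affine image by rational operations. Both heights in
  \<open>height_ab\<close> can therefore be computed over one field.\<close>

lemma (in minimal_poly) generate_field_affine:
  assumes "a \<noteq> 0"
  shows "generate_field complex_ring {of_rat a * \<alpha> + of_rat b} = adjoin \<alpha>"
proof
  let ?y = "of_rat a * \<alpha> + of_rat b"
  let ?G = "generate_field complex_ring {?y}"
  show "?G \<subseteq> adjoin \<alpha>"
    by (rule generate_field_subset) (auto intro!: add_in mult_in of_rat_in self_in_adjoin)
  have "?y \<in> ?G" by (rule generate_field.incl) simp
  then have "?y + of_rat (- b) \<in> ?G"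
    using generate_field.eng_add rat_in_generate_field[of "- b"] by (metis C_simps(3))
  then have "(?y + of_rat (- b)) * of_rat (1 / a) \<in> ?G"
    using generate_field.eng_mult rat_in_generate_field[of "1 / a"] by (metis C_simps(2))
  moreover have "(?y + of_rat (- b)) * of_rat (1 / a) = \<alpha>"
    using assms by (simp add: of_rat_minus of_rat_divide)
  ultimately show "adjoin \<alpha> \<subseteq> ?G" using adjoin_subset_generate_field by simp
qed

lemma ex_minimal_poly:
  assumes "reval G \<alpha> = 0" "G \<noteq> 0"
  shows "\<exists>F m. minimal_poly \<alpha> F m \<and> m \<le> degree G"
proof -
  define P where "P = (\<lambda>k. \<exists>g. reval g \<alpha> = 0 \<and> g \<noteq> 0 \<and> degree g = k)"
  define m where "m = (LEAST k. P k)"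
  have "P (degree G)" using assms by (auto simp: P_def)
  then have "P m" and le: "m \<le> degree G" unfolding m_def by (auto intro: LeastI Least_le)
  then obtain g where g: "reval g \<alpha> = 0" "g \<noteq> 0" "degree g = m" by (auto simp: P_def)
  define c where "c = 1 / lead_coeff g"
  have c: "c \<noteq> 0" "c * lead_coeff g = 1" using g(2) by (auto simp: c_def)
  have "minimal_poly \<alpha> (Polynomial.smult c g) m"
  proof
    show "lead_coeff (Polynomial.smult c g) = 1" using c by simp
    show "degree (Polynomial.smult c g) = m" using g c by simp
    show "reval (Polynomial.smult c g) \<alpha> = 0" using g by (simp add: reval_smult)
    fix h assume "reval h \<alpha> = 0" "h \<noteq> 0"
    then have "P (degree h)" by (auto simp: P_def)
    then show "m \<le> degree h" unfolding m_def by (rule Least_le)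
  qed
  then show ?thesis using le by blast
qed

lemma Rats_subfield: "subfield \<rat> complex_ring"
proof -
  interpret field complex_ring by (rule C_field)
  show ?thesis
  proof (rule subfieldI')
    show "subring \<rat> complex_ring"
      by (rule subringI) (auto simp: C_simps C_a_inv)
    fix k assume "k \<in> \<rat> - {\<zero>\<^bsub>complex_ring\<^esub>}"
    then show "inv\<^bsub>complex_ring\<^esub> k \<in> \<rat>" by (auto simp: C_simps C_m_inv)
  qed
qed

text \<open>The powers of \<alpha> below m are a basis: division by F reduces every polynomial to
  degree below m, and a linear relation among them would contradict minimality.\<close>

lemma (in minimal_poly) field_degree_adjoin: "field_degree (adjoin \<alpha>) = m"
proof -
  interpret C: field complex_ring by (rule C_field)
  \<comment> \<open>The highest exponent comes first, so that raising k puts one vector in front and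
    enlarges the span by a single line extension.\<close>
  define Us where "Us = (\<lambda>k. map (\<lambda>i. \<alpha> ^ i) (rev [0..<k]))"
  have Us_Suc: "Us (Suc k) = \<alpha> ^ k # Us k" for k by (simp add: Us_def)
  define V where "V = (\<lambda>k. {reval g \<alpha> | g. \<forall>i\<ge>k. coeff g i = 0})"
  have Span: "C.Span \<rat> (Us k) = V k" for k
  proof (induction k)
    case 0
    have "(\<forall>i. coeff g i = 0) \<longleftrightarrow> g = 0" for g :: "rat poly" by (auto simp: poly_eq_iff)
    then show ?case by (auto simp: Us_def V_def C_simps)
  next
    case (Suc k)
    have Sp: "C.Span \<rat> (Us (Suc k)) = C.line_extension \<rat> (\<alpha> ^ k) (C.Span \<rat> (Us k))"
      by (simp add: Us_Suc)
    show ?case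
    proof (intro Set.set_eqI iffI)
      fix x assume "x \<in> C.Span \<rat> (Us (Suc k))"
      then obtain c w where cw: "c \<in> \<rat>" "w \<in> V k" "x = c * \<alpha> ^ k + w"
        unfolding Sp Suc C.line_extension_mem_iff C_simps by blast
      obtain q where q: "c = of_rat q" using cw(1) by (rule Rats_cases)
      obtain g where "x = of_rat q * \<alpha> ^ k + reval g \<alpha>" "\<forall>i\<ge>k. coeff g i = 0"
        using cw q by (auto simp: V_def)
      then have "x = reval (monom q k + g) \<alpha>" "\<forall>i\<ge>Suc k. coeff (monom q k + g) i = 0"
        by (auto simp: reval_add reval_monom)
      then show "x \<in> V (Suc k)" unfolding V_def by blast
    next
      fix x assume "x \<in> V (Suc k)"
      then obtain g where g: "x = reval g \<alpha>" "\<forall>i\<ge>Suc k. coeff g i = 0" by (auto simp: V_def)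
      define g' where "g' = g - monom (coeff g k) k"
      have "\<forall>i\<ge>k. coeff g' i = 0"
      proof (intro allI impI)
        fix i assume "k \<le> i"
        then show "coeff g' i = 0" using g(2) by (cases "i = k") (auto simp: g'_def)
      qed
      then have "reval g' \<alpha> \<in> V k" by (auto simp: V_def)
      moreover have "x = of_rat (coeff g k) * \<alpha> ^ k + reval g' \<alpha>"
        by (simp add: g g'_def reval_diff reval_monom)
      ultimately show "x \<in> C.Span \<rat> (Us (Suc k))"
        unfolding Sp C.line_extension_mem_iff C_simps Suc
        by (intro bexI[of _ "of_rat (coeff g k)"] bexI[of _ "reval g' \<alpha>"]) auto
    qed
  qed
  have ind: "k \<le> m \<Longrightarrow> C.independent \<rat> (Us k)" for k
  proof (induction k)
    case 0
    then show ?case by (simp add: Us_def)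
  next
    case (Suc k)
    have "\<alpha> ^ k \<notin> V k"
    proof
      assume "\<alpha> ^ k \<in> V k"
      then obtain g where g: "\<alpha> ^ k = reval g \<alpha>" "\<forall>i\<ge>k. coeff g i = 0" by (auto simp: V_def)
      define h where "h = monom 1 k - g"
      have "reval h \<alpha> = 0" using g by (simp add: h_def reval_diff reval_monom)
      moreover have "coeff h k = 1" using g by (simp add: h_def)
      then have "h \<noteq> 0" by auto
      ultimately have "m \<le> degree h" by (rule minimal)
      moreover have "degree h \<le> k" by (rule degree_le) (use g in \<open>auto simp: h_def\<close>)
      ultimately show False using Suc.prems by simp
    qed
    then have nS: "\<alpha> ^ k \<notin> C.Span \<rat> (Us k)" unfolding Span .
    have "C.independent \<rat> (Us k)" using Suc by simp
    moreover have "\<alpha> ^ k \<in> carrier complex_ring" by (simp add: C_simps)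
    ultimately show ?case unfolding Us_Suc using nS C.li_Cons by metis
  qed
  have "V m = adjoin \<alpha>"
  proof
    show "V m \<subseteq> adjoin \<alpha>" by (auto simp: V_def adjoin_def)
    show "adjoin \<alpha> \<subseteq> V m"
    proof
      fix x assume "x \<in> adjoin \<alpha>"
      then obtain g where "x = reval g \<alpha>" by (auto simp: adjoin_def)
      then have "x = reval (g mod F) \<alpha>" using reval_mod by simp
      moreover have "\<forall>i\<ge>m. coeff (g mod F) i = 0"
        using mod_cases[of g] by (auto intro: coeff_eq_0)
      ultimately show "x \<in> V m" unfolding V_def by blast
    qed
  qed
  have "C.dimension (length (Us m)) \<rat> (C.Span \<rat> (Us m))"
    by (rule C.dimension_independent[OF ind[OF order_refl]])
  then have dim: "C.dimension m \<rat> (adjoin \<alpha>)"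
    unfolding Span \<open>V m = adjoin \<alpha>\<close> by (simp add: Us_def)
  show ?thesis
    unfolding field_degree_def C.dim_def
  proof (rule the_equality)
    show "C.dimension m \<rat> (adjoin \<alpha>)" by (rule dim)
    fix j assume "C.dimension j \<rat> (adjoin \<alpha>)"
    from C.dimension_is_inj[OF Rats_subfield this dim] show "j = m" .
  qed
qed

subsection \<open>Archimedean places and the height formula\<close>

lemma log_plus_power2: "t \<ge> 0 \<Longrightarrow> log_plus (t\<^sup>2) = 2 * log_plus t"
  by (auto simp: log_plus_def ln_realpow)

lemma log_plus_le_1: "0 \<le> t \<Longrightarrow> t \<le> 1 \<Longrightarrow> log_plus t = 0"
  by (auto simp: log_plus_def)

context prime_place
begin

lemma prime_abs_eq: "x \<in> K \<Longrightarrow> x \<noteq> 0 \<Longrightarrow> prime_abs K P x = real residue_card powi (- v x)"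
  by (simp add: prime_abs_def)

lemma prime_abs_nonneg: "prime_abs K P x \<ge> 0"
  by (simp add: prime_abs_def)

lemma prime_abs_le_1: assumes "vge 0 x" shows "prime_abs K P x \<le> 1"
proof (cases "x = 0")
  case False
  then have "v x \<ge> 0" "x \<in> K" using assms by (auto simp: vge_def)
  have "real residue_card powi (v x) \<ge> 1"
    using residue_card_pos \<open>v x \<ge> 0\<close> by (intro one_le_power_int) auto
  then show ?thesis using prime_abs_eq[OF \<open>x \<in> K\<close> False] by (simp add: power_int_minus inverse_le_1_iff)
qed (simp add: prime_abs_def)

lemma residue_card_gt_1: "residue_card > 1"
proof -
  obtain p :: nat where "prime p" "of_nat p \<in> P" by (rule rational_prime_in_P)
  then show ?thesis using residue_card_ge prime_gt_1_nat by (meson order.strict_trans2)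
qed

lemma prime_abs_less_1: assumes "x \<in> P" "x \<noteq> 0" shows "prime_abs K P x < 1"
proof -
  have "x \<in> K" using assms P_OK OK_in by blast
  have "real residue_card powi (v x) > 1"
    using residue_card_gt_1 v_pos[OF assms] by (intro one_less_power_int) auto
  then show ?thesis using prime_abs_eq[OF \<open>x \<in> K\<close> assms(2)] by (simp add: power_int_minus inverse_less_1_iff)
qed

lemma prime_abs_unit: "x \<in> OK \<Longrightarrow> x \<notin> P \<Longrightarrow> prime_abs K P x = 1"
  using P_0 by (subst prime_abs_eq) (auto simp: OK_in v_unit)

lemma prime_in_place_unique:
  fixes p q :: nat
  assumes "prime p" "prime q" "of_nat p \<in> P" "of_nat q \<in> P" shows "p = q"
  using coprime_notin_P[OF assms(1,3), of "int q"] assms primes_dvd_imp_eq[of p q] by auto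

end

lemma ring_hom_on_rationals:
  assumes s: "\<sigma> \<in> ring_hom (subfield_ring K) complex_ring" and "number_field K d"
  shows "\<sigma> (of_rat q) = of_rat q"
proof -
  interpret number_field K d by fact
  have add: "\<sigma> (x + y) = \<sigma> x + \<sigma> y" if "x \<in> K" "y \<in> K" for x y
    using s that by (auto simp: Ring.ring_hom_def C_simps)
  have mult: "\<sigma> (x * y) = \<sigma> x * \<sigma> y" if "x \<in> K" "y \<in> K" for x y
    using s that by (auto simp: Ring.ring_hom_def C_simps)
  have one: "\<sigma> 1 = 1" using s by (auto simp: Ring.ring_hom_def C_simps)
  have zero: "\<sigma> 0 = 0" using add[OF zero_in zero_in] by simp
  have n: "\<sigma> (of_nat k) = of_nat k" for k
    by (induction k) (auto simp: zero one add of_nat_in one_in)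
  have minus: "\<sigma> (- x) = - \<sigma> x" if "x \<in> K" for x
    using add[OF that minus_in[OF that]] zero by (simp add: eq_neg_iff_add_eq_0 add.commute)
  have i: "\<sigma> (of_int k) = of_int k" for k
    using n[of "nat k"] minus[OF of_nat_in[of "nat (- k)"]] n[of "nat (- k)"]
    by (cases "k \<ge> 0") auto
  show ?thesis
  proof (cases q)
    case (Fract a b)
    have "\<sigma> (of_int b * of_rat q) = of_int b * \<sigma> (of_rat q)" using mult[OF of_int_in of_rat_in] i by simp
    moreover have "(of_int b * of_rat q :: complex) = of_int a"
      using Fract by (simp add: of_rat_rat)
    ultimately show ?thesis using i[of a] Fract by (simp add: of_rat_rat field_simps)
  qed
qed

section \<open>Complex embeddings and archimedean places\<close>

context minimal_poly
begin

text \<open>The embedding taking \<alpha> to \<beta>. Two polynomials representing x differ by a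
  multiple of F, so the choice is immaterial when \<beta> is a root of F.\<close>

definition "emb \<beta> x = reval (SOME g. reval g \<alpha> = x) \<beta>"

definition "Z = {\<beta>. reval F \<beta> = 0}"

lemma emb_reval:
  assumes "\<beta> \<in> Z" shows "emb \<beta> (reval g \<alpha>) = reval g \<beta>"
proof -
  define h where "h = (SOME h. reval h \<alpha> = reval g \<alpha>)"
  have "reval h \<alpha> = reval g \<alpha>" unfolding h_def by (rule someI[of _ g]) simp
  then have "F dvd h - g" by (intro reval_eq_0_imp_dvd) (simp add: reval_diff)
  then obtain u where "h - g = F * u" by (elim dvdE)
  then have "reval (h - g) \<beta> = 0" using assms by (simp add: Z_def reval_mult)
  then show ?thesis by (simp add: emb_def h_def reval_diff)
qed

lemma finite_Z: "finite Z"
proof -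
  have "map_poly of_rat F \<noteq> (0 :: complex poly)"
    using F(1) by (metis coeff_0 coeff_map_poly of_rat_0 of_rat_1 zero_neq_one)
  from poly_roots_finite[OF this] show ?thesis by (simp add: Z_def reval_def)
qed

lemma emb_ring_hom:
  assumes "\<beta> \<in> Z" shows "emb \<beta> \<in> ring_hom (subfield_ring (adjoin \<alpha>)) complex_ring"
proof (rule ring_hom_memI)
  fix x y assume "x \<in> carrier (subfield_ring (adjoin \<alpha>))" "y \<in> carrier (subfield_ring (adjoin \<alpha>))"
  then obtain g h where gh: "x = reval g \<alpha>" "y = reval h \<alpha>" by (auto simp: adjoin_def)
  have "emb \<beta> (reval (g * h) \<alpha>) = reval (g * h) \<beta>" "emb \<beta> (reval (g + h) \<alpha>) = reval (g + h) \<beta>"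
    using emb_reval[OF assms] by auto
  then have "emb \<beta> (x * y) = emb \<beta> x * emb \<beta> y" "emb \<beta> (x + y) = emb \<beta> x + emb \<beta> y"
    unfolding reval_mult reval_add gh[symmetric] using emb_reval[OF assms] gh by auto
  then show "emb \<beta> (x \<otimes>\<^bsub>subfield_ring (adjoin \<alpha>)\<^esub> y) = emb \<beta> x \<otimes>\<^bsub>complex_ring\<^esub> emb \<beta> y"
    "emb \<beta> (x \<oplus>\<^bsub>subfield_ring (adjoin \<alpha>)\<^esub> y) = emb \<beta> x \<oplus>\<^bsub>complex_ring\<^esub> emb \<beta> y"
    by (simp_all add: C_simps)
next
  show "emb \<beta> \<one>\<^bsub>subfield_ring (adjoin \<alpha>)\<^esub> = \<one>\<^bsub>complex_ring\<^esub>"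
    using emb_reval[OF assms, of 1] by (simp add: C_simps)
qed (simp add: C_simps)

lemma ring_hom_reval:
  assumes s: "\<sigma> \<in> ring_hom (subfield_ring (adjoin \<alpha>)) complex_ring"
  shows "\<sigma> (reval g \<alpha>) = reval g (\<sigma> \<alpha>)"
proof (induction g)
  case 0
  show ?case using ring_hom_on_rationals[OF s number_field_axioms, of 0] by simp
next
  case (pCons a g)
  have add: "\<sigma> (x + y) = \<sigma> x + \<sigma> y" if "x \<in> adjoin \<alpha>" "y \<in> adjoin \<alpha>" for x y
    using s that by (auto simp: Ring.ring_hom_def C_simps)
  have mult: "\<sigma> (x * y) = \<sigma> x * \<sigma> y" if "x \<in> adjoin \<alpha>" "y \<in> adjoin \<alpha>" for x y
    using s that by (auto simp: Ring.ring_hom_def C_simps)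
  have gA: "reval g \<alpha> \<in> adjoin \<alpha>" by (simp add: adjoin_def)
  show ?case
    using pCons(2) ring_hom_on_rationals[OF s number_field_axioms, of a]
    by (simp add: add mult gA self_in_adjoin mult_in of_rat_in)
qed

lemma ring_hom_root: 
  assumes s: "\<sigma> \<in> ring_hom (subfield_ring (adjoin \<alpha>)) complex_ring"
  shows "\<sigma> \<alpha> \<in> Z"
  using ring_hom_reval[OF s, of F] ring_hom_on_rationals[OF s number_field_axioms, of 0] F(3)
  by (simp add: Z_def)

lemma embedding_abs_emb:
  assumes b: "\<beta> \<in> Z"
  shows "embedding_abs (adjoin \<alpha>) (emb \<beta>) x =
    (if x \<in> adjoin \<alpha> then if \<beta> \<in> \<real> then cmod (emb \<beta> x) else (cmod (emb \<beta> x))\<^sup>2 else 0)"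
proof -
  have "emb \<beta> ` adjoin \<alpha> \<subseteq> \<real> \<longleftrightarrow> \<beta> \<in> \<real>"
  proof
    have "emb \<beta> \<alpha> = \<beta>" using emb_reval[OF b, of "[:0, 1:]"] by simp
    then show "emb \<beta> ` adjoin \<alpha> \<subseteq> \<real> \<Longrightarrow> \<beta> \<in> \<real>" using self_in_adjoin by force
    assume "\<beta> \<in> \<real>"
    then have "cnj (reval g \<beta>) = reval g \<beta>" for g
      using reval_cnj[of g \<beta>] Reals_cnj_iff by metis
    then have "reval g \<beta> \<in> \<real>" for g using Reals_cnj_iff by blast
    then show "emb \<beta> ` adjoin \<alpha> \<subseteq> \<real>" using emb_reval[OF b] by (auto simp: adjoin_def)
  qed
  then show ?thesis by (simp add: embedding_abs_def)
qed

text \<open>A ring homomorphism is arbitrary outside the field, but \<open>embedding_abs\<close> is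
  0 there; so the place depends only on the image of \<alpha>.\<close>

lemma arch_places: "embedding_abs (adjoin \<alpha>) ` ring_hom (subfield_ring (adjoin \<alpha>)) complex_ring
    = (\<lambda>\<beta>. embedding_abs (adjoin \<alpha>) (emb \<beta>)) ` Z"
proof (intro subset_antisym subsetI)
  fix w assume "w \<in> (\<lambda>\<beta>. embedding_abs (adjoin \<alpha>) (emb \<beta>)) ` Z"
  then show "w \<in> embedding_abs (adjoin \<alpha>) ` ring_hom (subfield_ring (adjoin \<alpha>)) complex_ring"
    using emb_ring_hom by blast
next
  fix w assume "w \<in> embedding_abs (adjoin \<alpha>) ` ring_hom (subfield_ring (adjoin \<alpha>)) complex_ring"
  then obtain \<sigma> where s: "\<sigma> \<in> ring_hom (subfield_ring (adjoin \<alpha>)) complex_ring"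
    "w = embedding_abs (adjoin \<alpha>) \<sigma>" by blast
  have eq: "\<sigma> x = emb (\<sigma> \<alpha>) x" if "x \<in> adjoin \<alpha>" for x
    using that ring_hom_reval[OF s(1)] emb_reval[OF ring_hom_root[OF s(1)]] by (auto simp: adjoin_def)
  then have "\<sigma> ` adjoin \<alpha> = emb (\<sigma> \<alpha>) ` adjoin \<alpha>" by (intro image_cong) auto
  then have "w = embedding_abs (adjoin \<alpha>) (emb (\<sigma> \<alpha>))"
    unfolding s(2) embedding_abs_def using eq by (auto simp: fun_eq_iff)
  then show "w \<in> (\<lambda>\<beta>. embedding_abs (adjoin \<alpha>) (emb \<beta>)) ` Z" using ring_hom_root[OF s(1)] by blast
qed

lemma emb_cnj: "\<beta> \<in> Z \<Longrightarrow> cnj \<beta> \<in> Z" "\<beta> \<in> Z \<Longrightarrow> x \<in> adjoin \<alpha> \<Longrightarrow> emb (cnj \<beta>) x = cnj (emb \<beta> x)"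
proof -
  show c: "cnj \<beta> \<in> Z" if "\<beta> \<in> Z" for \<beta> using that by (simp add: Z_def reval_cnj)
  show "\<beta> \<in> Z \<Longrightarrow> x \<in> adjoin \<alpha> \<Longrightarrow> emb (cnj \<beta>) x = cnj (emb \<beta> x)"
    using emb_reval emb_reval[OF c] by (auto simp: adjoin_def reval_cnj)
qed

text \<open>The value at 2 is 2 at a real place and 4 at a complex one. Once the type is known, the
  moduli of \<beta> and 1 + \<beta> determine the real part and the square of the imaginary
  part.\<close>

lemma embedding_abs_eq_iff:
  assumes b: "\<beta> \<in> Z" and c: "\<gamma> \<in> Z"
  shows "embedding_abs (adjoin \<alpha>) (emb \<beta>) = embedding_abs (adjoin \<alpha>) (emb \<gamma>) \<longleftrightarrow> \<gamma> = \<beta> \<or> \<gamma> = cnj \<beta>"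
proof
  assume eq: "embedding_abs (adjoin \<alpha>) (emb \<beta>) = embedding_abs (adjoin \<alpha>) (emb \<gamma>)"
  have e2: "emb \<delta> 2 = 2" if "\<delta> \<in> Z" for \<delta>
    using emb_reval[OF that, of "[:2:]"] by simp
  have "2 \<in> adjoin \<alpha>" using of_nat_in[of 2] by simp
  then have r: "\<beta> \<in> \<real> \<longleftrightarrow> \<gamma> \<in> \<real>"
    using fun_cong[OF eq, of 2] by (simp add: embedding_abs_emb b c e2 split: if_splits)
  have n: "cmod (emb \<beta> x) = cmod (emb \<gamma> x)" if "x \<in> adjoin \<alpha>" for x
    using fun_cong[OF eq, of x] that r by (auto simp: embedding_abs_emb b c split: if_splits)
  have e: "emb \<delta> \<alpha> = \<delta>" "emb \<delta> (1 + \<alpha>) = 1 + \<delta>" if "\<delta> \<in> Z" for \<delta>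
    using emb_reval[OF that, of "[:0, 1:]"] emb_reval[OF that, of "[:1, 1:]"] by auto
  have "cmod \<beta> = cmod \<gamma>" using n[OF self_in_adjoin] e b c by simp
  then have a1: "(Re \<beta>)\<^sup>2 + (Im \<beta>)\<^sup>2 = (Re \<gamma>)\<^sup>2 + (Im \<gamma>)\<^sup>2" by (metis cmod_power2)
  have "cmod (1 + \<beta>) = cmod (1 + \<gamma>)" using n[OF add_in[OF one_in self_in_adjoin]] e b c by simp
  then have "(1 + Re \<beta>)\<^sup>2 + (Im \<beta>)\<^sup>2 = (1 + Re \<gamma>)\<^sup>2 + (Im \<gamma>)\<^sup>2"
    using cmod_power2[of "1 + \<beta>"] cmod_power2[of "1 + \<gamma>"] by simp
  with a1 have re: "Re \<beta> = Re \<gamma>" by (simp add: power2_eq_square algebra_simps)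
  with a1 have "(Im \<gamma>)\<^sup>2 = (Im \<beta>)\<^sup>2" by simp
  then have "Im \<gamma> = Im \<beta> \<or> Im \<gamma> = - Im \<beta>" by (simp add: power2_eq_iff)
  then show "\<gamma> = \<beta> \<or> \<gamma> = cnj \<beta>" using re by (auto simp: complex_eq_iff)
next
  assume "\<gamma> = \<beta> \<or> \<gamma> = cnj \<beta>"
  moreover have "embedding_abs (adjoin \<alpha>) (emb (cnj \<beta>)) = embedding_abs (adjoin \<alpha>) (emb \<beta>)"
  proof
    fix x
    have "cnj \<beta> \<in> \<real> \<longleftrightarrow> \<beta> \<in> \<real>" by (simp add: complex_is_Real_iff)
    then show "embedding_abs (adjoin \<alpha>) (emb (cnj \<beta>)) x = embedding_abs (adjoin \<alpha>) (emb \<beta>) x"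
      using emb_cnj[OF b] by (simp add: embedding_abs_emb b)
  qed
  ultimately show "embedding_abs (adjoin \<alpha>) (emb \<beta>) = embedding_abs (adjoin \<alpha>) (emb \<gamma>)" by auto
qed

text \<open>A real place comes from one root, a complex place from two conjugate roots; the square
  in the normalization accounts for the second.\<close>

lemma arch_sum:
  assumes y: "y \<in> adjoin \<alpha>"
  shows "(\<Sum>w\<in>(\<lambda>\<beta>. embedding_abs (adjoin \<alpha>) (emb \<beta>)) ` Z. log_plus (w y)) =
    (\<Sum>\<beta>\<in>Z. log_plus (cmod (emb \<beta> y)))"
proof -
  define ab where "ab = (\<lambda>\<beta>. embedding_abs (adjoin \<alpha>) (emb \<beta>))"
  have "(\<Sum>\<beta>\<in>Z. log_plus (cmod (emb \<beta> y))) =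
      (\<Sum>w\<in>ab ` Z. \<Sum>\<gamma>\<in>{\<gamma>. \<gamma> \<in> Z \<and> ab \<gamma> = w}. log_plus (cmod (emb \<gamma> y)))"
    by (rule sum.image_gen[OF finite_Z])
  also have "\<dots> = (\<Sum>w\<in>ab ` Z. log_plus (w y))"
  proof (rule sum.cong)
    fix w assume "w \<in> ab ` Z"
    then obtain \<beta> where b: "\<beta> \<in> Z" "w = ab \<beta>" by blast
    have fib: "{\<gamma>. \<gamma> \<in> Z \<and> ab \<gamma> = w} = {\<beta>, cnj \<beta>}"
    proof -
      have "ab \<gamma> = w \<longleftrightarrow> \<gamma> = \<beta> \<or> \<gamma> = cnj \<beta>" if "\<gamma> \<in> Z" for \<gamma>
        using embedding_abs_eq_iff[OF b(1) that] unfolding b(2) ab_def by (simp only: eq_commute)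
      then show ?thesis using emb_cnj(1)[OF b(1)] b(1) by blast
    qed
    show "(\<Sum>\<gamma>\<in>{\<gamma>. \<gamma> \<in> Z \<and> ab \<gamma> = w}. log_plus (cmod (emb \<gamma> y))) = log_plus (w y)"
    proof (cases "\<beta> \<in> \<real>")
      case True
      then have "cnj \<beta> = \<beta>" using Reals_cnj_iff by blast
      then show ?thesis unfolding fib using True y b by (simp add: ab_def embedding_abs_emb)
    next
      case False
      then have "cnj \<beta> \<noteq> \<beta>" using Reals_cnj_iff by blast
      then show ?thesis unfolding fib using False y b emb_cnj(2)[OF b(1) y]
        by (simp add: ab_def embedding_abs_emb log_plus_power2)
    qed
  qed simp
  finally show ?thesis by (simp add: ab_def)
qed

text \<open>\<open>PP\<close> selects one prime above each p in T, and \<open>other\<close> makes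
  all remaining finite places contribute 0. As the sum runs over functions, the listed places have
  to be shown distinct.\<close>

lemma height_over_formula:
  fixes T :: "nat set" and PP :: "nat \<Rightarrow> complex set"
  assumes y: "y \<in> adjoin \<alpha>" and T: "finite T" "\<And>p. p \<in> T \<Longrightarrow> prime p"
    and PP: "\<And>p. p \<in> T \<Longrightarrow> prime_place (adjoin \<alpha>) m (PP p)" "\<And>p. p \<in> T \<Longrightarrow> of_nat p \<in> PP p"
    and other: "\<And>Q. prime_place (adjoin \<alpha>) m Q \<Longrightarrow> Q \<notin> PP ` T \<Longrightarrow> prime_abs (adjoin \<alpha>) Q y \<le> 1"
  shows "height_over (adjoin \<alpha>) y =
    ((\<Sum>p\<in>T. log_plus (prime_abs (adjoin \<alpha>) (PP p) y)) + (\<Sum>\<beta>\<in>Z. log_plus (cmod (emb \<beta> y)))) / real m"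
proof -
  define K where "K = adjoin \<alpha>"
  define A where "A = (\<lambda>\<beta>. embedding_abs K (emb \<beta>)) ` Z"
  define B where "B = (\<lambda>p. prime_abs K (PP p)) ` T"
  have pl: "prime_place K m Q" if "Q \<in> finite_primes K" for Q
    using that number_field_axioms unfolding K_def prime_place_def prime_place_axioms_def by blast
  have places: "places K = prime_abs K ` finite_primes K \<union> A"
    unfolding places_def A_def K_def arch_places ..
  have fin: "finite A" "finite B" using finite_Z T(1) by (auto simp: A_def B_def)
  have "infsum (\<lambda>w. log_plus (w y)) (places K) = infsum (\<lambda>w. log_plus (w y)) (A \<union> B)"
  proof (rule infsum_cong_neutral)
    fix w assume "w \<in> (A \<union> B) - places K"
    then obtain p where p: "p \<in> T" "w = prime_abs K (PP p)" "w \<notin> places K" by (auto simp: places B_def)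
    then have "PP p \<in> finite_primes K" using PP(1) unfolding K_def
      by (simp add: prime_place_def prime_place_axioms_def)
    then show "log_plus (w y) = 0" using p by (auto simp: places)
  next
    fix w assume w: "w \<in> places K - (A \<union> B)"
    then obtain Q where Q: "Q \<in> finite_primes K" "w = prime_abs K Q" "w \<notin> B" by (auto simp: places)
    then have "Q \<notin> PP ` T" by (auto simp: B_def)
    then have "w y \<le> 1" using other pl Q by (simp add: K_def)
    then show "log_plus (w y) = 0"
      using log_plus_le_1 prime_place.prime_abs_nonneg[OF pl[OF Q(1)]] Q(2) by simp
  qed simp
  also have "\<dots> = (\<Sum>w\<in>A \<union> B. log_plus (w y))" using fin by (intro infsum_finite) auto
  also have "\<dots> = (\<Sum>w\<in>A. log_plus (w y)) + (\<Sum>w\<in>B. log_plus (w y))"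
  proof (rule sum.union_disjoint[OF fin])
    \<comment> \<open>Archimedean and finite places are told apart by their value at 2.\<close>
    have "a 2 > 1" if a: "a \<in> A" for a
    proof -
      obtain \<beta> where b: "\<beta> \<in> Z" "a = embedding_abs K (emb \<beta>)" using a by (auto simp: A_def)
      have "emb \<beta> 2 = 2" using emb_reval[OF b(1), of "[:2:]"] by simp
      then show ?thesis using of_nat_in[of 2] b by (simp add: K_def embedding_abs_emb)
    qed
    moreover have "b 2 \<le> 1" if b: "b \<in> B" for b
    proof -
      obtain p where p: "p \<in> T" "b = prime_abs K (PP p)" using b by (auto simp: B_def)
      interpret P: prime_place K m "PP p" using PP(1)[OF p(1)] by (simp add: K_def)
      show ?thesis using P.prime_abs_le_1[OF P.vge_OK[OF P.OK_of_nat[of 2]]] p(2) by simp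
    qed
    ultimately show "A \<inter> B = {}" by force
  qed
  also have "(\<Sum>w\<in>A. log_plus (w y)) = (\<Sum>\<beta>\<in>Z. log_plus (cmod (emb \<beta> y)))"
    unfolding A_def K_def by (rule arch_sum[OF y])
  also have "(\<Sum>w\<in>B. log_plus (w y)) = (\<Sum>p\<in>T. log_plus (prime_abs K (PP p) y))"
    unfolding B_def
  proof (subst sum.reindex)
    \<comment> \<open>The value at p is less than 1 at a prime containing p and equal to 1 at any
      other.\<close>
    show "inj_on (\<lambda>p. prime_abs K (PP p)) T"
    proof (rule inj_onI)
      fix p q assume pq: "p \<in> T" "q \<in> T" "prime_abs K (PP p) = prime_abs K (PP q)"
      interpret P: prime_place K m "PP p" using PP(1)[OF pq(1)] by (simp add: K_def)
      interpret Q: prime_place K m "PP q" using PP(1)[OF pq(2)] by (simp add: K_def)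
      have "of_nat p \<in> PP q"
      proof (rule ccontr)
        assume "of_nat p \<notin> PP q"
        then have "prime_abs K (PP q) (of_nat p) = 1" using Q.prime_abs_unit[OF OK_of_nat[folded K_def]] by (simp add: K_def)
        moreover have "prime_abs K (PP p) (of_nat p) < 1"
          using P.prime_abs_less_1 PP(2)[OF pq(1)] prime_gt_0_nat[OF T(2)[OF pq(1)]] by simp
        ultimately show False using pq(3) by simp
      qed
      from Q.prime_in_place_unique[OF T(2)[OF pq(1)] T(2)[OF pq(2)] this PP(2)[OF pq(2)]]
      show "p = q" .
    qed
  qed simp
  finally show ?thesis
    unfolding height_over_def field_degree_adjoin[folded K_def] K_def[symmetric] field_degree_adjoin
    by (simp add: K_def field_degree_adjoin add.commute)
qed

end

subsection \<open>Polynomials with totally ramified roots\<close>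

lemma log_plus_power: "t \<ge> 0 \<Longrightarrow> n > 0 \<Longrightarrow> log_plus (t ^ n) = real n * log_plus t"
  by (cases "t = 0") (auto simp: log_plus_def ln_realpow max_def zero_le_mult_iff mult_le_0_iff)

definition "vp p q = int (multiplicity (int p) (fst (quotient_of q))) - int (multiplicity (int p) (snd (quotient_of q)))"

lemma padic_abs_vp: "q \<noteq> 0 \<Longrightarrow> padic_abs p q = real p powi (- vp p q)"
  by (simp add: padic_abs_def vp_def)

lemma (in prime_place) v_of_rat:
  fixes p :: nat
  assumes p: "prime p" "of_nat p \<in> P" and q: "q \<noteq> 0"
  shows "v (of_rat q) = vp p q * v (of_nat p)"
proof -
  obtain a b where ab: "quotient_of q = (a, b)" by (cases "quotient_of q")
  have b: "b > 0" "q = of_int a / of_int b" using ab quotient_of_denom_pos quotient_of_div by auto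
  then have a: "a \<noteq> 0" using q by auto
  have "(of_rat q :: complex) = of_int a / of_int b" by (simp add: b(2) of_rat_divide)
  then have "v (of_rat q) = v (of_int a) - v (of_int b)"
    using a b(1) by (simp add: v_quotient of_int_in)
  then show ?thesis
    using v_of_int[OF p, of a] v_of_int[OF p, of b] a b(1) by (simp add: vp_def ab algebra_simps)
qed

lemma (in prime_place) vge_of_rat:
  fixes p :: nat
  assumes p: "prime p" "of_nat p \<in> P" and q: "\<not> int p dvd snd (quotient_of q)"
  shows "vge 0 (of_rat q)"
proof (cases "q = 0")
  case False
  have "multiplicity (int p) (snd (quotient_of q)) = 0" using q by (rule not_dvd_imp_multiplicity_0)
  moreover have "v (of_nat p) \<ge> 0" using v_OK_nonneg[OF OK_of_nat] prime_gt_0_nat[OF p(1)] by simp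
  ultimately have "v (of_rat q) \<ge> 0" using v_of_rat[OF p False] by (simp add: vp_def)
  then show ?thesis by (simp add: vge_def of_rat_in)
qed (simp add: vge_def zero_in)

text \<open>Roots are to have absolute value \<open>p powr (k p / n)\<close> at p, that is order -
  \<open>k p / n\<close> when p has order 1. \<open>e0\<close> and \<open>M0\<close> fix the left
  end of the Newton polygon, and \<open>slope\<close> keeps the other points on or above the segment
  from there to (n, 0). Nonemptiness of T supplies the ramified prime from which irreducibility is
  derived.\<close>

locale ramified_poly =
  fixes n :: nat and T :: "nat set" and k :: "nat \<Rightarrow> int" and e :: "nat \<Rightarrow> nat \<Rightarrow> int" and M :: "nat \<Rightarrow> int"
  assumes n: "prime n" and finite_T: "finite T" and T_nonempty: "T \<noteq> {}"
    and T_prime: "\<And>p. p \<in> T \<Longrightarrow> prime p"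
    and k: "\<And>p. p \<in> T \<Longrightarrow> \<not> int n dvd k p"
    and e0: "\<And>p. p \<in> T \<Longrightarrow> e p 0 = - k p"
    and slope: "\<And>p i. p \<in> T \<Longrightarrow> i < n \<Longrightarrow> int n * e p i \<ge> - k p * int (n - i)"
    and M0: "\<And>p. p \<in> T \<Longrightarrow> \<not> int p dvd M 0"
begin

definition "cf i = of_int (M i) * (\<Prod>p\<in>T. rat_of_nat p powi e p i)"
definition "F = monom 1 n + (\<Sum>i<n. monom (cf i) i)"

lemma n_pos: "n > 0" using n by (rule prime_gt_0_nat)

lemma coeff_F: "coeff F i = (if i = n then 1 else if i < n then cf i else 0)"
  by (auto simp: F_def coeff_sum)

lemma degree_F: "degree F = n"
  by (rule antisym) (auto intro!: degree_le le_degree simp: coeff_F)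

lemma lead_coeff_F: "lead_coeff F = 1"
  by (simp add: degree_F coeff_F)

lemma reval_F: "reval F x = x ^ n + (\<Sum>i<n. of_rat (cf i) * x ^ i)"
  by (simp add: F_def reval_add reval_sum reval_monom)

lemma T_pos: "p \<in> T \<Longrightarrow> p > 0" using T_prime prime_gt_0_nat by blast

lemma M0_nz: "M 0 \<noteq> 0" using T_nonempty M0 by auto

lemma of_rat_cf: "(of_rat (cf i) :: complex) = of_int (M i) * (\<Prod>p\<in>T. of_nat p powi e p i)"
  unfolding cf_def of_rat_mult of_rat_prod of_rat_of_int_eq
  by (intro arg_cong2[of _ _ _ _ "(*)"] refl prod.cong) (auto simp: power_int_def of_rat_power of_rat_inverse)

lemma cf_nz: "cf i \<noteq> 0 \<longleftrightarrow> M i \<noteq> 0"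
  using finite_T T_pos by (auto simp: cf_def)

end

section \<open>Orders of the roots at the primes of a number field\<close>

locale ramified_place = ramified_poly + prime_place
begin

lemma v_prod:
  assumes "finite I" "I \<subseteq> T"
  shows "(\<Prod>p\<in>I. of_nat p powi f p) \<in> K \<and> v (\<Prod>p\<in>I. of_nat p powi f p) = (\<Sum>p\<in>I. f p * v (of_nat p))"
  using assms
proof (induction I)
  case (insert p I)
  have "of_nat p powi f p \<in> K"
    by (simp add: power_int_def power_in inverse_in of_nat_in)
  moreover have "(\<Prod>p\<in>I. of_nat p powi f p) \<noteq> (0 :: complex)"
    using insert T_pos by (auto simp: prod_zero_iff)
  moreover have "of_nat p powi f p \<noteq> (0 :: complex)" using insert T_pos[of p] by auto
  ultimately show ?case using insert T_pos[of p] by (simp add: mult_in v_mult v_power_int of_nat_in)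
qed (simp add: one_in v_1)

lemma v_cf:
  assumes "M i \<noteq> 0"
  shows "v (of_rat (cf i)) = v (of_int (M i)) + (\<Sum>p\<in>T. e p i * v (of_nat p))"
  unfolding of_rat_cf using v_prod[OF finite_T order_refl] assms finite_T T_pos
  by (subst v_mult) (auto simp: of_int_in prod_zero_iff)

lemma v_cf_over:
  assumes p: "p \<in> T" "of_nat p \<in> P" and M: "M i \<noteq> 0"
  shows "v (of_rat (cf i)) = v (of_int (M i)) + e p i * v (of_nat p)"
proof -
  have "v (of_nat q) = 0" if "q \<in> T - {p}" for q
    using v_unit[OF OK_of_nat, of q] prime_in_place_unique[of p q] that T_prime p by blast
  then have "(\<Sum>q\<in>T - {p}. e q i * v (of_nat q)) = 0" by (intro sum.neutral) auto
  then show ?thesis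
    using v_cf[OF M] sum.remove[OF finite_T p(1), of "\<lambda>q. e q i * v (of_nat q)"] by simp
qed

text \<open>The Newton polygon gives n v(\<alpha>) = - k v(p). The prime n does not divide k, so it
  divides the ramification index v(p), which is positive.\<close>

lemma v_root:
  assumes p: "p \<in> T" "of_nat p \<in> P" and a: "\<alpha> \<in> K" "reval F \<alpha> = 0"
  shows "\<alpha> \<noteq> 0" "int n * v \<alpha> = - k p * v (of_nat p)" "v (of_nat p) \<ge> int n"
proof -
  have vp: "v (of_nat p) > 0" using v_pos[OF p(2)] T_pos[OF p(1)] by simp
  have v0: "v (of_rat (cf 0)) = - k p * v (of_nat p)"
    using v_cf_over[OF p M0_nz] e0[OF p(1)] v_of_int_coprime[OF T_prime[OF p(1)] p(2) M0[OF p(1)]] by simp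
  have eq: "\<alpha> ^ n + (\<Sum>i<n. of_rat (cf i) * \<alpha> ^ i) = 0" using a(2) by (simp add: reval_F)
  have c0: "(of_rat (cf 0) :: complex) \<noteq> 0" using M0_nz by (simp add: cf_nz)
  have sl: "int n * v (of_rat (cf i)) \<ge> int (n - i) * v (of_rat (cf 0))"
    if i: "i < n" "(of_rat (cf i) :: complex) \<noteq> 0" for i
  proof -
    have Mi: "M i \<noteq> 0" using i(2) by (simp add: cf_nz)
    have "v (of_int (M i)) \<ge> 0" using v_OK_nonneg[OF OK_of_int] Mi by simp
    then have "int n * v (of_rat (cf i)) \<ge> int n * (e p i * v (of_nat p))"
      using v_cf_over[OF p Mi] by (intro mult_left_mono) auto
    moreover have "(int n * e p i) * v (of_nat p) \<ge> (- k p * int (n - i)) * v (of_nat p)"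
      using slope[OF p(1) i(1)] vp by (intro mult_right_mono) auto
    ultimately show ?thesis unfolding v0 by (simp add: algebra_simps)
  qed
  show "\<alpha> \<noteq> 0" using newton_single_slope(1)[OF n_pos a(1) of_rat_in eq c0 sl] .
  show s: "int n * v \<alpha> = - k p * v (of_nat p)"
    using newton_single_slope(2)[OF n_pos a(1) of_rat_in eq c0 sl] v0 by simp
  have "int n dvd k p * v (of_nat p)" using s by (metis dvd_triv_left dvd_minus_iff mult_minus_left)
  moreover have "prime (int n)" using n by simp
  ultimately have "int n dvd v (of_nat p)" using k[OF p(1)] by (metis prime_dvd_mult_iff)
  then show "v (of_nat p) \<ge> int n" using vp by (rule zdvd_imp_le)
qed

text \<open>Away from T the primes of T are units, so the coefficients have nonnegative
  order.\<close>

lemma vge_root_outside: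
  assumes out: "\<And>p. p \<in> T \<Longrightarrow> of_nat p \<notin> P" and a: "\<alpha> \<in> K" "reval F \<alpha> = 0"
  shows "vge 0 \<alpha>"
proof (rule vge_root[OF n_pos a(1)])
  fix i
  show "vge 0 (of_rat (cf i))"
  proof (cases "M i = 0")
    case False
    have "v (of_nat q) = 0" if "q \<in> T" for q using v_unit[OF OK_of_nat out[OF that]] .
    then have "(\<Sum>q\<in>T. e q i * v (of_nat q)) = 0" by (intro sum.neutral) auto
    then have "v (of_rat (cf i)) \<ge> 0" using v_cf[OF False] v_OK_nonneg[OF OK_of_int] False by simp
    then show ?thesis by (simp add: vge_def of_rat_in)
  qed (simp add: vge_def zero_in cf_def)
  show "\<alpha> ^ n + (\<Sum>i<n. of_rat (cf i) * \<alpha> ^ i) = 0" using a(2) by (simp add: reval_F)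
qed

end

section \<open>Irreducibility, separability and the height of a root\<close>

context ramified_poly
begin

text \<open>Let m be the degree of \<alpha>, so far only at most n. Above a prime of T the
  ramification index is at least n, hence at least m, and total ramification then says that it
  equals m; so m = n.\<close>

lemma root_minimal_poly:
  assumes root: "reval F \<alpha> = 0"
  shows "minimal_poly \<alpha> F n"
proof -
  have "F \<noteq> 0" using lead_coeff_F by auto
  then obtain G m where G: "minimal_poly \<alpha> G m" "m \<le> n"
    using ex_minimal_poly[OF root] degree_F by auto
  interpret minimal_poly \<alpha> G m by fact
  obtain p where p: "p \<in> T" using T_nonempty by blast
  obtain P where P: "prime_place (adjoin \<alpha>) m P" "of_nat p \<in> P" using ex_prime_over[OF T_prime[OF p]] by blast
  interpret P: prime_place "adjoin \<alpha>" m P by fact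
  interpret ramified_place n T k e M "adjoin \<alpha>" m P by unfold_locales
  have "prime_ord (adjoin \<alpha>) P (of_nat p) \<ge> int n" by (rule v_root(3)[OF p P(2) self_in_adjoin root])
  then have "m = n"
    using P.total_ramification(1)[OF T_prime[OF p] P(2) _ m_pos] G(2) by simp
  then show ?thesis
    using lead_coeff_F degree_F root minimal by unfold_locales auto
qed

text \<open>A multiple root would also be a root of the derivative, a nonzero polynomial of smaller
  degree, contradicting minimality.\<close>

lemma card_roots: "card {\<beta>. reval F \<beta> = 0} = n"
  and factor: "map_poly of_rat F = (\<Prod>\<beta>\<in>{\<beta>. reval F \<beta> = 0}. [:- \<beta>, 1:])"
proof -
  define f where "f = (map_poly of_rat F :: complex poly)"
  have lf: "degree f = n" "lead_coeff f = 1"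
    using degree_F lead_coeff_F by (auto simp: f_def degree_map_poly coeff_map_poly)
  have pd: "pderiv f = map_poly of_rat (pderiv F)"
    by (rule poly_eqI) (simp add: f_def coeff_pderiv coeff_map_poly of_rat_mult of_rat_add)
  have "rsquarefree f"
    unfolding rsquarefree_roots
  proof (intro allI notI)
    fix b assume b: "poly f b = 0 \<and> poly (pderiv f) b = 0"
    then have r: "reval F b = 0" "reval (pderiv F) b = 0" unfolding reval_def pd[symmetric] f_def[symmetric] by blast+
    interpret minimal_poly b F n by (rule root_minimal_poly[OF r(1)])
    have "pderiv F \<noteq> 0" using degree_F n_pos by (simp add: pderiv_eq_0_iff)
    then have "n \<le> degree (pderiv F)" using minimal r(2) by blast
    then show False using degree_F n_pos by (simp add: degree_pderiv)
  qed
  then have fac: "f = (\<Prod>z|poly f z = 0. [:- z, 1:])"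
    using complex_poly_decompose_rsquarefree[of f] lf(2) by simp
  have Z: "{z. poly f z = 0} = {\<beta>. reval F \<beta> = 0}" by (simp add: reval_def f_def)
  show "map_poly of_rat F = (\<Prod>\<beta>\<in>{\<beta>. reval F \<beta> = 0}. [:- \<beta>, 1:])"
    using fac unfolding Z by (simp add: f_def)
  have "degree (\<Prod>z|poly f z = 0. [:- z, 1:]) = (\<Sum>z|poly f z = 0. degree [:- z, 1:])"
    by (rule degree_prod_eq_sum_degree) auto
  then show "card {\<beta>. reval F \<beta> = 0} = n" using fac lf(1) unfolding Z by simp
qed

text \<open>Each p in T has a single prime above it, with p residue classes and ramification index
  n. The normalized absolute values there are n-th powers of the quantities in the bound, and
  division by the degree n cancels the power.\<close>

lemma height_ab_root:
  assumes root: "reval F \<alpha> = 0" and a: "a \<noteq> 0" and S: "S_ab a b \<subseteq> T"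
  defines "r \<equiv> \<lambda>p. real p powr (real_of_int (k p) / real n)"
  shows "height_ab a b \<alpha> =
    (\<Sum>p\<in>T. log_plus (r p) + log_plus (max (padic_abs p a * r p) (padic_abs p b))) +
    (\<Sum>\<beta>|reval F \<beta> = 0. log_plus (cmod \<beta>) + log_plus (cmod (of_rat a * \<beta> + of_rat b))) / real n"
proof -
  interpret minimal_poly \<alpha> F n by (rule root_minimal_poly[OF root])
  define K where "K = adjoin \<alpha>"
  have aK: "\<alpha> \<in> K" using self_in_adjoin by (simp add: K_def)
  define PP where "PP = (\<lambda>p. SOME P. prime_place K n P \<and> of_nat p \<in> P)"
  have PP: "prime_place K n (PP p) \<and> of_nat p \<in> PP p" if "p \<in> T" for p
    unfolding PP_def using ex_prime_over[OF T_prime[OF that]] unfolding K_def by (rule someI_ex)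
  have r_pos: "r p > 0" if "p \<in> T" for p using T_pos[OF that] by (simp add: r_def)
  have r_pow: "r p ^ n = real p powi k p" if "p \<in> T" for p
    using T_pos[OF that] n_pos by (simp add: r_def powr_realpow[symmetric] powr_powr powr_real_of_int')
  have over: "prime_abs K (PP p) \<alpha> = r p ^ n \<and>
      prime_abs K (PP p) (of_rat a * \<alpha> + of_rat b) = (max (padic_abs p a * r p) (padic_abs p b)) ^ n"
    if p: "p \<in> T" for p
  proof -
    interpret P: prime_place K n "PP p" using PP[OF p] by blast
    interpret ramified_place n T k e M K n "PP p" by unfold_locales
    have pP: "of_nat p \<in> PP p" using PP[OF p] by blast
    note vr = v_root[OF p pP aK root]
    have tr: "P.v (of_nat p) = int n" "P.residue_card = p"
      using P.total_ramification(1,2)[OF T_prime[OF p] pP vr(3) n_pos] by auto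
    have "int n * P.v \<alpha> = int n * (- k p)" using vr(2) tr(1) by (simp add: mult.commute)
    then have va: "P.v \<alpha> = - k p" using n_pos unfolding mult_cancel_left by simp
    have p0: "real p \<noteq> 0" using T_pos[OF p] by simp
    have abs: "prime_abs K (PP p) x = real p powi (- P.v x)" if "x \<in> K" "x \<noteq> 0" for x
      using P.prime_abs_eq[OF that] tr(2) by simp
    have 1: "prime_abs K (PP p) \<alpha> = r p ^ n" using abs[OF aK vr(1)] va r_pow[OF p] by simp
    have pn: "padic_abs p q ^ n = real p powi (- P.v (of_rat q))" if "q \<noteq> 0" for q
    proof -
      have "(real p powi (- vp p q)) ^ n = real p powi (- vp p q * int n)"
        by (simp only: power_int_mult power_int_of_nat)
      then show ?thesis
        using P.v_of_rat[OF T_prime[OF p] pP that] tr(1) padic_abs_vp[OF that, of p] by simp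
    qed
    define y where "y = of_rat a * \<alpha>"
    have yK: "y \<in> K" "y \<noteq> 0" using aK a vr(1) by (auto simp: y_def P.mult_in P.of_rat_in)
    have vy: "P.v y = P.v (of_rat a) + P.v \<alpha>" using aK a vr(1) by (simp add: y_def P.v_mult P.of_rat_in)
    have absy: "prime_abs K (PP p) y = (padic_abs p a * r p) ^ n"
      unfolding power_mult_distrib pn[OF a] r_pow[OF p] abs[OF yK] vy va
      using p0 by (simp add: power_int_add[symmetric])
    have nonneg: "padic_abs p q \<ge> 0" for q by (simp add: padic_abs_def)
    have ar: "padic_abs p a * r p \<ge> 0" using nonneg r_pos[OF p] by simp
    have maxp: "(max s t) ^ n = max (s ^ n) (t ^ n)" if "s \<ge> 0" "t \<ge> 0" for s t :: real
      using that by (auto simp: max_def power_mono intro!: antisym)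
    have 2: "prime_abs K (PP p) (y + of_rat b) = (max (padic_abs p a * r p) (padic_abs p b)) ^ n"
    proof (cases "b = 0")
      case True
      then show ?thesis using absy ar by (simp add: padic_abs_def max_absorb1)
    next
      case False
      define z where "z = (of_rat b :: complex)"
      have zK: "z \<in> K" "z \<noteq> 0" using False by (auto simp: z_def P.of_rat_in)
      have absz: "prime_abs K (PP p) z = padic_abs p b ^ n" using abs[OF zK] pn[OF False] by (simp add: z_def)
      \<comment> \<open>Equal orders would make \<open>k p\<close> a multiple of n. With different
        orders the ultrametric inequality becomes the exact maximum.\<close>
      have ne: "P.v y \<noteq> P.v z"
      proof
        assume "P.v y = P.v z"
        then have "k p = int n * (vp p a - vp p b)"
          using vy va P.v_of_rat[OF T_prime[OF p] pP a] P.v_of_rat[OF T_prime[OF p] pP False] tr(1)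
          by (simp add: z_def algebra_simps)
        then show False using k[OF p] by simp
      qed
      have p1: "real p \<ge> 1" using T_pos[OF p] by simp
      have "prime_abs K (PP p) (y + z) = max (prime_abs K (PP p) y) (prime_abs K (PP p) z)"
      proof (cases "P.v y < P.v z")
        case True
        then have "P.vge (P.v y + 1) z" using zK by (simp add: P.vge_def)
        from P.v_add_dominant[OF yK this] have "prime_abs K (PP p) (y + z) = prime_abs K (PP p) y"
          using abs[of "y + z"] abs[OF yK] yK zK by (simp add: P.add_in)
        moreover have "prime_abs K (PP p) z \<le> prime_abs K (PP p) y"
          unfolding abs[OF yK] abs[OF zK] using True p1 by (intro power_int_increasing) auto
        ultimately show ?thesis by simp
      next
        case False
        then have lt: "P.v z < P.v y" using ne by simp
        then have "P.vge (P.v z + 1) y" using yK by (simp add: P.vge_def)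
        from P.v_add_dominant[OF zK this] have "prime_abs K (PP p) (y + z) = prime_abs K (PP p) z"
          using abs[of "y + z"] abs[OF zK] yK zK by (simp add: P.add_in add.commute)
        moreover have "prime_abs K (PP p) y \<le> prime_abs K (PP p) z"
          unfolding abs[OF yK] abs[OF zK] using lt p1 by (intro power_int_increasing) auto
        ultimately show ?thesis by simp
      qed
      then show ?thesis using absy absz maxp[OF ar nonneg] by (simp add: z_def)
    qed
    show ?thesis using 1 2 by (simp add: y_def)
  qed
  \<comment> \<open>Uniqueness of the prime above each p in T shows that Q lies over a prime outside
    T, where \<alpha> is integral and, as T contains \<open>S_ab a b\<close>, so are a and
    b.\<close>
  have outside: "prime_abs K Q \<alpha> \<le> 1 \<and> prime_abs K Q (of_rat a * \<alpha> + of_rat b) \<le> 1"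
    if Q: "prime_place K n Q" "Q \<notin> PP ` T" for Q
  proof -
    interpret Q: prime_place K n Q by fact
    interpret ramified_place n T k e M K n Q by unfold_locales
    have out: "of_nat p \<notin> Q" if p: "p \<in> T" for p
    proof
      assume pQ: "of_nat p \<in> Q"
      interpret P: prime_place K n "PP p" using PP[OF p] by blast
      interpret ramified_place n T k e M K n "PP p" by unfold_locales
      have pP: "of_nat p \<in> PP p" using PP[OF p] by blast
      have "Q = PP p"
        using P.prime_over_unique[OF T_prime[OF p] pP v_root(3)[OF p pP aK root] n_pos Q(1) pQ] .
      then show False using Q(2) p by blast
    qed
    have va: "Q.vge 0 \<alpha>" by (rule vge_root_outside[OF out aK root])
    obtain q :: nat where q: "prime q" "of_nat q \<in> Q" by (rule Q.rational_prime_in_P)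
    then have "q \<notin> T" using out by blast
    then have qS: "q \<notin> S_ab a b" using S by blast
    have ra: "Q.vge 0 (of_rat a)" using qS q by (intro Q.vge_of_rat[OF q]) (auto simp: S_ab_def)
    have rb: "Q.vge 0 (of_rat b)"
    proof (cases "b = 0")
      case True
      then show ?thesis by (simp add: Q.vge_def Q.zero_in)
    next
      case False
      then show ?thesis using qS q by (intro Q.vge_of_rat[OF q]) (auto simp: S_ab_def)
    qed
    have "Q.vge 0 (of_rat a * \<alpha> + of_rat b)"
      using Q.vge_add[OF _ rb] Q.vge_mult[OF ra va] by simp
    then show ?thesis using va Q.prime_abs_le_1 by blast
  qed
  have hf: "height_over K y = ((\<Sum>p\<in>T. log_plus (prime_abs K (PP p) y)) + (\<Sum>\<beta>\<in>Z. log_plus (cmod (emb \<beta> y)))) / real n"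
    if "y \<in> K" "\<And>Q. prime_place K n Q \<Longrightarrow> Q \<notin> PP ` T \<Longrightarrow> prime_abs K Q y \<le> 1" for y
    using height_over_formula[OF that(1)[unfolded K_def] finite_T T_prime, of PP] PP that(2)
    unfolding K_def by blast
  have yK: "of_rat a * \<alpha> + of_rat b \<in> K" using aK unfolding K_def by (intro add_in mult_in of_rat_in)
  have div: "(\<Sum>p\<in>T. real n * g p) / real n = (\<Sum>p\<in>T. g p)" for g
    using n_pos by (simp add: sum_distrib_left[symmetric])
  \<comment> \<open>The identity as an affine map, with a = 1 and b = 0, identifies the field
    generated by \<alpha>.\<close>
  have "weil_height \<alpha> = height_over K \<alpha>"
    unfolding weil_height_def using generate_field_affine[of 1 0] by (simp add: K_def)
  also have "\<dots> = ((\<Sum>p\<in>T. log_plus (prime_abs K (PP p) \<alpha>)) + (\<Sum>\<beta>\<in>Z. log_plus (cmod (emb \<beta> \<alpha>)))) / real n"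
    by (rule hf[OF aK]) (use outside in blast)
  also have "(\<Sum>p\<in>T. log_plus (prime_abs K (PP p) \<alpha>)) = (\<Sum>p\<in>T. real n * log_plus (r p))"
    by (rule sum.cong) (use over r_pos n_pos in \<open>auto simp: log_plus_power less_imp_le\<close>)
  also have "(\<Sum>\<beta>\<in>Z. log_plus (cmod (emb \<beta> \<alpha>))) = (\<Sum>\<beta>\<in>Z. log_plus (cmod \<beta>))"
  proof (rule sum.cong)
    fix \<beta> assume "\<beta> \<in> Z"
    then show "log_plus (cmod (emb \<beta> \<alpha>)) = log_plus (cmod \<beta>)" using emb_reval[of \<beta> "[:0, 1:]"] by simp
  qed simp
  finally have h1: "weil_height \<alpha> = (\<Sum>p\<in>T. log_plus (r p)) + (\<Sum>\<beta>\<in>Z. log_plus (cmod \<beta>)) / real n"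
    by (simp add: add_divide_distrib div)
  have "weil_height (of_rat a * \<alpha> + of_rat b) = height_over K (of_rat a * \<alpha> + of_rat b)"
    unfolding weil_height_def using generate_field_affine[OF a, of b] by (simp add: K_def)
  also have "\<dots> = ((\<Sum>p\<in>T. log_plus (prime_abs K (PP p) (of_rat a * \<alpha> + of_rat b))) +
      (\<Sum>\<beta>\<in>Z. log_plus (cmod (emb \<beta> (of_rat a * \<alpha> + of_rat b))))) / real n"
    by (rule hf[OF yK]) (use outside in blast)
  also have "(\<Sum>p\<in>T. log_plus (prime_abs K (PP p) (of_rat a * \<alpha> + of_rat b))) =
      (\<Sum>p\<in>T. real n * log_plus (max (padic_abs p a * r p) (padic_abs p b)))"
  proof (rule sum.cong)
    fix p assume p: "p \<in> T"
    have "max (padic_abs p a * r p) (padic_abs p b) \<ge> 0" by (simp add: padic_abs_def le_max_iff_disj)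
    then show "log_plus (prime_abs K (PP p) (of_rat a * \<alpha> + of_rat b)) =
        real n * log_plus (max (padic_abs p a * r p) (padic_abs p b))"
      using over[OF p] n_pos by (simp add: log_plus_power)
  qed simp
  also have "(\<Sum>\<beta>\<in>Z. log_plus (cmod (emb \<beta> (of_rat a * \<alpha> + of_rat b)))) =
      (\<Sum>\<beta>\<in>Z. log_plus (cmod (of_rat a * \<beta> + of_rat b)))"
  proof (rule sum.cong)
    fix \<beta> assume "\<beta> \<in> Z"
    then show "log_plus (cmod (emb \<beta> (of_rat a * \<alpha> + of_rat b))) = log_plus (cmod (of_rat a * \<beta> + of_rat b))"
      using emb_reval[of \<beta> "[:b, a:]"] by (simp add: add.commute mult.commute)
  qed simp
  finally have h2: "weil_height (of_rat a * \<alpha> + of_rat b) =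
      (\<Sum>p\<in>T. log_plus (max (padic_abs p a * r p) (padic_abs p b))) +
      (\<Sum>\<beta>\<in>Z. log_plus (cmod (of_rat a * \<beta> + of_rat b))) / real n"
    by (simp add: add_divide_distrib div)
  show ?thesis unfolding height_ab_def h1 h2 by (simp add: sum.distrib add_divide_distrib Z_def)
qed

end

subsection \<open>Equidistribution of the roots of polynomials with bounded coefficients\<close>

text \<open>Monic polynomials given by their roots, to be used for fixed C and growing degree. I
  will be a set of roots and \<open>v\<close> a change of variable.\<close>

definition flat_poly :: "real \<Rightarrow> complex set \<Rightarrow> (complex \<Rightarrow> complex) \<Rightarrow> bool" where
  "flat_poly C I v \<longleftrightarrow> finite I \<and> I \<noteq> {} \<and> C \<ge> 1 \<and>
    (\<forall>j. cmod (coeff (\<Prod>i\<in>I. [:- v i, 1:]) j) \<le> C) \<and> cmod (coeff (\<Prod>i\<in>I. [:- v i, 1:]) 0) \<ge> 1"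

lemma degree_prod_linear: "finite I \<Longrightarrow> degree (\<Prod>i\<in>I. [:- v i :: complex, 1:]) = card I"
  by (subst degree_prod_eq_sum_degree) auto

lemma flat_poly_nonzero:
  assumes "flat_poly C I v" "i \<in> I" shows "v i \<noteq> 0"
proof
  assume "v i = 0"
  then have "poly (\<Prod>i\<in>I. [:- v i, 1:]) 0 = 0"
    using assms by (auto simp: poly_prod flat_poly_def)
  then show False using assms by (simp add: flat_poly_def poly_0_coeff_0)
qed

text \<open>Cauchy's bound: beyond C + 1 the leading term exceeds the geometric sum bounding all
  others.\<close>

lemma flat_poly_root_bound:
  assumes f: "flat_poly C I v" and i: "i \<in> I" shows "cmod (v i) \<le> C + 1"
proof (rule ccontr)
  assume "\<not> ?thesis"
  then have gt: "cmod (v i) > C + 1" by simp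
  define p where "p = (\<Prod>i\<in>I. [:- v i, 1:])"
  define n where "n = card I"
  define t where "t = cmod (v i)"
  have fin: "finite I" and C: "C \<ge> 1" and co: "cmod (coeff p j) \<le> C" for j
    using f by (auto simp: flat_poly_def p_def)
  have dp: "degree p = n" unfolding p_def n_def by (rule degree_prod_linear[OF fin])
  have lc: "coeff p n = 1"
    using dp lead_coeff_prod[of "\<lambda>i. [:- v i, 1:]" I] by (simp add: p_def)
  have "poly p (v i) = 0" using i fin by (auto simp: p_def poly_prod)
  then have "(\<Sum>j<n. coeff p j * v i ^ j) + v i ^ n = 0"
    unfolding poly_altdef dp using lc by (simp add: lessThan_Suc_atMost[symmetric])
  then have "v i ^ n = - (\<Sum>j<n. coeff p j * v i ^ j)" by (simp add: eq_neg_iff_add_eq_0 add.commute)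
  then have "t ^ n = cmod (\<Sum>j<n. coeff p j * v i ^ j)" unfolding t_def by (metis norm_minus_cancel norm_power)
  also have "\<dots> \<le> (\<Sum>j<n. C * t ^ j)"
    by (intro sum_norm_le) (use co in \<open>auto simp: norm_mult norm_power t_def intro!: mult_right_mono\<close>)
  also have "\<dots> = C * ((t ^ n - 1) / (t - 1))"
    using gt C by (simp add: sum_distrib_left[symmetric] geometric_sum t_def)
  finally have "t ^ n * (t - 1) \<le> C * (t ^ n - 1)" using gt C by (simp add: t_def field_simps)
  moreover have "t ^ n \<ge> 1" using gt C by (simp add: t_def one_le_power)
  then have "t ^ n * C < t ^ n * (t - 1)" using gt by (intro mult_strict_left_mono) (auto simp: t_def)
  ultimately show False using C by (simp add: algebra_simps)
qed

text \<open>By Landau's inequality the roots outside the unit disc have a product of polynomial size,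
  and by the lower bound for the constant coefficient so have those inside.\<close>

lemma flat_poly_radial:
  assumes f: "flat_poly C I v"
  shows "(\<Sum>i\<in>I. \<bar>cmod (v i) - 1\<bar>) \<le> 2 * (C + 1) * ln (C * (real (card I) + 1))"
proof -
  define p where "p = (\<Prod>i\<in>I. [:- v i, 1:])"
  define n where "n = card I"
  have fin: "finite I" and C: "C \<ge> 1" and co: "cmod (coeff p j) \<le> C" and c0: "cmod (coeff p 0) \<ge> 1" for j
    using f by (auto simp: flat_poly_def p_def)
  have dp: "degree p = n" unfolding p_def n_def by (rule degree_prod_linear[OF fin])
  obtain xs where xs: "set xs = I" "distinct xs" using finite_distinct_list[OF fin] by blast
  have pl: "p = (\<Prod>a\<leftarrow>map v xs. [:- a, 1:])"
    unfolding p_def xs(1)[symmetric] by (simp add: prod.distinct_set_conv_list[OF xs(2)] o_def)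
  have "mahler_measure_poly p = (\<Prod>a\<leftarrow>map v xs. max 1 (cmod a))"
    using mahler_measure_poly_explicit[of 1 "map v xs"] pl by simp
  also have "\<dots> = (\<Prod>i\<in>I. max 1 (cmod (v i)))"
    unfolding xs(1)[symmetric] by (simp add: prod.distinct_set_conv_list[OF xs(2)] o_def)
  finally have mm: "mahler_measure_poly p = (\<Prod>i\<in>I. max 1 (cmod (v i)))" .
  \<comment> \<open>Replacing n + 1 by its square removes the square root and costs at most a
    constant factor after taking logarithms.\<close>
  have "l2norm_complex p \<le> C * (real n + 1)"
  proof -
    have "(\<Sum>a\<leftarrow>coeffs p. (cmod a)\<^sup>2) = (\<Sum>j\<le>n. (cmod (coeff p j))\<^sup>2)"
    proof (cases "p = 0")
      case True
      then show ?thesis using c0 by simp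
    next
      case False
      then show ?thesis
        by (simp add: coeffs_def dp sum_list_distinct_conv_sum_set o_def atLeast_upt[symmetric] atLeast0LessThan
            lessThan_Suc_atMost del: upt_Suc)
    qed
    also have "\<dots> \<le> (\<Sum>j\<le>n. C\<^sup>2)" by (intro sum_mono power_mono co) auto
    also have "\<dots> = C\<^sup>2 * (real n + 1)" by simp
    also have "\<dots> \<le> C\<^sup>2 * (real n + 1)\<^sup>2" by (intro mult_left_mono self_le_power) auto
    also have "\<dots> = (C * (real n + 1))\<^sup>2" by (simp add: power_mult_distrib)
    finally show ?thesis using C by (intro real_le_lsqrt) auto
  qed
  then have prodle: "(\<Prod>i\<in>I. max 1 (cmod (v i))) \<le> C * (real n + 1)"
    using Landau_inequality[of p] mm by simp
  have nz: "v i \<noteq> 0" if "i \<in> I" for i using flat_poly_nonzero[OF f that] .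
  define A where "A = (\<Sum>i\<in>I. max 0 (ln (cmod (v i))))"
  define B where "B = (\<Sum>i\<in>I. max 0 (- ln (cmod (v i))))"
  have "A = (\<Sum>i\<in>I. ln (max 1 (cmod (v i))))"
    unfolding A_def by (rule sum.cong) (use nz in \<open>auto simp: max_def ln_ge_zero_iff\<close>)
  also have "\<dots> = ln (\<Prod>i\<in>I. max 1 (cmod (v i)))" by (rule ln_prod[symmetric]) (use fin in auto)
  also have "\<dots> \<le> ln (C * (real n + 1))"
    using prodle by (intro ln_mono) (auto intro!: prod_pos)
  finally have A: "A \<le> ln (C * (real n + 1))" .
  have "coeff p 0 = (\<Prod>i\<in>I. - v i)"
    unfolding poly_0_coeff_0[symmetric] p_def by (simp add: poly_prod)
  then have "(\<Prod>i\<in>I. cmod (v i)) \<ge> 1" using c0 by (simp add: prod_norm[symmetric])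
  then have "0 \<le> ln (\<Prod>i\<in>I. cmod (v i))" by simp
  also have "\<dots> = (\<Sum>i\<in>I. ln (cmod (v i)))" by (rule ln_prod) (use fin nz in auto)
  also have "\<dots> = A - B"
    unfolding A_def B_def sum_subtractf[symmetric] by (rule sum.cong) auto
  finally have B: "B \<le> A" by simp
  \<comment> \<open>The two maxima add up to the absolute value of the logarithm; the factor C + 1
    comes from the root bound.\<close>
  have trm: "\<bar>cmod (v i) - 1\<bar> \<le> (C + 1) * (max 0 (ln (cmod (v i))) + max 0 (- ln (cmod (v i))))"
    if i: "i \<in> I" for i
  proof -
    define t where "t = cmod (v i)"
    have t: "t > 0" "t \<le> C + 1" using nz[OF i] flat_poly_root_bound[OF f i] by (auto simp: t_def)
    show ?thesis
    proof (cases "t \<ge> 1")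
      case True
      have "ln (1 / t) \<le> 1 / t - 1" using t by (intro ln_le_minus_one) auto
      then have "1 - 1 / t \<le> ln t" using t by (simp add: ln_div)
      then have "t * (1 - 1 / t) \<le> t * ln t" using t by (intro mult_left_mono) auto
      then have "t - 1 \<le> t * ln t" using t by (simp add: right_diff_distrib)
      also have "\<dots> \<le> (C + 1) * ln t" using t True by (intro mult_right_mono) auto
      finally show ?thesis using True by (simp add: t_def[symmetric])
    next
      case False
      have "ln t \<le> t - 1" using t by (intro ln_le_minus_one) auto
      then have "1 - t \<le> 1 * (- ln t)" by simp
      also have "\<dots> \<le> (C + 1) * (- ln t)" using C False t by (intro mult_right_mono) auto
      finally have "1 - t \<le> (C + 1) * (- ln t)" .
      moreover have "ln t < 0" using False t by simp
      ultimately show ?thesis using False by (simp add: t_def[symmetric] max_def)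
    qed
  qed
  have "(\<Sum>i\<in>I. \<bar>cmod (v i) - 1\<bar>) \<le> (\<Sum>i\<in>I. (C + 1) * (max 0 (ln (cmod (v i))) + max 0 (- ln (cmod (v i)))))"
    by (rule sum_mono) (rule trm)
  also have "\<dots> = (C + 1) * (A + B)" unfolding A_def B_def sum.distrib[symmetric] sum_distrib_left ..
  also have "\<dots> \<le> (C + 1) * (2 * ln (C * (real n + 1)))" using A B C by (intro mult_left_mono) auto
  finally show ?thesis by (simp only: n_def mult_ac)
qed

text \<open>The logarithmic derivative of the reversed polynomial, with each 1 / (1 - v i X) written
  as a geometric series. The coefficient of index k of the sum on the right is the power sum of
  exponent k + 1.\<close>

lemma newton_identity:
  fixes v :: "complex \<Rightarrow> complex"
  assumes "finite I"
  defines "G \<equiv> \<Prod>i\<in>I. (1 - fps_const (v i) * fps_X)"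
  shows "fps_deriv G = - G * (\<Sum>i\<in>I. fps_const (v i) * Abs_fps (\<lambda>k. v i ^ k))"
  unfolding G_def using assms(1)
proof (induction I)
  case (insert i I)
  define a where "a = 1 - fps_const (v i) * fps_X"
  define H where "H = Abs_fps (\<lambda>k. v i ^ k)"
  have aH: "a * H = 1"
    by (rule fps_ext) (auto simp: a_def H_def left_diff_distrib mult.assoc fps_X_mult_nth power_eq_if)
  have da: "fps_deriv a = - fps_const (v i)" by (simp add: a_def)
  have c: "fps_deriv a = - a * (fps_const (v i) * H)"
    using arg_cong[OF aH, of "\<lambda>t. - (fps_const (v i) * t)"] da by (simp add: mult_ac)
  define Q where "Q = (\<Prod>i\<in>I. (1 - fps_const (v i) * fps_X))"
  define S where "S = (\<Sum>i\<in>I. fps_const (v i) * Abs_fps (\<lambda>k. v i ^ k))"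
  have alg: "a' * (- Q' * S') + (- a' * h) * Q' = - (a' * Q') * (h + S')" for a' Q' S' h :: "complex fps"
    by (simp add: algebra_simps)
  have "fps_deriv Q = - Q * S" using insert.IH by (simp add: Q_def S_def)
  then have "fps_deriv (a * Q) = - (a * Q) * (fps_const (v i) * H + S)"
    unfolding fps_deriv_mult c by (simp only: alg)
  then show ?case unfolding prod.insert[OF insert.hyps] sum.insert[OF insert.hyps]
    by (simp only: a_def H_def Q_def S_def)
qed simp

text \<open>Newton's identities express a power sum by coefficients and lower power sums, in a
  number of terms that depends on the exponent only; the bound is thus uniform in the
  degree.\<close>

lemma flat_poly_power_sums:
  "\<exists>B\<ge>0. \<forall>j<k. \<forall>I v. flat_poly C I v \<longrightarrow> cmod (\<Sum>i\<in>I. v i ^ Suc j) \<le> B"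
proof (induction k)
  case (Suc k)
  then obtain B where B: "B \<ge> 0" "\<And>j I v. j < k \<Longrightarrow> flat_poly C I v \<Longrightarrow> cmod (\<Sum>i\<in>I. v i ^ Suc j) \<le> B" by blast
  \<comment> \<open>k + 1 times a coefficient, plus k products of a coefficient with a lower power
    sum; the summand B covers the smaller exponents. Absolute values of C keep the bound nonnegative
    for every C.\<close>
  define B' where "B' = B + (real k + 1) * \<bar>C\<bar> + real k * (\<bar>C\<bar> * B)"
  have step: "cmod (\<Sum>i\<in>I. v i ^ Suc k) \<le> B'" if f: "flat_poly C I v" for I v
  proof -
    define p where "p = (\<Prod>i\<in>I. [:- v i, 1:])"
    have fin: "finite I" and C: "C \<ge> 1" and co: "cmod (coeff p j) \<le> C" for j
      using f by (auto simp: flat_poly_def p_def)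
    define G where "G = (\<Prod>i\<in>I. (1 - fps_const (v i) * fps_X))"
    have "reflect_poly p = (\<Prod>i\<in>I. [:1, - v i:])"
      unfolding p_def reflect_poly_prod by (intro prod.cong refl) (simp add: reflect_poly_def cCons_def)
    then have "fps_of_poly (reflect_poly p) = (\<Prod>i\<in>I. fps_of_poly [:1, - v i:])"
      by (simp only: fps_of_poly_prod)
    also have "\<dots> = G"
      unfolding G_def by (intro prod.cong refl) (simp add: fps_of_poly_pCons flip: fps_const_neg)
    finally have "G = fps_of_poly (reflect_poly p)" ..
    then have Gn: "fps_nth G j = coeff (reflect_poly p) j" for j by (simp only: fps_of_poly_nth)
    have Gb: "cmod (fps_nth G j) \<le> C" for j
      unfolding Gn coeff_reflect_poly using co C by auto
    have "coeff (reflect_poly p) 0 = 1"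
      using lead_coeff_prod[of "\<lambda>i. [:- v i, 1:]" I] by (simp add: p_def)
    then have G0: "fps_nth G 0 = 1" by (simp only: Gn)
    define S where "S = (\<Sum>i\<in>I. fps_const (v i) * Abs_fps (\<lambda>k. v i ^ k))"
    have Sn: "fps_nth S j = (\<Sum>i\<in>I. v i ^ Suc j)" for j
      by (simp add: S_def fps_sum_nth)
    have "fps_deriv G = - G * S" unfolding G_def S_def by (rule newton_identity[OF fin])
    then have "fps_nth (fps_deriv G) k = fps_nth (- G * S) k" by simp
    then have "of_nat (Suc k) * fps_nth G (Suc k) = - (\<Sum>j=0..k. fps_nth G j * fps_nth S (k - j))"
      by (simp only: fps_deriv_nth minus_mult_left[symmetric] fps_neg_nth fps_mult_nth Suc_eq_plus1)
    also have "(\<Sum>j=0..k. fps_nth G j * fps_nth S (k - j)) =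
        fps_nth S k + (\<Sum>j=1..k. fps_nth G j * fps_nth S (k - j))"
      by (subst sum.atLeast_Suc_atMost) (auto simp: G0)
    finally have e: "of_nat (Suc k) * fps_nth G (Suc k) = - (fps_nth S k + (\<Sum>j=1..k. fps_nth G j * fps_nth S (k - j)))" .
    have "fps_nth S k = - (of_nat (Suc k) * fps_nth G (Suc k)) - (\<Sum>j=1..k. fps_nth G j * fps_nth S (k - j))"
      unfolding e by simp
    then have "cmod (fps_nth S k) \<le> cmod (- (of_nat (Suc k) * fps_nth G (Suc k))) +
        cmod (\<Sum>j=1..k. fps_nth G j * fps_nth S (k - j))"
      by (simp only: norm_triangle_ineq4)
    also have "cmod (- (of_nat (Suc k) * fps_nth G (Suc k))) = cmod (of_nat (Suc k) * fps_nth G (Suc k))"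
      by (rule norm_minus_cancel)
    also have "cmod (of_nat (Suc k) * fps_nth G (Suc k)) + cmod (\<Sum>j=1..k. fps_nth G j * fps_nth S (k - j))
        \<le> (real k + 1) * C + (\<Sum>j=1..k. C * B)"
    proof (intro add_mono sum_norm_le)
      have "cmod (of_nat (Suc k) * fps_nth G (Suc k)) = real (Suc k) * cmod (fps_nth G (Suc k))"
        by (simp only: norm_mult norm_of_nat)
      also have "\<dots> \<le> real (Suc k) * C" by (intro mult_left_mono Gb) simp
      finally show "cmod (of_nat (Suc k) * fps_nth G (Suc k)) \<le> (real k + 1) * C" by (simp add: add.commute)
      fix j assume "j \<in> {1..k}"
      then have "cmod (fps_nth S (k - j)) \<le> B" unfolding Sn by (intro B(2)[OF _ f]) auto
      then show "cmod (fps_nth G j * fps_nth S (k - j)) \<le> C * B"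
        unfolding norm_mult using Gb C by (intro mult_mono) auto
    qed
    also have "\<dots> \<le> B'" using C B(1) by (simp add: B'_def)
    finally show ?thesis unfolding Sn .
  qed
  have "B' \<ge> B" using B(1) by (simp add: B'_def)
  show ?case
  proof (rule exI[of _ B'], intro conjI allI impI)
    show "B' \<ge> 0" using B(1) \<open>B' \<ge> B\<close> by simp
    fix j I v assume "j < Suc k" "flat_poly C I v"
    then show "cmod (\<Sum>i\<in>I. v i ^ Suc j) \<le> B'"
      using step B(2)[of j I v] \<open>B' \<ge> B\<close> by (cases "j = k") fastforce+
  qed
qed auto

section \<open>Equidistribution for trigonometric polynomials\<close>

definition circle_mean :: "(complex \<Rightarrow> complex) \<Rightarrow> complex" where
  "circle_mean h = integral {0..2 * pi} (\<lambda>\<theta>. h (cis \<theta>)) / (2 * pi)"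

text \<open>The rate \<psi> depends on the degree only, so the statement is uniform over all flat
  polynomials. Evaluating at the radial projections \<open>sgn (v i)\<close> lets h be altered away
  from the circle.\<close>

definition equidist :: "real \<Rightarrow> (complex \<Rightarrow> complex) \<Rightarrow> bool" where
  "equidist C h \<longleftrightarrow> continuous_on UNIV h \<and> (\<exists>\<psi>. \<psi> \<longlonglongrightarrow> (0::real) \<and>
    (\<forall>I v. flat_poly C I v \<longrightarrow>
      cmod ((\<Sum>i\<in>I. h (sgn (v i))) / of_nat (card I) - circle_mean h) \<le> \<psi> (card I)))"

lemma continuous_circle:
  "continuous_on UNIV h \<Longrightarrow> continuous_on A (\<lambda>\<theta>. h (cis \<theta>))"
  by (rule continuous_on_compose2[of UNIV h]) (auto intro!: continuous_intros)

lemma circle_mean_add: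
  "continuous_on UNIV f \<Longrightarrow> continuous_on UNIV g \<Longrightarrow>
    circle_mean (\<lambda>z. f z + g z) = circle_mean f + circle_mean g"
  unfolding circle_mean_def
  by (subst Henstock_Kurzweil_Integration.integral_add)
     (auto intro!: integrable_continuous_interval continuous_circle simp: add_divide_distrib)

lemma circle_mean_scale: "circle_mean (\<lambda>z. c * f z) = c * circle_mean f"
  by (simp add: circle_mean_def)

lemma circle_mean_cnj: "circle_mean (\<lambda>z. cnj (f z)) = cnj (circle_mean f)"
  by (simp add: circle_mean_def integral_cnj)

lemma circle_mean_cong: "(\<And>z. cmod z = 1 \<Longrightarrow> f z = g z) \<Longrightarrow> circle_mean f = circle_mean g"
  by (simp add: circle_mean_def)

lemma equidist_add: assumes "equidist C f" "equidist C g" shows "equidist C (\<lambda>z. f z + g z)"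
proof -
  obtain \<psi> where c: "continuous_on UNIV f" "\<psi> \<longlonglongrightarrow> 0" "\<And>I v. flat_poly C I v \<Longrightarrow>
      cmod ((\<Sum>i\<in>I. f (sgn (v i))) / of_nat (card I) - circle_mean f) \<le> \<psi> (card I)"
    using assms(1) unfolding equidist_def by blast
  obtain \<phi> where d: "continuous_on UNIV g" "\<phi> \<longlonglongrightarrow> 0" "\<And>I v. flat_poly C I v \<Longrightarrow>
      cmod ((\<Sum>i\<in>I. g (sgn (v i))) / of_nat (card I) - circle_mean g) \<le> \<phi> (card I)"
    using assms(2) unfolding equidist_def by blast
  have "cmod ((\<Sum>i\<in>I. f (sgn (v i)) + g (sgn (v i))) / of_nat (card I) - circle_mean (\<lambda>z. f z + g z)) \<le> \<psi> (card I) + \<phi> (card I)"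
    if "flat_poly C I v" for I v
  proof -
    have "(\<Sum>i\<in>I. f (sgn (v i)) + g (sgn (v i))) / of_nat (card I) - circle_mean (\<lambda>z. f z + g z) =
      ((\<Sum>i\<in>I. f (sgn (v i))) / of_nat (card I) - circle_mean f) + ((\<Sum>i\<in>I. g (sgn (v i))) / of_nat (card I) - circle_mean g)"
      by (simp add: circle_mean_add[OF c(1) d(1)] sum.distrib add_divide_distrib)
    then show ?thesis using c(3)[OF that] d(3)[OF that] norm_triangle_mono by metis
  qed
  moreover have "(\<lambda>n. \<psi> n + \<phi> n) \<longlonglongrightarrow> 0" using tendsto_add[OF c(2) d(2)] by simp
  ultimately show ?thesis unfolding equidist_def using c(1) d(1)
    by (intro conjI continuous_on_add exI[of _ "\<lambda>n. \<psi> n + \<phi> n"]) auto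
qed

lemma equidist_scale: assumes "equidist C f" shows "equidist C (\<lambda>z. c * f z)"
proof -
  obtain \<psi> where e: "continuous_on UNIV f" "\<psi> \<longlonglongrightarrow> 0" "\<And>I v. flat_poly C I v \<Longrightarrow>
      cmod ((\<Sum>i\<in>I. f (sgn (v i))) / of_nat (card I) - circle_mean f) \<le> \<psi> (card I)"
    using assms unfolding equidist_def by blast
  have "cmod ((\<Sum>i\<in>I. c * f (sgn (v i))) / of_nat (card I) - circle_mean (\<lambda>z. c * f z)) \<le> cmod c * \<psi> (card I)"
    if "flat_poly C I v" for I v
  proof -
    have "(\<Sum>i\<in>I. c * f (sgn (v i))) / of_nat (card I) - circle_mean (\<lambda>z. c * f z) =
      c * ((\<Sum>i\<in>I. f (sgn (v i))) / of_nat (card I) - circle_mean f)"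
      by (simp add: circle_mean_scale sum_distrib_left right_diff_distrib)
    then show ?thesis using e(3)[OF that] by (simp add: norm_mult mult_left_mono)
  qed
  moreover have "(\<lambda>n. cmod c * \<psi> n) \<longlonglongrightarrow> 0" using tendsto_mult_left[OF e(2), of "cmod c"] by simp
  ultimately show ?thesis unfolding equidist_def using e(1)
    by (intro conjI continuous_on_mult continuous_on_const exI[of _ "\<lambda>n. cmod c * \<psi> n"]) auto
qed

lemma equidist_cnj: assumes "equidist C f" shows "equidist C (\<lambda>z. cnj (f z))"
proof -
  obtain \<psi> where e: "continuous_on UNIV f" "\<psi> \<longlonglongrightarrow> 0" "\<And>I v. flat_poly C I v \<Longrightarrow>
      cmod ((\<Sum>i\<in>I. f (sgn (v i))) / of_nat (card I) - circle_mean f) \<le> \<psi> (card I)"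
    using assms unfolding equidist_def by blast
  have "cmod ((\<Sum>i\<in>I. cnj (f (sgn (v i)))) / of_nat (card I) - circle_mean (\<lambda>z. cnj (f z))) \<le> \<psi> (card I)"
    if "flat_poly C I v" for I v
  proof -
    have "(\<Sum>i\<in>I. cnj (f (sgn (v i)))) / of_nat (card I) - circle_mean (\<lambda>z. cnj (f z)) =
      cnj ((\<Sum>i\<in>I. f (sgn (v i))) / of_nat (card I) - circle_mean f)"
      by (simp add: circle_mean_cnj)
    then show ?thesis using e(3)[OF that] complex_mod_cnj by metis
  qed
  then show ?thesis unfolding equidist_def using e(1,2)
    by (intro conjI continuous_on_cnj exI[of _ \<psi>]) auto
qed

lemma equidist_cong:
  assumes "equidist C f" "continuous_on UNIV g" "\<And>z. cmod z = 1 \<Longrightarrow> f z = g z" shows "equidist C g"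
proof -
  have "(\<Sum>i\<in>I. f (sgn (v i))) = (\<Sum>i\<in>I. g (sgn (v i)))" if "flat_poly C I v" for I v
    using flat_poly_nonzero[OF that] by (intro sum.cong refl assms(3)) (auto simp: norm_sgn)
  moreover have "circle_mean f = circle_mean g" by (rule circle_mean_cong[OF assms(3)])
  ultimately show ?thesis using assms(1,2) unfolding equidist_def by simp
qed

lemma equidist_1: "equidist C (\<lambda>z. 1)"
proof -
  have "circle_mean (\<lambda>z. 1) = 1" by (simp add: circle_mean_def scaleR_conv_of_real)
  then show ?thesis unfolding equidist_def
    by (intro conjI exI[of _ "\<lambda>_. 0"]) (auto simp: flat_poly_def)
qed

lemma circle_mean_power: "m > 0 \<Longrightarrow> circle_mean (\<lambda>z. z ^ m) = 0"
proof -
  assume m: "m > 0"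
  define c where "c = \<i> * of_nat m"
  have c: "c \<noteq> 0" using m by (simp add: c_def)
  have "((\<lambda>t. exp (c * of_real t)) has_integral
      exp (c * of_real (2 * pi)) / c - exp (c * of_real 0) / c) {0..2 * pi}"
  proof (rule fundamental_theorem_of_calculus)
    fix t :: real
    have "((\<lambda>z. exp (c * z) / c) has_field_derivative exp (c * of_real t)) (at (of_real t))"
      using c by (auto intro!: derivative_eq_intros)
    then show "((\<lambda>t. exp (c * of_real t) / c) has_vector_derivative exp (c * of_real t)) (at t within {0..2 * pi})"
      by (rule has_vector_derivative_real_field)
  qed simp
  moreover have "exp (c * of_real (2 * pi)) = 1"
    unfolding exp_eq_1 by (auto simp: c_def intro!: exI[of _ "int m"])
  moreover have "cis t ^ m = exp (c * of_real t)" for t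
    by (simp add: c_def cis_conv_exp exp_of_nat_mult[symmetric] mult_ac)
  ultimately show ?thesis by (simp add: circle_mean_def integral_unique)
qed

lemma power_minus_1_bound:
  fixes t :: real assumes "t \<ge> 0" "t \<le> D" "D \<ge> 1" shows "\<bar>t ^ m - 1\<bar> \<le> real m * D ^ m * \<bar>t - 1\<bar>"
proof -
  have "\<bar>t ^ m - 1\<bar> = \<bar>t - 1\<bar> * \<bar>\<Sum>i<m. t ^ i\<bar>"
    by (metis abs_mult power_diff_1_eq)
  moreover have "\<bar>\<Sum>i<m. t ^ i\<bar> \<le> (\<Sum>i<m. D ^ m)"
  proof (rule order_trans[OF sum_abs sum_mono])
    fix i assume "i \<in> {..<m}"
    have "t ^ i \<le> D ^ i" using assms by (intro power_mono) auto
    also have "\<dots> \<le> D ^ m" using assms \<open>i \<in> {..<m}\<close> by (intro power_increasing) auto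
    finally show "\<bar>t ^ i\<bar> \<le> D ^ m" using assms by simp
  qed
  then have "\<bar>t - 1\<bar> * \<bar>\<Sum>i<m. t ^ i\<bar> \<le> \<bar>t - 1\<bar> * (real m * D ^ m)"
    by (intro mult_left_mono) auto
  ultimately show ?thesis by (simp only: mult_ac)
qed

text \<open>The power sum is bounded, and projecting the roots to the circle changes it by a
  constant times the total radial deviation, which is logarithmic in the degree. Division by the
  degree gives the rate.\<close>

lemma equidist_power: "equidist C (\<lambda>z. z ^ m)"
proof (cases "m = 0 \<or> C < 1")
  case True
  then show ?thesis
  proof
    assume "m = 0" then show ?thesis using equidist_1 by simp
  next
    assume "C < 1"
    then show ?thesis unfolding equidist_def flat_poly_def
      by (intro conjI exI[of _ "\<lambda>_. 0"]) (auto intro!: continuous_intros)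
  qed
next
  case False
  then obtain k where k: "m = Suc k" by (cases m) auto
  have C: "C \<ge> 1" using False by simp
  obtain B where B: "B \<ge> 0" "\<And>I v. flat_poly C I v \<Longrightarrow> cmod (\<Sum>i\<in>I. v i ^ m) \<le> B"
    using flat_poly_power_sums[of "Suc k" C] k by blast
  define E where "E = real m * (C + 1) ^ m * (2 * (C + 1))"
  define \<psi> where "\<psi> = (\<lambda>n. (B + E * ln (C * (real n + 1))) / real n)"
  have "\<psi> \<longlonglongrightarrow> 0" unfolding \<psi>_def using C by real_asymp
  moreover have "cmod ((\<Sum>i\<in>I. sgn (v i) ^ m) / of_nat (card I) - circle_mean (\<lambda>z. z ^ m)) \<le> \<psi> (card I)"
    if f: "flat_poly C I v" for I v
  proof -
    have "cmod (\<Sum>i\<in>I. sgn (v i) ^ m) = cmod ((\<Sum>i\<in>I. v i ^ m) - (\<Sum>i\<in>I. v i ^ m - sgn (v i) ^ m))"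
      by (simp add: sum_subtractf)
    also have "\<dots> \<le> B + (\<Sum>i\<in>I. cmod (v i ^ m - sgn (v i) ^ m))"
      by (rule order_trans[OF norm_triangle_ineq4]) (intro add_mono B(2)[OF f] norm_sum)
    also have "(\<Sum>i\<in>I. cmod (v i ^ m - sgn (v i) ^ m)) \<le> (\<Sum>i\<in>I. real m * (C + 1) ^ m * \<bar>cmod (v i) - 1\<bar>)"
    proof (rule sum_mono)
      fix i assume i: "i \<in> I"
      have nz: "v i \<noteq> 0" using flat_poly_nonzero[OF f i] .
      then have s: "v i = of_real (cmod (v i)) * sgn (v i)"
        by (simp add: sgn_div_norm scaleR_conv_of_real)
      have "v i ^ m = of_real (cmod (v i) ^ m) * sgn (v i) ^ m"
        using arg_cong[OF s, of "\<lambda>t. t ^ m"] by (simp only: power_mult_distrib of_real_power)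
      then have "v i ^ m - sgn (v i) ^ m = of_real (cmod (v i) ^ m - 1) * sgn (v i) ^ m"
        by (simp add: left_diff_distrib)
      then have "cmod (v i ^ m - sgn (v i) ^ m) = \<bar>cmod (v i) ^ m - 1\<bar>"
        using nz by (simp only: norm_mult norm_of_real norm_power norm_sgn) simp
      also have "\<dots> \<le> real m * (C + 1) ^ m * \<bar>cmod (v i) - 1\<bar>"
        using flat_poly_root_bound[OF f i] C by (intro power_minus_1_bound) auto
      finally show "cmod (v i ^ m - sgn (v i) ^ m) \<le> real m * (C + 1) ^ m * \<bar>cmod (v i) - 1\<bar>" .
    qed
    also have "\<dots> = real m * (C + 1) ^ m * (\<Sum>i\<in>I. \<bar>cmod (v i) - 1\<bar>)" by (simp add: sum_distrib_left)
    also have "\<dots> \<le> real m * (C + 1) ^ m * (2 * (C + 1) * ln (C * (real (card I) + 1)))"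
      using C by (intro mult_left_mono flat_poly_radial[OF f]) auto
    finally have "cmod (\<Sum>i\<in>I. sgn (v i) ^ m) \<le> B + E * ln (C * (real (card I) + 1))"
      by (simp add: E_def mult_ac)
    then show ?thesis using False circle_mean_power[of m]
      by (simp add: \<psi>_def norm_divide divide_right_mono)
  qed
  ultimately show ?thesis unfolding equidist_def
    by (intro conjI exI[of _ \<psi>]) (auto intro!: continuous_intros)
qed

text \<open>Polynomials in z and its conjugate, which restrict to the trigonometric polynomials on
  the unit circle.\<close>

inductive trig :: "(complex \<Rightarrow> complex) \<Rightarrow> bool" where
  trig_monom: "trig (\<lambda>z. c * (z ^ k * cnj z ^ l))"
| trig_add: "trig f \<Longrightarrow> trig g \<Longrightarrow> trig (\<lambda>z. f z + g z)"

lemma trig_mult: assumes "trig f" "trig g" shows "trig (\<lambda>z. f z * g z)"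
  using assms
proof (induction arbitrary: g rule: trig.induct)
  case (trig_monom c k l)
  then show ?case
  proof (induction rule: trig.induct)
    case (trig_monom c' k' l')
    have "(\<lambda>z. c * (z ^ k * cnj z ^ l) * (c' * (z ^ k' * cnj z ^ l'))) =
        (\<lambda>z. (c * c') * (z ^ (k + k') * cnj z ^ (l + l')))"
      by (simp add: fun_eq_iff power_add mult_ac)
    then show ?case using trig.trig_monom by simp
  next
    case (trig_add f g)
    then show ?case using trig.trig_add by (simp add: ring_distribs)
  qed
next
  case (trig_add f f')
  then show ?case using trig.trig_add by (simp add: ring_distribs)
qed

text \<open>On the circle z and its conjugate are inverse to each other, so every monomial reduces
  to a power of one of them.\<close>

lemma equidist_trig: assumes "trig h" shows "equidist C h"
  using assms
proof (induction rule: trig.induct)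
  case (trig_monom c k l)
  have "equidist C (\<lambda>z. z ^ k * cnj z ^ l)"
  proof (cases "k \<ge> l")
    case True
    have eq: "z ^ (k - l) = z ^ k * cnj z ^ l" if "cmod z = 1" for z
    proof -
      have "z * cnj z = 1" using that by (simp add: complex_norm_square[symmetric])
      then have "z ^ l * cnj z ^ l = 1" by (simp add: power_mult_distrib[symmetric])
      moreover have "z ^ k = z ^ (k - l) * z ^ l" using True by (simp add: power_add[symmetric])
      ultimately show ?thesis by (simp add: mult.assoc)
    qed
    show ?thesis
      by (rule equidist_cong[OF equidist_power[of C "k - l"] _ eq]) (auto intro!: continuous_intros)
  next
    case False
    have eq: "cnj (z ^ (l - k)) = z ^ k * cnj z ^ l" if "cmod z = 1" for z
    proof -
      have "z * cnj z = 1" using that by (simp add: complex_norm_square[symmetric])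
      then have "z ^ k * cnj z ^ k = 1" by (simp add: power_mult_distrib[symmetric])
      moreover have "cnj z ^ l = cnj z ^ k * cnj z ^ (l - k)" using False by (simp add: power_add[symmetric])
      ultimately show ?thesis by (simp add: mult.assoc[symmetric])
    qed
    show ?thesis
      by (rule equidist_cong[OF equidist_cnj[OF equidist_power[of C "l - k"]] _ eq])
         (auto intro!: continuous_intros)
  qed
  then show ?case by (rule equidist_scale)
qed (rule equidist_add)

text \<open>A real-linear function is a combination of z and its conjugate, with coefficients read
  off from its values at 1 and \<i>.\<close>

lemma trig_real_polynomial:
  fixes p :: "complex \<Rightarrow> real"
  assumes "real_polynomial_function p" shows "trig (\<lambda>z. of_real (p z))"
  using assms
proof (induction rule: real_polynomial_function.induct)
  case (linear f)
  define A B where "A = (of_real (f 1) - \<i> * of_real (f \<i>)) / 2" and "B = (of_real (f 1) + \<i> * of_real (f \<i>)) / 2"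
  have eq: "of_real (f z) = A * (z ^ 1 * cnj z ^ 0) + B * (z ^ 0 * cnj z ^ 1)" for z
  proof -
    interpret bounded_linear f by fact
    have "f z = f (Re z *\<^sub>R 1 + Im z *\<^sub>R \<i>)"
      by (rule arg_cong[of _ _ f]) (simp add: complex_eq_iff)
    then have "f z = Re z * f 1 + Im z * f \<i>" by (simp add: add scaleR)
    then show ?thesis by (simp add: A_def B_def complex_eq_iff field_simps)
  qed
  show ?case unfolding eq by (rule trig_add[OF trig_monom trig_monom])
next
  case (const c)
  show ?case using trig_monom[of "of_real c" 0 0] by simp
next
  case (add f g)
  then show ?case using trig_add by simp
next
  case (mult f g)
  then show ?case using trig_mult by simp
qed

text \<open>The Lipschitz condition in the plane pays for moving the roots to the circle, at the
  cost of L times the radial deviation of each; on the circle continuity is enough for the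
  approximation.\<close>

theorem flat_poly_equidistribution:
  fixes g :: "complex \<Rightarrow> real"
  assumes lip: "\<And>x y. \<bar>g x - g y\<bar> \<le> L * cmod (x - y)" and eps: "\<epsilon> > 0"
  shows "\<exists>N. \<forall>I v. flat_poly C I v \<longrightarrow> card I \<ge> N \<longrightarrow>
    \<bar>(\<Sum>i\<in>I. g (v i)) / real (card I) - integral {0..2 * pi} (\<lambda>\<theta>. g (cis \<theta>)) / (2 * pi)\<bar> < \<epsilon>"
proof (cases "C \<ge> 1")
  case False
  then show ?thesis by (auto simp: flat_poly_def)
next
  case C: True
  have L: "L \<ge> 0" using lip[of 0 1] by simp
  have contg: "continuous_on UNIV g"
    by (rule lipschitz_on_continuous_on[of L], rule lipschitz_onI)
       (use lip L in \<open>auto simp: dist_norm\<close>)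
  \<comment> \<open>Four errors of at most \<epsilon> / 8 will be added: projection of the roots,
    replacement of g by q in the sum and in the integral, and equidistribution for q.\<close>
  obtain q where q: "polynomial_function q" "\<And>z. z \<in> sphere (0::complex) 1 \<Longrightarrow> norm (g z - q z) < \<epsilon> / 8"
    using Stone_Weierstrass_polynomial_function[of "sphere (0::complex) 1" g "\<epsilon> / 8"] eps
      continuous_on_subset[OF contg] by auto
  then have "real_polynomial_function q" by (simp add: real_polynomial_function_eq)
  then have "equidist C (\<lambda>z. of_real (q z))" by (intro equidist_trig trig_real_polynomial)
  then obtain \<psi> where p: "continuous_on UNIV (\<lambda>z. of_real (q z) :: complex)" "\<psi> \<longlonglongrightarrow> 0" "\<And>I v. flat_poly C I v \<Longrightarrow>
      cmod ((\<Sum>i\<in>I. of_real (q (sgn (v i)))) / of_nat (card I) - circle_mean (\<lambda>z. of_real (q z))) \<le> \<psi> (card I)"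
    unfolding equidist_def by blast
  have contq: "continuous_on UNIV q" using q(1) by (simp add: continuous_on_polymonial_function)
  define gm where "gm = integral {0..2 * pi} (\<lambda>\<theta>. g (cis \<theta>)) / (2 * pi)"
  define qm where "qm = integral {0..2 * pi} (\<lambda>\<theta>. q (cis \<theta>)) / (2 * pi)"
  have cc: "continuous_on {0..2 * pi} (\<lambda>\<theta>. h (cis \<theta>))" if "continuous_on UNIV h" for h :: "complex \<Rightarrow> real"
    by (rule continuous_on_compose2[OF that]) (auto intro!: continuous_intros)
  have int: "(\<lambda>\<theta>. h (cis \<theta>)) integrable_on {0..2 * pi}" if "continuous_on UNIV h" for h :: "complex \<Rightarrow> real"
    by (rule integrable_continuous_interval[OF cc[OF that]])
  have cm: "circle_mean (\<lambda>z. of_real (q z)) = of_real qm"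
    unfolding circle_mean_def qm_def using integral_linear[OF int[OF contq], of "of_real :: real \<Rightarrow> complex", OF bounded_linear_of_real]
    by (simp add: o_def)
  have gq: "\<bar>gm - qm\<bar> \<le> \<epsilon> / 8"
  proof -
    have eq: "integral {0..2 * pi} (\<lambda>\<theta>. g (cis \<theta>)) - integral {0..2 * pi} (\<lambda>\<theta>. q (cis \<theta>)) =
        integral {0..2 * pi} (\<lambda>\<theta>. g (cis \<theta>) - q (cis \<theta>))"
      by (rule Henstock_Kurzweil_Integration.integral_diff[symmetric]) (use int contg contq in auto)
    have "norm (integral {0..2 * pi} (\<lambda>\<theta>. g (cis \<theta>) - q (cis \<theta>))) \<le> \<epsilon> / 8 * (2 * pi - 0)"
    proof (rule integral_bound)
      show "continuous_on {0..2 * pi} (\<lambda>\<theta>. g (cis \<theta>) - q (cis \<theta>))"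
        by (intro continuous_on_diff cc contg contq)
      show "norm (g (cis t) - q (cis t)) \<le> \<epsilon> / 8" for t
        using q(2)[of "cis t"] by simp
    qed simp
    then have "\<bar>integral {0..2 * pi} (\<lambda>\<theta>. g (cis \<theta>)) - integral {0..2 * pi} (\<lambda>\<theta>. q (cis \<theta>))\<bar> \<le> \<epsilon> / 8 * (2 * pi)"
      unfolding eq by simp
    then show ?thesis unfolding gm_def qm_def diff_divide_distrib[symmetric] abs_divide
      by (simp add: field_simps)
  qed
  have "(\<lambda>n. L * (2 * (C + 1) * ln (C * (real n + 1))) / real n) \<longlonglongrightarrow> 0" using C by real_asymp
  from order_tendstoD(2)[OF this, of "\<epsilon> / 8"] order_tendstoD(2)[OF p(2), of "\<epsilon> / 8"]
  have "eventually (\<lambda>n. L * (2 * (C + 1) * ln (C * (real n + 1))) / real n < \<epsilon> / 8 \<and> \<psi> n < \<epsilon> / 8) sequentially"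
    using eps by (simp add: eventually_conj)
  then obtain N where N: "\<And>n. n \<ge> N \<Longrightarrow> L * (2 * (C + 1) * ln (C * (real n + 1))) / real n < \<epsilon> / 8 \<and> \<psi> n < \<epsilon> / 8"
    unfolding eventually_sequentially by blast
  have "\<bar>(\<Sum>i\<in>I. g (v i)) / real (card I) - gm\<bar> < \<epsilon>" if f: "flat_poly C I v" and nN: "card I \<ge> N" for I v
  proof -
    define n where "n = real (card I)"
    have n: "n > 0" using f by (simp add: n_def flat_poly_def card_gt_0_iff)
    have nz: "v i \<noteq> 0" if "i \<in> I" for i using flat_poly_nonzero[OF f that] .
    have 1: "\<bar>(\<Sum>i\<in>I. g (v i)) / n - (\<Sum>i\<in>I. g (sgn (v i))) / n\<bar> < \<epsilon> / 8"
    proof -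
      have "\<bar>(\<Sum>i\<in>I. g (v i)) - (\<Sum>i\<in>I. g (sgn (v i)))\<bar> \<le> (\<Sum>i\<in>I. \<bar>g (v i) - g (sgn (v i))\<bar>)"
        unfolding sum_subtractf[symmetric] by (rule sum_abs)
      also have "\<dots> \<le> (\<Sum>i\<in>I. L * \<bar>cmod (v i) - 1\<bar>)"
      proof (rule sum_mono)
        fix i assume i: "i \<in> I"
        have "cmod (v i) *\<^sub>R sgn (v i) = v i" using nz[OF i] by (simp add: sgn_div_norm)
        then have "v i - sgn (v i) = (cmod (v i) - 1) *\<^sub>R sgn (v i)"
          by (simp add: scaleR_diff_left)
        then have "cmod (v i - sgn (v i)) = \<bar>cmod (v i) - 1\<bar>" using nz[OF i] by (simp add: norm_sgn)
        then show "\<bar>g (v i) - g (sgn (v i))\<bar> \<le> L * \<bar>cmod (v i) - 1\<bar>" using lip by metis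
      qed
      also have "\<dots> = L * (\<Sum>i\<in>I. \<bar>cmod (v i) - 1\<bar>)" by (simp add: sum_distrib_left)
      also have "\<dots> \<le> L * (2 * (C + 1) * ln (C * (real (card I) + 1)))"
        using L by (intro mult_left_mono flat_poly_radial[OF f])
      finally have "\<bar>(\<Sum>i\<in>I. g (v i)) - (\<Sum>i\<in>I. g (sgn (v i)))\<bar> / n \<le> L * (2 * (C + 1) * ln (C * (real (card I) + 1))) / n"
        using n by (intro divide_right_mono) auto
      also have "\<dots> < \<epsilon> / 8" using N[OF nN] by (simp add: n_def)
      finally show ?thesis using n by (simp add: diff_divide_distrib[symmetric])
    qed
    have 2: "\<bar>(\<Sum>i\<in>I. g (sgn (v i))) / n - (\<Sum>i\<in>I. q (sgn (v i))) / n\<bar> \<le> \<epsilon> / 8"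
    proof -
      have "\<bar>(\<Sum>i\<in>I. g (sgn (v i))) - (\<Sum>i\<in>I. q (sgn (v i)))\<bar> \<le> (\<Sum>i\<in>I. \<bar>g (sgn (v i)) - q (sgn (v i))\<bar>)"
        unfolding sum_subtractf[symmetric] by (rule sum_abs)
      also have "\<dots> \<le> (\<Sum>i\<in>I. \<epsilon> / 8)"
      proof (rule sum_mono)
        fix i assume "i \<in> I"
        then have "sgn (v i) \<in> sphere 0 1" using nz by (simp add: norm_sgn)
        then show "\<bar>g (sgn (v i)) - q (sgn (v i))\<bar> \<le> \<epsilon> / 8" using q(2) by (force simp: less_imp_le)
      qed
      also have "\<dots> = n * (\<epsilon> / 8)" by (simp add: n_def)
      finally show ?thesis using n by (simp add: diff_divide_distrib[symmetric] field_simps)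
    qed
    have 3: "\<bar>(\<Sum>i\<in>I. q (sgn (v i))) / n - qm\<bar> < \<epsilon> / 8"
    proof -
      have "(\<Sum>i\<in>I. of_real (q (sgn (v i)))) / of_nat (card I) - circle_mean (\<lambda>z. of_real (q z))
          = (of_real ((\<Sum>i\<in>I. q (sgn (v i))) / n - qm) :: complex)"
        by (simp add: cm n_def)
      then have "cmod (of_real ((\<Sum>i\<in>I. q (sgn (v i))) / n - qm)) \<le> \<psi> (card I)" using p(3)[OF f] by simp
      then have "\<bar>(\<Sum>i\<in>I. q (sgn (v i))) / n - qm\<bar> \<le> \<psi> (card I)" unfolding norm_of_real .
      then show ?thesis using N[OF nN] by linarith
    qed
    show ?thesis using 1 2 3 gq eps unfolding n_def by linarith
  qed
  then show ?thesis unfolding gm_def by blast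
qed

subsection \<open>Rounding a power of a linear polynomial\<close>

lemma coeff_linear_power:
  fixes x :: real
  shows "coeff ([:- of_real x, 1:] ^ i :: complex poly) l \<in> \<real>"
    "l > i \<Longrightarrow> coeff ([:- of_real x, 1:] ^ i :: complex poly) l = 0"
    "coeff ([:- of_real x, 1:] ^ i :: complex poly) i = 1"
proof -
  show "coeff ([:- of_real x, 1:] ^ i :: complex poly) l \<in> \<real>"
  proof (induction i arbitrary: l)
    case (Suc i)
    have "coeff ([:- of_real x, 1:] ^ Suc i :: complex poly) l =
        - of_real x * coeff ([:- of_real x, 1:] ^ i) l + (case l of 0 \<Rightarrow> 0 | Suc l' \<Rightarrow> coeff ([:- of_real x, 1:] ^ i) l')"
      by (simp add: mult_pCons_left coeff_pCons split: nat.split)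
    moreover have "\<dots> \<in> \<real>" by (cases l) (use Suc in auto)
    ultimately show ?case by simp
  qed simp
  have d: "degree ([:- of_real x, 1:] ^ i :: complex poly) = i" by (rule degree_linear_power)
  show "l > i \<Longrightarrow> coeff ([:- of_real x, 1:] ^ i :: complex poly) l = 0"
    by (rule coeff_eq_0) (simp only: d)
  have "lead_coeff ([:- of_real x, 1:] ^ i :: complex poly) = 1" by (simp add: lead_coeff_power)
  then show "coeff ([:- of_real x, 1:] ^ i :: complex poly) i = 1" unfolding d .
qed

text \<open>The admissible values \<open>D * M\<close> have spacing m D, so a closed interval of
  that length contains one. The interval starts at distance m D above c, so that the error is
  bounded below as well as above.\<close>

lemma round_in_residue_class:
  fixes c D :: real and m :: int
  assumes "D > 0" "m > 0"
  shows "\<exists>M::int. m dvd M - 1 \<and> of_int m * D \<le> D * of_int M - c \<and> D * of_int M - c \<le> 2 * of_int m * D"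
proof -
  define y where "y = (c / D + of_int m - 1) / of_int m"
  define M where "M = 1 + m * \<lceil>y\<rceil>"
  have y: "D * (1 + of_int m * y) - c = of_int m * D"
  proof -
    have "of_int m * y = c / D + of_int m - 1" using assms by (simp add: y_def)
    then have "D * (1 + of_int m * y) = D * (c / D) + D * of_int m" by (simp add: ring_distribs)
    then show ?thesis using assms by simp
  qed
  have "y \<le> of_int \<lceil>y\<rceil>" "of_int \<lceil>y\<rceil> \<le> y + 1" by linarith+
  then have "D * (of_int m * y) \<le> D * (of_int m * of_int \<lceil>y\<rceil>)"
    "D * (of_int m * of_int \<lceil>y\<rceil>) \<le> D * (of_int m * (y + 1))"
    using assms by (auto intro!: mult_left_mono)
  then have "of_int m * D \<le> D * of_int M - c" "D * of_int M - c \<le> 2 * of_int m * D"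
    using y by (simp_all add: M_def algebra_simps)
  then show ?thesis by (intro exI[of _ M]) (simp add: M_def)
qed

text \<open>The coefficients are rounded from the top down: adding a multiple of the i-th power
  does not disturb the coefficients above i.\<close>

lemma ex_rounded_poly:
  fixes D :: "nat \<Rightarrow> real" and m :: int and x :: real
  assumes D: "\<And>i. D i > 0" and m: "m > 0"
  shows "\<exists>M \<delta>. (\<forall>i<n. m dvd M i - 1 \<and> of_int m * D i \<le> \<delta> i \<and> \<delta> i \<le> 2 * of_int m * D i) \<and>
    (\<forall>z::complex. z ^ n + (\<Sum>i<n. of_real (D i * of_int (M i)) * z ^ i) =
      (z - of_real x) ^ n + (\<Sum>i<n. of_real (\<delta> i) * (z - of_real x) ^ i))"
proof -
  define w where "w = ([:- of_real x, 1:] :: complex poly)"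
  note cw = coeff_linear_power[where x = x, folded w_def]
  \<comment> \<open>Only the corrections of index at least j are included. The later ones have
    degree below j, so the coefficients from j upwards are already final.\<close>
  define g where "g = (\<lambda>\<delta> j. w ^ n + (\<Sum>i\<in>{j..<n}. Polynomial.smult (of_real (\<delta> i)) (w ^ i)))"
  have "j \<le> n \<Longrightarrow> \<exists>M \<delta>. (\<forall>i. n - j \<le> i \<and> i < n \<longrightarrow> m dvd M i - 1 \<and> of_int m * D i \<le> \<delta> i \<and> \<delta> i \<le> 2 * of_int m * D i) \<and>
      (\<forall>l\<ge>n - j. coeff (g \<delta> (n - j)) l = (if l = n then 1 else if l < n then of_real (D l * of_int (M l)) else 0))" for j
  proof (induction j)
    case 0
    show ?case
      by (intro exI[of _ "\<lambda>_. 0 :: int"] exI[of _ "\<lambda>_. 0 :: real"]) (auto simp: g_def cw)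
  next
    case (Suc j)
    then obtain M \<delta> where IH: "\<forall>i. n - j \<le> i \<and> i < n \<longrightarrow> m dvd M i - 1 \<and> of_int m * D i \<le> \<delta> i \<and> \<delta> i \<le> 2 * of_int m * D i"
      "\<forall>l\<ge>n - j. coeff (g \<delta> (n - j)) l = (if l = n then 1 else if l < n then of_real (D l * of_int (M l)) else 0)"
      by auto
    define s where "s = n - Suc j"
    have s: "s < n" "n - j = Suc s" using Suc.prems by (auto simp: s_def)
    \<comment> \<open>The coefficient left at s by the higher terms; since \<open>w ^ s\<close> is
      monic of degree s, a suitable multiple of it brings this coefficient to
      \<open>D s * N\<close>.\<close>
    define c where "c = Re (coeff (g \<delta> (Suc s)) s)"
    have "coeff (g \<delta> (Suc s)) s \<in> \<real>"
      by (auto simp: g_def coeff_sum intro!: Reals_add sum_in_Reals Reals_mult cw)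
    then have c: "coeff (g \<delta> (Suc s)) s = of_real c" by (simp add: c_def)
    obtain N where N: "m dvd N - 1" "of_int m * D s \<le> D s * of_int N - c" "D s * of_int N - c \<le> 2 * of_int m * D s"
      using round_in_residue_class[OF D m] by blast
    define M' where "M' = M(s := N)"
    define \<delta>' where "\<delta>' = \<delta>(s := D s * of_int N - c)"
    have gg: "g \<delta>' s = Polynomial.smult (of_real (D s * of_int N - c)) (w ^ s) + g \<delta> (Suc s)"
    proof -
      have "(\<Sum>i\<in>{Suc s..<n}. Polynomial.smult (of_real (\<delta>' i)) (w ^ i)) =
          (\<Sum>i\<in>{Suc s..<n}. Polynomial.smult (of_real (\<delta> i)) (w ^ i))"
        by (rule sum.cong) (auto simp: \<delta>'_def)
      then show ?thesis using s(1) unfolding g_def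
        by (simp add: sum.atLeast_Suc_lessThan \<delta>'_def)
    qed
    have "coeff (g \<delta>' s) l = (if l = n then 1 else if l < n then of_real (D l * of_int (M' l)) else 0)" if l: "l \<ge> s" for l
    proof (cases "l = s")
      case True
      then show ?thesis using s(1) by (simp add: gg c cw M'_def)
    next
      case False
      then have "l > s" using l by simp
      then show ?thesis using IH(2) s by (simp add: gg cw M'_def)
    qed
    moreover have "m dvd M' i - 1 \<and> of_int m * D i \<le> \<delta>' i \<and> \<delta>' i \<le> 2 * of_int m * D i" if "s \<le> i" "i < n" for i
      using IH(1) that N s by (cases "i = s") (auto simp: M'_def \<delta>'_def)
    ultimately show ?case unfolding s_def[symmetric]
      by (intro exI[of _ M'] exI[of _ \<delta>']) blast
  qed
  from this[of n] obtain M \<delta> where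
    1: "\<forall>i<n. m dvd M i - 1 \<and> of_int m * D i \<le> \<delta> i \<and> \<delta> i \<le> 2 * of_int m * D i" and
    2: "\<forall>l. coeff (g \<delta> 0) l = (if l = n then 1 else if l < n then of_real (D l * of_int (M l)) else 0)"
    by auto
  have "monom 1 n + (\<Sum>i<n. monom (of_real (D i * of_int (M i))) i) = g \<delta> 0"
  proof (rule poly_eqI)
    fix l
    have "coeff (\<Sum>i<n. monom (of_real (D i * of_int (M i)) :: complex) i) l =
        (if l < n then of_real (D l * of_int (M l)) else 0)"
      by (simp add: coeff_sum)
    then show "coeff (monom 1 n + (\<Sum>i<n. monom (of_real (D i * of_int (M i))) i)) l = coeff (g \<delta> 0) l"
      using 2 by auto
  qed
  then have "poly (monom 1 n + (\<Sum>i<n. monom (of_real (D i * of_int (M i))) i)) z = poly (g \<delta> 0) z" for z by simp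
  then have "z ^ n + (\<Sum>i<n. of_real (D i * of_int (M i)) * z ^ i) =
      (z - of_real x) ^ n + (\<Sum>i<n. of_real (\<delta> i) * (z - of_real x) ^ i)" for z :: complex
    by (simp add: poly_monom poly_sum g_def w_def poly_power lessThan_atLeast0)
  then show ?thesis using 1 by blast
qed

text \<open>Of the two consecutive integers next to y at most one is divisible by n.\<close>

lemma ex_nearby_nonmultiple:
  fixes y :: real and n :: nat
  assumes "n \<ge> 2" shows "\<exists>k::int. \<not> int n dvd k \<and> \<bar>of_int k - y\<bar> \<le> 1"
proof (cases "int n dvd \<lfloor>y\<rfloor>")
  case False
  moreover have "\<bar>of_int \<lfloor>y\<rfloor> - y\<bar> \<le> 1" by linarith
  ultimately show ?thesis by blast
next
  case True
  have "\<not> int n dvd \<lfloor>y\<rfloor> + 1"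
  proof
    assume "int n dvd \<lfloor>y\<rfloor> + 1"
    then have "int n dvd \<lfloor>y\<rfloor> + 1 - \<lfloor>y\<rfloor>" using True by (rule dvd_diff)
    then show False using assms by simp
  qed
  moreover have "\<bar>of_int (\<lfloor>y\<rfloor> + 1) - y\<bar> \<le> 1" by linarith
  ultimately show ?thesis by blast
qed

text \<open>In the bound 2 Q^2 one factor Q comes from rounding the exponents up to integers and 2 Q
  from rounding the coefficients within a class modulo Q.\<close>

lemma ex_flat_ramified_poly:
  fixes k :: "nat \<Rightarrow> int" and x :: real
  assumes n: "prime n" and T: "finite T" "T \<noteq> {}" "\<And>p. p \<in> T \<Longrightarrow> prime p"
    and k: "\<And>p. p \<in> T \<Longrightarrow> \<not> int n dvd k p"
  defines "R \<equiv> \<Prod>p\<in>T. real p powr (- real_of_int (k p) / real n)"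
  defines "Q \<equiv> real (\<Prod>T)"
  shows "\<exists>e M. ramified_poly n T k e M \<and>
    flat_poly (2 * Q\<^sup>2) {\<beta>. reval (ramified_poly.F n T e M) \<beta> = 0} (\<lambda>\<beta>. (\<beta> - of_real x) / of_real R)"
proof -
  have n0: "n > 0" using n by (rule prime_gt_0_nat)
  have T1: "real p \<ge> 1" "real p > 0" if "p \<in> T" for p using prime_gt_0_nat[OF T(3)[OF that]] by auto
  have Tpos: "(\<Prod>T) > 0" using T prime_gt_0_nat by (simp add: prod_pos)
  have Q1: "Q \<ge> 1" using Tpos unfolding Q_def by linarith
  have R0: "R > 0" unfolding R_def using T1 by (intro prod_pos) force
  \<comment> \<open>The height of the prescribed segment at i, rounded up to the next
    integer.\<close>
  define e where "e = (\<lambda>p i. \<lceil>- real_of_int (k p) * real (n - i) / real n\<rceil>)"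
  define D where "D = (\<lambda>i. \<Prod>p\<in>T. real p powi e p i)"
  have D0: "D i > 0" for i unfolding D_def using T1 by (intro prod_pos) simp
  have DR: "D i \<le> Q * R ^ (n - i)" for i
  proof -
    have "D i \<le> (\<Prod>p\<in>T. real p * (real p powr (- real_of_int (k p) / real n)) ^ (n - i))"
      unfolding D_def
    proof (rule prod_mono, intro conjI)
      fix p assume p: "p \<in> T"
      show "0 \<le> real p powi e p i" by simp
      have "real p powi e p i = real p powr real_of_int (e p i)" using T1[OF p] by (simp add: powr_real_of_int')
      also have "\<dots> \<le> real p powr (1 + (- real_of_int (k p) / real n) * real (n - i))"
        using T1[OF p] unfolding e_def by (intro powr_mono) (simp, linarith, simp)
      also have "\<dots> = real p * (real p powr (- real_of_int (k p) / real n)) ^ (n - i)"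
      proof -
        define c where "c = - real_of_int (k p) / real n"
        have "real p powr (1 + c * real (n - i)) = real p * (real p powr c) ^ (n - i)"
          using T1[OF p] by (simp add: powr_add powr_power mult.commute)
        then show ?thesis by (simp only: c_def)
      qed
      finally show "real p powi e p i \<le> real p * (real p powr (- real_of_int (k p) / real n)) ^ (n - i)" .
    qed
    also have "\<dots> = Q * R ^ (n - i)" by (simp add: Q_def R_def prod.distrib prod_power_distrib)
    finally show ?thesis .
  qed
  have e0: "e p 0 = - k p" for p
  proof -
    have "- real_of_int (k p) * real (n - 0) / real n = real_of_int (- k p)" using n0 by simp
    then show ?thesis by (simp only: e_def ceiling_of_int)
  qed
  \<comment> \<open>At the left end the height is an integer and rounding loses nothing.\<close>
  have D_0: "D 0 = R ^ n"
    unfolding D_def R_def prod_power_distrib e0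
  proof (rule prod.cong)
    fix p assume p: "p \<in> T"
    have "(real p powr (- real_of_int (k p) / real n)) ^ n = real p powr ((- real_of_int (k p) / real n) * real n)"
      using T1[OF p] by (subst powr_power) (auto simp: mult.commute)
    also have "\<dots> = real p powr real_of_int (- k p)" using n0 by simp
    also have "\<dots> = real p powi (- k p)" using T1[OF p] by (subst powr_real_of_int') auto
    finally show "real p powi - k p = (real p powr (- real_of_int (k p) / real n)) ^ n" ..
  qed simp
  have "int (\<Prod>T) > 0" using Tpos by (simp only: of_nat_0_less_iff)
  from ex_rounded_poly[of D "int (\<Prod>T)" n x, OF D0 this]
  obtain M \<delta> where rounded: "(\<forall>i<n. int (\<Prod>T) dvd M i - 1 \<and> of_int (int (\<Prod>T)) * D i \<le> \<delta> i \<and>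
      \<delta> i \<le> 2 * of_int (int (\<Prod>T)) * D i) \<and>
    (\<forall>z::complex. z ^ n + (\<Sum>i<n. of_real (D i * of_int (M i)) * z ^ i) =
      (z - of_real x) ^ n + (\<Sum>i<n. of_real (\<delta> i) * (z - of_real x) ^ i))"
    by blast
  then have M: "\<forall>i<n. int (\<Prod>T) dvd M i - 1 \<and> Q * D i \<le> \<delta> i \<and> \<delta> i \<le> 2 * Q * D i"
    unfolding Q_def of_int_of_nat_eq by (rule conjunct1)
  have id: "\<forall>z::complex. z ^ n + (\<Sum>i<n. of_real (D i * of_int (M i)) * z ^ i) =
      (z - of_real x) ^ n + (\<Sum>i<n. of_real (\<delta> i) * (z - of_real x) ^ i)"
    using rounded by (rule conjunct2)
  have ram: "ramified_poly n T k e M"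
  proof
    show "prime n" "finite T" "T \<noteq> {}" by (rule n T)+
    fix p assume p: "p \<in> T"
    show "prime p" "\<not> int n dvd k p" "e p 0 = - k p" by (rule T(3)[OF p] k[OF p] e0)+
    have "int p dvd int (\<Prod>T)" using p T(1) by (simp add: dvd_prod_eqI)
    then have "int p dvd M 0 - 1" using M n0 dvd_trans by blast
    then show "\<not> int p dvd M 0"
      using prime_gt_1_nat[OF T(3)[OF p]] dvd_diff[of "int p" "M 0" "M 0 - 1"] by auto
    fix i assume "i < n"
    have "- real_of_int (k p) * real (n - i) / real n \<le> of_int (e p i)" by (simp add: e_def)
    then have "- real_of_int (k p) * real (n - i) \<le> real n * of_int (e p i)"
      using n0 by (simp add: field_simps)
    then have "real_of_int (- k p * int (n - i)) \<le> real_of_int (int n * e p i)" by simp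
    then show "- k p * int (n - i) \<le> int n * e p i" by (simp only: of_int_le_iff)
  qed
  interpret ramified_poly n T k e M by (rule ram)
  define Z where "Z = {\<beta>. reval F \<beta> = 0}"
  have cZ: "card Z = n" unfolding Z_def by (rule card_roots)
  then have fZ: "finite Z" using n0 card_ge_0_finite by blast
  define v where "v = (\<lambda>\<beta>. (\<beta> - of_real x) / of_real R :: complex)"
  have cfD: "(of_rat (cf i) :: complex) = of_real (D i * of_int (M i))" for i
    unfolding of_rat_cf D_def by simp
  have rF: "reval F z = (z - of_real x) ^ n + (\<Sum>i<n. of_real (\<delta> i) * (z - of_real x) ^ i)" for z
    using id unfolding reval_F cfD by simp
  \<comment> \<open>The polynomial F written in y = (z - x) / R and made monic again.\<close>
  define h where "h = monom 1 n + (\<Sum>i<n. monom (of_real (\<delta> i / R ^ (n - i)) :: complex) i)"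
  have "poly (\<Prod>\<beta>\<in>Z. [:- v \<beta>, 1:]) y = poly h y" for y
  proof -
    define z where "z = of_real x + of_real R * y"
    have Rc: "(of_real R :: complex) \<noteq> 0" using R0 by simp
    have "reval F z = (\<Prod>\<beta>\<in>Z. z - \<beta>)"
      using arg_cong[OF factor, of "\<lambda>p. poly p z"] by (simp add: reval_def poly_prod Z_def)
    also have "\<dots> = (\<Prod>\<beta>\<in>Z. of_real R * (y - v \<beta>))"
      by (rule prod.cong) (use Rc in \<open>auto simp: z_def v_def field_simps\<close>)
    also have "\<dots> = of_real R ^ n * poly (\<Prod>\<beta>\<in>Z. [:- v \<beta>, 1:]) y"
      by (simp add: prod.distrib cZ poly_prod)
    finally have 1: "reval F z = of_real R ^ n * poly (\<Prod>\<beta>\<in>Z. [:- v \<beta>, 1:]) y" .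
    have "reval F z = of_real R ^ n * y ^ n + (\<Sum>i<n. of_real (\<delta> i) * (of_real R * y) ^ i)"
      by (simp add: rF z_def power_mult_distrib)
    also have "(\<Sum>i<n. of_real (\<delta> i) * (of_real R * y) ^ i) =
        of_real R ^ n * (\<Sum>i<n. of_real (\<delta> i / R ^ (n - i)) * y ^ i)"
      unfolding sum_distrib_left
    proof (rule sum.cong)
      fix i assume "i \<in> {..<n}"
      then have "(of_real R :: complex) ^ n = of_real R ^ i * of_real R ^ (n - i)"
        by (simp add: power_add[symmetric])
      then show "of_real (\<delta> i) * (of_real R * y) ^ i = of_real R ^ n * (of_real (\<delta> i / R ^ (n - i)) * y ^ i)"
        using Rc by (simp add: power_mult_distrib field_simps)
    qed simp
    finally have "reval F z = of_real R ^ n * poly h y"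
      by (simp add: h_def poly_monom poly_sum ring_distribs)
    then show ?thesis using 1 Rc by simp
  qed
  then have ph: "(\<Prod>\<beta>\<in>Z. [:- v \<beta>, 1:]) = h"
    by (intro poly_eq_poly_eq_iff[THEN iffD1] ext)
  have ch: "coeff h j = (if j = n then 1 else if j < n then of_real (\<delta> j / R ^ (n - j)) else 0)" for j
    by (auto simp: h_def coeff_sum)
  have dl: "Q * D j / R ^ (n - j) \<le> \<delta> j / R ^ (n - j)" "\<delta> j / R ^ (n - j) \<le> 2 * Q\<^sup>2" "\<delta> j \<ge> 0" if "j < n" for j
  proof -
    show "Q * D j / R ^ (n - j) \<le> \<delta> j / R ^ (n - j)" using M that R0 by (intro divide_right_mono) auto
    have "\<delta> j \<le> 2 * Q * D j" using M that by blast
    also have "\<dots> \<le> 2 * Q * (Q * R ^ (n - j))" using DR Q1 by (intro mult_left_mono) auto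
    finally show "\<delta> j / R ^ (n - j) \<le> 2 * Q\<^sup>2" using R0 by (simp add: field_simps power2_eq_square)
    have "0 \<le> Q * D j" using Q1 D0[of j] by simp
    then show "\<delta> j \<ge> 0" using M that by force
  qed
  have Q2: "2 * Q\<^sup>2 \<ge> 1" using one_le_power[OF Q1, of 2] by simp
  have "flat_poly (2 * Q\<^sup>2) Z v"
    unfolding flat_poly_def ph
  proof (intro conjI allI)
    show "finite Z" "Z \<noteq> {}" "2 * Q\<^sup>2 \<ge> 1" using fZ cZ n0 Q2 by auto
    fix j show "cmod (coeff h j) \<le> 2 * Q\<^sup>2"
      using Q2 dl[of j] R0 by (auto simp: ch norm_divide norm_power)
    \<comment> \<open>The lower end of the rounding interval, at index 0, is what bounds the
      constant coefficient from below.\<close>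
    have "Q * D 0 / R ^ n = Q" using R0 by (simp add: D_0)
    then have "\<delta> 0 / R ^ n \<ge> 1" using dl(1)[of 0] n0 Q1 by simp
    moreover have "coeff h 0 = of_real (\<delta> 0 / R ^ n)" using n0 unfolding ch by simp
    ultimately show "cmod (coeff h 0) \<ge> 1" by (simp only: norm_of_real)
  qed
  then show ?thesis using ram unfolding Z_def v_def by blast
qed

subsection \<open>The density theorem\<close>

lemma log_plus_eq: "t \<ge> 0 \<Longrightarrow> log_plus t = ln (max 1 t)"
  by (auto simp: log_plus_def max_def)

lemma log_plus_nonneg: "log_plus t \<ge> 0"
  by (simp add: log_plus_def)

lemma tendsto_log_plus:
  assumes "(f \<longlongrightarrow> l) A" "eventually (\<lambda>n. f n \<ge> 0) A" "l \<ge> 0"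
  shows "((\<lambda>n. log_plus (f n)) \<longlongrightarrow> log_plus l) A"
proof -
  have "((\<lambda>n. ln (max 1 (f n))) \<longlongrightarrow> ln (max 1 l)) A"
    by (intro tendsto_intros assms) auto
  moreover have "eventually (\<lambda>n. ln (max 1 (f n)) = log_plus (f n)) A"
    using assms(2) by eventually_elim (simp add: log_plus_eq)
  ultimately show ?thesis unfolding log_plus_eq[OF assms(3)] using tendsto_cong by force
qed

lemma log_plus_lipschitz:
  assumes "s \<ge> 0" "t \<ge> 0" shows "\<bar>log_plus s - log_plus t\<bar> \<le> \<bar>s - t\<bar>"
proof -
  have *: "ln (max 1 s) - ln (max 1 t) \<le> \<bar>s - t\<bar>" for s t :: real
  proof -
    have "ln (max 1 s) - ln (max 1 t) \<le> (max 1 s - max 1 t) / max 1 t" by (rule ln_diff_le) auto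
    also have "\<dots> \<le> \<bar>s - t\<bar> / max 1 t" by (intro divide_right_mono) auto
    also have "\<dots> \<le> \<bar>s - t\<bar> / 1" by (intro divide_left_mono) auto
    finally show ?thesis by simp
  qed
  show ?thesis using *[of s t] *[of t s] unfolding log_plus_eq[OF assms(1)] log_plus_eq[OF assms(2)]
    by linarith
qed

definition log_plus_ab :: "rat \<Rightarrow> rat \<Rightarrow> complex \<Rightarrow> real" where
  "log_plus_ab a b z = log_plus (cmod z) + log_plus (cmod (of_rat a * z + of_rat b))"

lemma log_plus_ab_lipschitz:
  "\<bar>log_plus_ab a b z - log_plus_ab a b w\<bar> \<le> (1 + \<bar>of_rat a\<bar>) * cmod (z - w)"
proof -
  have 1: "\<bar>log_plus (cmod z) - log_plus (cmod w)\<bar> \<le> cmod (z - w)"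
    using log_plus_lipschitz[OF norm_ge_zero norm_ge_zero, of z w] norm_triangle_ineq3[of z w] by linarith
  have na: "cmod (of_rat a) = \<bar>of_rat a\<bar>"
    by (cases a) (simp add: of_rat_rat norm_divide)
  have "(of_rat a * z + of_rat b) - (of_rat a * w + of_rat b) = of_rat a * (z - w)" by (simp add: algebra_simps)
  then have "cmod ((of_rat a * z + of_rat b) - (of_rat a * w + of_rat b)) = \<bar>of_rat a\<bar> * cmod (z - w)"
    by (simp only: norm_mult na)
  then have "\<bar>cmod (of_rat a * z + of_rat b) - cmod (of_rat a * w + of_rat b)\<bar> \<le> \<bar>of_rat a\<bar> * cmod (z - w)"
    using norm_triangle_ineq3[of "of_rat a * z + of_rat b" "of_rat a * w + of_rat b"] by linarith
  then have 2: "\<bar>log_plus (cmod (of_rat a * z + of_rat b)) - log_plus (cmod (of_rat a * w + of_rat b))\<bar> \<le> \<bar>of_rat a\<bar> * cmod (z - w)"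
    using log_plus_lipschitz[OF norm_ge_zero norm_ge_zero, of "of_rat a * z + of_rat b" "of_rat a * w + of_rat b"]
    by linarith
  show ?thesis using 1 2 unfolding log_plus_ab_def by (simp add: ring_distribs)
qed

text \<open>T is a parameter because the sum will be formed over a set larger than
  \<open>S_ab\<close>.\<close>

definition local_sum :: "rat \<Rightarrow> rat \<Rightarrow> nat set \<Rightarrow> (nat \<Rightarrow> real) \<Rightarrow> real" where
  "local_sum a b T r = (\<Sum>p\<in>T. log_plus (r p) + log_plus (max (padic_abs p a * r p) (padic_abs p b)))"

definition arch_mean :: "rat \<Rightarrow> rat \<Rightarrow> real \<Rightarrow> real \<Rightarrow> real" where
  "arch_mean a b x R = integral {0..2 * pi} (\<lambda>\<theta>. log_plus_ab a b (of_real x + of_real R * cis \<theta>)) / (2 * pi)"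

lemma Gamma_ab_eq:
  "Gamma_ab a b x r = local_sum a b (S_ab a b) r + arch_mean a b x (1 / (\<Prod>p\<in>S_ab a b. r p))"
proof -
  define R where "R = (\<Prod>p\<in>S_ab a b. r p)"
  have e: "log_plus (cmod (exp (\<i> * of_real \<theta>) / of_real R + of_real x)) +
      log_plus (cmod (of_rat a * exp (\<i> * of_real \<theta>) / of_real R + of_rat b + of_rat a * of_real x)) =
      log_plus_ab a b (of_real x + of_real (1 / R) * cis \<theta>)" for \<theta>
    by (simp add: log_plus_ab_def cis_conv_exp algebra_simps)
  show ?thesis unfolding Gamma_ab_def local_sum_def arch_mean_def R_def[symmetric] e by simp
qed

text \<open>The realizable radii \<open>r' n\<close> and \<open>Rn n\<close> tend to the given ones.
  The errors from the local terms, from the change of radius and from equidistribution are each kept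
  below \<epsilon> / 3.\<close>

lemma ex_height_near:
  fixes x :: real and r :: "nat \<Rightarrow> real"
  assumes a: "a \<noteq> 0" and T: "finite T" "T \<noteq> {}" "\<And>p. p \<in> T \<Longrightarrow> prime p" "S_ab a b \<subseteq> T"
    and r: "\<And>p. p \<in> T \<Longrightarrow> r p > 0" and eps: "\<epsilon> > 0"
  shows "\<exists>\<alpha>. algebraic \<alpha> \<and> \<bar>height_ab a b \<alpha> - (local_sum a b T r + arch_mean a b x (1 / (\<Prod>p\<in>T. r p)))\<bar> < \<epsilon>"
proof -
  define R where "R = 1 / (\<Prod>p\<in>T. r p)"
  have R0: "R > 0" unfolding R_def using r by (simp add: prod_pos)
  define C where "C = 2 * (real (\<Prod>T))\<^sup>2"
  define L where "L = 1 + \<bar>of_rat a :: real\<bar>"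
  have p1: "real p > 1" if "p \<in> T" for p using prime_gt_1_nat[OF T(3)[OF that]] by simp
  \<comment> \<open>An integer within 1 of n times the logarithm of the radius to base p; after
    division by n the difference vanishes in the limit.\<close>
  define k where "k = (\<lambda>n p. SOME k::int. \<not> int n dvd k \<and> \<bar>of_int k - real n * log (real p) (r p)\<bar> \<le> 1)"
  have k: "\<not> int n dvd k n p \<and> \<bar>of_int (k n p) - real n * log (real p) (r p)\<bar> \<le> 1" if "n \<ge> 2" for n p
    unfolding k_def by (rule someI_ex) (rule ex_nearby_nonmultiple[OF that])
  define r' where "r' = (\<lambda>n p. real p powr (real_of_int (k n p) / real n))"
  have lim_r': "(\<lambda>n. r' n p) \<longlonglongrightarrow> r p" if p: "p \<in> T" for p
  proof -
    have "(\<lambda>n. real_of_int (k n p) / real n - log (real p) (r p)) \<longlonglongrightarrow> 0"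
    proof (rule Lim_null_comparison)
      show "eventually (\<lambda>n. norm (real_of_int (k n p) / real n - log (real p) (r p)) \<le> 1 / real n) sequentially"
        using eventually_ge_at_top[of 2]
      proof eventually_elim
        case (elim n)
        have "real_of_int (k n p) / real n - log (real p) (r p) = (of_int (k n p) - real n * log (real p) (r p)) / real n"
          using elim by (simp add: field_simps)
        then show ?case using k[OF elim, of p] elim by (simp add: abs_divide divide_right_mono)
      qed
      show "(\<lambda>n. 1 / real n) \<longlonglongrightarrow> 0" by (rule lim_1_over_n)
    qed
    then have "(\<lambda>n. real_of_int (k n p) / real n) \<longlonglongrightarrow> log (real p) (r p)" by (simp add: LIM_zero_iff)
    then have "(\<lambda>n. r' n p) \<longlonglongrightarrow> real p powr log (real p) (r p)"
      unfolding r'_def using p1[OF p] by (intro tendsto_powr tendsto_const) auto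
    then show ?thesis using p1[OF p] r[OF p] by simp
  qed
  have r'0: "r' n p \<ge> 0" for n p by (simp add: r'_def)
  have pn: "padic_abs p q \<ge> 0" for p q by (simp add: padic_abs_def)
  have lim1: "(\<lambda>n. local_sum a b T (r' n)) \<longlonglongrightarrow> local_sum a b T r"
    unfolding local_sum_def
    by (intro tendsto_sum tendsto_add tendsto_log_plus tendsto_max tendsto_mult tendsto_const lim_r' always_eventually)
       (use r r'0 pn in \<open>auto simp: le_max_iff_disj intro: less_imp_le\<close>)
  define Rn where "Rn = (\<lambda>n. \<Prod>p\<in>T. real p powr (- real_of_int (k n p) / real n))"
  have Rn_eq: "Rn n = 1 / (\<Prod>p\<in>T. r' n p)" for n
    by (simp add: Rn_def r'_def powr_minus prod_inversef[symmetric] divide_inverse o_def)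
  have lim2: "(\<lambda>n. L * (C + 1) * \<bar>Rn n - R\<bar>) \<longlonglongrightarrow> 0"
  proof -
    have nz: "(\<Prod>p\<in>T. r p) \<noteq> 0" using R0 unfolding R_def by auto
    have "(\<lambda>n. 1 / (\<Prod>p\<in>T. r' n p)) \<longlonglongrightarrow> 1 / (\<Prod>p\<in>T. r p)"
      by (intro tendsto_divide tendsto_const tendsto_prod lim_r' nz)
    then have "Rn \<longlonglongrightarrow> R" by (simp only: Rn_eq[symmetric] R_def)
    then have "(\<lambda>n. \<bar>Rn n - R\<bar>) \<longlonglongrightarrow> 0" by (simp add: LIM_zero_iff tendsto_rabs_zero_iff)
    from tendsto_mult_left[OF this, of "L * (C + 1)"] show ?thesis by simp
  qed
  \<comment> \<open>The limit radius R is used instead of \<open>Rn n\<close>, so that one test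
    function and one N serve for all degrees.\<close>
  define g where "g = (\<lambda>v. log_plus_ab a b (of_real x + of_real R * v))"
  have lip: "\<bar>g v - g w\<bar> \<le> (L * R) * cmod (v - w)" for v w
  proof -
    have "\<bar>g v - g w\<bar> \<le> L * cmod ((of_real x + of_real R * v) - (of_real x + of_real R * w))"
      unfolding g_def L_def by (rule log_plus_ab_lipschitz)
    also have "(of_real x + of_real R * v) - (of_real x + of_real R * w) = of_real R * (v - w)" by (simp add: algebra_simps)
    finally show ?thesis using R0 by (simp add: norm_mult mult.assoc)
  qed
  obtain N where N: "\<And>I v. flat_poly C I v \<Longrightarrow> card I \<ge> N \<Longrightarrow>
      \<bar>(\<Sum>i\<in>I. g (v i)) / real (card I) - integral {0..2 * pi} (\<lambda>\<theta>. g (cis \<theta>)) / (2 * pi)\<bar> < \<epsilon> / 3"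
    using flat_poly_equidistribution[OF lip, of "\<epsilon> / 3" C] eps by auto
  have am: "integral {0..2 * pi} (\<lambda>\<theta>. g (cis \<theta>)) / (2 * pi) = arch_mean a b x R"
    by (simp add: g_def arch_mean_def)
  have "eventually (\<lambda>n. \<bar>local_sum a b T (r' n) - local_sum a b T r\<bar> < \<epsilon> / 3) sequentially"
    using tendstoD[OF lim1, of "\<epsilon> / 3"] eps by (simp add: dist_real_def)
  moreover have "eventually (\<lambda>n. L * (C + 1) * \<bar>Rn n - R\<bar> < \<epsilon> / 3) sequentially"
    using order_tendstoD(2)[OF lim2, of "\<epsilon> / 3"] eps by simp
  ultimately have "eventually (\<lambda>n. \<bar>local_sum a b T (r' n) - local_sum a b T r\<bar> < \<epsilon> / 3 \<and>
      L * (C + 1) * \<bar>Rn n - R\<bar> < \<epsilon> / 3) sequentially" by (rule eventually_conj)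
  then obtain N' where N': "\<And>n. n \<ge> N' \<Longrightarrow> \<bar>local_sum a b T (r' n) - local_sum a b T r\<bar> < \<epsilon> / 3 \<and>
      L * (C + 1) * \<bar>Rn n - R\<bar> < \<epsilon> / 3" unfolding eventually_sequentially by blast
  obtain n where nP: "prime n" "n > N + N'" using bigger_prime by blast
  then have n2: "n \<ge> 2" "n > 0" using prime_ge_2_nat[OF nP(1)] prime_gt_0_nat[OF nP(1)] by auto
  obtain e M where eM: "ramified_poly n T (k n) e M"
    and fl: "flat_poly C {\<beta>. reval (ramified_poly.F n T e M) \<beta> = 0} (\<lambda>\<beta>. (\<beta> - of_real x) / of_real (Rn n))"
    using ex_flat_ramified_poly[OF nP(1) T(1,2,3), of "k n" x] k[OF n2(1)] unfolding C_def Rn_def by blast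
  interpret ramified_poly n T "k n" e M by fact
  define Z where "Z = {\<beta>. reval F \<beta> = 0}"
  define v where "v = (\<lambda>\<beta>::complex. (\<beta> - of_real x) / of_real (Rn n))"
  have fl': "flat_poly C Z v" using fl by (simp add: Z_def v_def)
  have cZ: "card Z = n" unfolding Z_def by (rule card_roots)
  have "Z \<noteq> {}" using cZ n2 by auto
  then obtain \<alpha> where \<alpha>: "reval F \<alpha> = 0" by (auto simp: Z_def)
  interpret mp: minimal_poly \<alpha> F n by (rule root_minimal_poly[OF \<alpha>])
  have "height_ab a b \<alpha> = local_sum a b T (r' n) + (\<Sum>\<beta>\<in>Z. log_plus_ab a b \<beta>) / real n"
    unfolding local_sum_def log_plus_ab_def Z_def r'_def by (rule height_ab_root[OF \<alpha> a T(4)])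
  \<comment> \<open>Exchanging \<open>Rn n\<close> for R moves each root by at most C + 1 times the
    difference, by the bound on the rescaled roots.\<close>
  moreover have "\<bar>(\<Sum>\<beta>\<in>Z. log_plus_ab a b \<beta>) / real n - (\<Sum>\<beta>\<in>Z. g (v \<beta>)) / real n\<bar> \<le> L * (C + 1) * \<bar>Rn n - R\<bar>"
  proof -
    have Rn0: "Rn n > 0" unfolding Rn_def using p1 by (intro prod_pos) force
    have "\<bar>(\<Sum>\<beta>\<in>Z. log_plus_ab a b \<beta>) - (\<Sum>\<beta>\<in>Z. g (v \<beta>))\<bar> \<le> (\<Sum>\<beta>\<in>Z. \<bar>log_plus_ab a b \<beta> - g (v \<beta>)\<bar>)"
      unfolding sum_subtractf[symmetric] by (rule sum_abs)
    also have "\<dots> \<le> (\<Sum>\<beta>\<in>Z. L * (C + 1) * \<bar>Rn n - R\<bar>)"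
    proof (rule sum_mono)
      fix \<beta> assume b: "\<beta> \<in> Z"
      have "\<beta> - (of_real x + of_real R * v \<beta>) = of_real (Rn n - R) * v \<beta>"
        using Rn0 by (simp add: v_def field_simps)
      then have "cmod (\<beta> - (of_real x + of_real R * v \<beta>)) = \<bar>Rn n - R\<bar> * cmod (v \<beta>)"
        by (simp only: norm_mult norm_of_real)
      also have "\<dots> \<le> \<bar>Rn n - R\<bar> * (C + 1)"
        by (intro mult_left_mono flat_poly_root_bound[OF fl' b]) auto
      finally have le: "L * cmod (\<beta> - (of_real x + of_real R * v \<beta>)) \<le> L * (\<bar>Rn n - R\<bar> * (C + 1))"
        by (intro mult_left_mono) (auto simp: L_def)
      have "\<bar>log_plus_ab a b \<beta> - g (v \<beta>)\<bar> \<le> L * cmod (\<beta> - (of_real x + of_real R * v \<beta>))"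
        unfolding g_def L_def by (rule log_plus_ab_lipschitz)
      also note le
      also have "L * (\<bar>Rn n - R\<bar> * (C + 1)) = L * (C + 1) * \<bar>Rn n - R\<bar>" by (simp only: mult_ac)
      finally show "\<bar>log_plus_ab a b \<beta> - g (v \<beta>)\<bar> \<le> L * (C + 1) * \<bar>Rn n - R\<bar>" .
    qed
    also have "\<dots> = real n * (L * (C + 1) * \<bar>Rn n - R\<bar>)" by (simp add: cZ)
    finally show ?thesis using n2 by (simp add: diff_divide_distrib[symmetric] pos_divide_le_eq mult.commute)
  qed
  moreover have "\<bar>(\<Sum>\<beta>\<in>Z. g (v \<beta>)) / real n - arch_mean a b x R\<bar> < \<epsilon> / 3"
    using N[OF fl'] nP(2) unfolding am cZ by simp
  moreover have "\<bar>local_sum a b T (r' n) - local_sum a b T r\<bar> < \<epsilon> / 3 \<and> L * (C + 1) * \<bar>Rn n - R\<bar> < \<epsilon> / 3"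
    using N'[of n] nP(2) by simp
  ultimately have "\<bar>height_ab a b \<alpha> - (local_sum a b T r + arch_mean a b x R)\<bar> < \<epsilon>" by linarith
  then show ?thesis using mp.algebraic_in[OF mp.self_in_adjoin] unfolding R_def by blast
qed

lemma finite_S_ab: "finite (S_ab a b)"
proof -
  define D where "D = snd (quotient_of a) * snd (quotient_of b)"
  have D: "D > 0" unfolding D_def
    by (intro mult_pos_pos) (metis quotient_of_denom_pos prod.collapse)+
  have "S_ab a b \<subseteq> {..nat D}"
  proof
    fix p assume "p \<in> S_ab a b"
    then have "int p dvd D" by (auto simp: S_ab_def D_def)
    then have "int p \<le> D" using D by (rule zdvd_imp_le)
    then show "p \<in> {..nat D}" by simp
  qed
  then show ?thesis by (rule finite_subset) simp
qed

text \<open>An auxiliary prime of radius 1 ensures that the set of ramified primes is not empty.\<close>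

lemma ex_height_near_Gamma:
  assumes a: "a \<noteq> 0" and r: "\<And>p. p \<in> S_ab a b \<Longrightarrow> r p > 0" and eps: "\<epsilon> > 0"
  shows "\<exists>\<alpha>. algebraic \<alpha> \<and> \<bar>height_ab a b \<alpha> - Gamma_ab a b x r\<bar> < \<epsilon>"
proof -
  define S where "S = S_ab a b"
  have fin: "finite S" unfolding S_def by (rule finite_S_ab)
  obtain q where q: "prime q" "q \<notin> S"
    using bigger_prime[of "Max (insert 0 S)"] fin by (metis Max_ge finite_insert insertCI leD)
  define r1 where "r1 = r(q := 1)"
  have eq: "r1 p = r p" if "p \<in> S" for p using that q by (auto simp: r1_def)
  have le1: "padic_abs q c \<le> 1" if c: "c = 0 \<or> \<not> int q dvd snd (quotient_of c)" for c
  proof (cases "c = 0")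
    case False
    then have "multiplicity (int q) (snd (quotient_of c)) = 0" using c not_dvd_imp_multiplicity_0 by blast
    moreover have "real q powi (int (multiplicity (int q) (fst (quotient_of c)))) \<ge> 1"
      using prime_gt_0_nat[OF q(1)] by (intro one_le_power_int) auto
    ultimately show ?thesis by (simp add: padic_abs_def power_int_minus inverse_le_1_iff)
  qed (simp add: padic_abs_def)
  have nn: "padic_abs q c \<ge> 0" for c by (simp add: padic_abs_def)
  \<comment> \<open>Both a and b are integral at q, so with radius 1 the auxiliary prime adds
    nothing to the local sum.\<close>
  have "padic_abs q a \<le> 1" "padic_abs q b \<le> 1" using q by (auto intro!: le1 simp: S_def S_ab_def)
  then have "log_plus (max (padic_abs q a * r1 q) (padic_abs q b)) = 0"
    using nn by (intro log_plus_le_1) (auto simp: r1_def le_max_iff_disj)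
  moreover have "log_plus (r1 q) = 0" by (simp add: r1_def log_plus_def)
  moreover have "local_sum a b S r1 = local_sum a b S r"
    unfolding local_sum_def by (rule sum.cong) (auto simp: eq)
  ultimately have ls: "local_sum a b (insert q S) r1 = local_sum a b S r"
    using fin q(2) by (simp add: local_sum_def)
  have pr: "(\<Prod>p\<in>insert q S. r1 p) = (\<Prod>p\<in>S. r p)"
    using fin q(2) eq by (simp add: r1_def cong: prod.cong)
  have "\<exists>\<alpha>. algebraic \<alpha> \<and> \<bar>height_ab a b \<alpha> -
      (local_sum a b (insert q S) r1 + arch_mean a b x (1 / (\<Prod>p\<in>insert q S. r1 p)))\<bar> < \<epsilon>"
    by (rule ex_height_near[OF a])
       (use fin q(1) eps r in \<open>auto simp: S_def S_ab_def r1_def\<close>)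
  then show ?thesis unfolding ls pr Gamma_ab_eq S_def[symmetric] .
qed

section \<open>Dependence of the bound on x\<close>

lemma continuous_log_plus_ab_circle:
  "continuous_on A (\<lambda>\<theta>. log_plus_ab a b (of_real x + of_real R * cis \<theta>))"
proof (rule continuous_on_compose2[of UNIV "log_plus_ab a b"])
  show "continuous_on UNIV (log_plus_ab a b)"
    by (rule lipschitz_on_continuous_on[of "1 + \<bar>of_rat a\<bar>"], rule lipschitz_onI)
       (use log_plus_ab_lipschitz in \<open>auto simp: dist_norm\<close>)
qed (auto intro!: continuous_intros)

text \<open>A change of x translates the circle, so the Lipschitz constant of the integrand passes
  to the mean.\<close>

lemma continuous_Gamma_ab: "continuous_on UNIV (\<lambda>x. Gamma_ab a b x r)"
proof (rule lipschitz_on_continuous_on, rule lipschitz_onI)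
  fix x y :: real
  define R where "R = 1 / (\<Prod>p\<in>S_ab a b. r p)"
  define f where "f = (\<lambda>x \<theta>. log_plus_ab a b (of_real x + of_real R * cis \<theta>))"
  have cf: "continuous_on {0..2 * pi} (f x)" for x unfolding f_def by (rule continuous_log_plus_ab_circle)
  have int: "f x integrable_on {0..2 * pi}" for x by (rule integrable_continuous_interval[OF cf])
  have "integral {0..2 * pi} (f x) - integral {0..2 * pi} (f y) = integral {0..2 * pi} (\<lambda>\<theta>. f x \<theta> - f y \<theta>)"
    by (rule Henstock_Kurzweil_Integration.integral_diff[symmetric]) (rule int)+
  moreover have "norm (integral {0..2 * pi} (\<lambda>\<theta>. f x \<theta> - f y \<theta>)) \<le> (1 + \<bar>of_rat a\<bar>) * \<bar>x - y\<bar> * (2 * pi - 0)"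
  proof (rule integral_bound)
    show "continuous_on {0..2 * pi} (\<lambda>\<theta>. f x \<theta> - f y \<theta>)" by (intro continuous_on_diff cf)
    fix t
    have "(of_real x + of_real R * cis t) - (of_real y + of_real R * cis t) = (of_real (x - y) :: complex)" by simp
    then show "norm (f x t - f y t) \<le> (1 + \<bar>of_rat a\<bar>) * \<bar>x - y\<bar>"
      using log_plus_ab_lipschitz[of a b "of_real x + of_real R * cis t" "of_real y + of_real R * cis t"]
      unfolding f_def real_norm_def by (simp only: norm_of_real)
  qed simp
  ultimately have "\<bar>integral {0..2 * pi} (f x) - integral {0..2 * pi} (f y)\<bar> \<le> (1 + \<bar>of_rat a\<bar>) * \<bar>x - y\<bar> * (2 * pi)"
    by simp
  then have le: "\<bar>integral {0..2 * pi} (f x) / (2 * pi) - integral {0..2 * pi} (f y) / (2 * pi)\<bar> \<le> (1 + \<bar>of_rat a\<bar>) * \<bar>x - y\<bar>"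
    by (simp add: diff_divide_distrib[symmetric] pos_divide_le_eq mult.assoc)
  have eq: "Gamma_ab a b z r = local_sum a b (S_ab a b) r + integral {0..2 * pi} (f z) / (2 * pi)" for z
    unfolding Gamma_ab_eq arch_mean_def R_def f_def ..
  show "dist (Gamma_ab a b x r) (Gamma_ab a b y r) \<le> (1 + \<bar>of_rat a\<bar>) * dist x y"
    unfolding dist_real_def eq[of x] eq[of y] using le by simp
qed simp

text \<open>For large x the whole circle lies outside the disc of radius \<open>exp t\<close>, where
  the first logarithm is at least t; all other terms are nonnegative.\<close>

lemma Gamma_ab_unbounded:
  assumes r: "\<And>p. p \<in> S_ab a b \<Longrightarrow> r p > 0"
  shows "\<exists>x\<ge>x0. Gamma_ab a b x r \<ge> t"
proof -
  define R where "R = 1 / (\<Prod>p\<in>S_ab a b. r p)"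
  have R: "R > 0" unfolding R_def using r by (simp add: prod_pos)
  define x where "x = max x0 (R + exp t + 1)"
  have "t \<le> log_plus_ab a b (of_real x + of_real R * cis \<theta>)" for \<theta>
  proof -
    have "cmod (of_real x + of_real R * cis \<theta>) \<ge> \<bar>x\<bar> - R"
      using norm_diff_ineq[of "of_real x" "of_real R * cis \<theta>"] R by (simp add: norm_mult)
    then have "exp t < cmod (of_real x + of_real R * cis \<theta>)" unfolding x_def by linarith
    then have "t \<le> ln (cmod (of_real x + of_real R * cis \<theta>))"
      by (metis exp_gt_zero less_imp_le ln_exp ln_mono)
    then have "t \<le> log_plus (cmod (of_real x + of_real R * cis \<theta>))"
      using \<open>exp t < _\<close> exp_gt_zero[of t] by (auto simp: log_plus_def)
    then show ?thesis unfolding log_plus_ab_def using log_plus_nonneg by (metis add_increasing2)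
  qed
  then have "integral {0..2 * pi} (\<lambda>\<theta>. t) \<le> integral {0..2 * pi} (\<lambda>\<theta>. log_plus_ab a b (of_real x + of_real R * cis \<theta>))"
    by (intro integral_le integrable_continuous_interval continuous_log_plus_ab_circle) auto
  then have "t \<le> arch_mean a b x R" by (simp add: arch_mean_def pos_le_divide_eq mult.commute)
  moreover have "local_sum a b (S_ab a b) r \<ge> 0"
    unfolding local_sum_def by (intro sum_nonneg add_nonneg_nonneg log_plus_nonneg)
  ultimately have "Gamma_ab a b x r \<ge> t" by (simp add: Gamma_ab_eq R_def)
  then show ?thesis by (intro exI[of _ x]) (simp add: x_def)
qed

text \<open>By the intermediate value theorem in x, t is itself a value of the bound for the same
  radii.\<close>

lemma ex_height_near_above_Gamma:
  assumes a: "a \<noteq> 0" and r: "\<And>p. p \<in> S_ab a b \<Longrightarrow> r p > 0"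
    and t: "t \<ge> Gamma_ab a b x r" and eps: "\<epsilon> > 0"
  shows "\<exists>\<alpha>. algebraic \<alpha> \<and> \<bar>height_ab a b \<alpha> - t\<bar> < \<epsilon>"
proof -
  obtain y where y: "y \<ge> x" "Gamma_ab a b y r \<ge> t" using Gamma_ab_unbounded[of a b r x t, OF r] by blast
  have "continuous_on {x..y} (\<lambda>x. Gamma_ab a b x r)"
    by (rule continuous_on_subset[OF continuous_Gamma_ab]) simp
  then obtain z where "Gamma_ab a b z r = t" using IVT'[of "\<lambda>x. Gamma_ab a b x r" x t y] t y by auto
  then show ?thesis using ex_height_near_Gamma[where r = r and x = z and b = b, OF a r eps] by simp
qed

theorem theoremC:
  fixes a b :: rat and x :: real and r :: "nat \<Rightarrow> real"
  assumes "a \<noteq> 0"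
    and "\<And>p. p \<in> S_ab a b \<Longrightarrow> r p > 0"
  shows "{Gamma_ab a b x r..} \<subseteq> closure (height_ab a b ` {\<alpha>. algebraic \<alpha>} \<inter> {Gamma_ab a b x r..})
         \<and> mu_ess (height_ab a b) \<le> ereal (Gamma_ab a b x r)"
proof
  define \<Gamma> where "\<Gamma> = Gamma_ab a b x r"
  have near: "\<exists>\<alpha>. algebraic \<alpha> \<and> \<bar>height_ab a b \<alpha> - t\<bar> < \<epsilon>" if "t \<ge> \<Gamma>" "\<epsilon> > 0" for t \<epsilon>
    using ex_height_near_above_Gamma[where r = r and x = x and b = b, OF assms _ that(2)] that(1) by (simp add: \<Gamma>_def)
  show "{Gamma_ab a b x r..} \<subseteq> closure (height_ab a b ` {\<alpha>. algebraic \<alpha>} \<inter> {Gamma_ab a b x r..})"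
    unfolding \<Gamma>_def[symmetric]
  proof
    fix t assume t: "t \<in> {\<Gamma>..}"
    show "t \<in> closure (height_ab a b ` {\<alpha>. algebraic \<alpha>} \<inter> {\<Gamma>..})"
      unfolding closure_approachable
    proof (intro allI impI)
      fix e :: real assume e: "e > 0"
      have t\<Gamma>: "t \<ge> \<Gamma>" using t by simp
      \<comment> \<open>Aiming at t + e / 2 keeps the height above \<Gamma>, as the closure is
        formed of heights inside the interval.\<close>
      obtain \<alpha> where al: "algebraic \<alpha>" "\<bar>height_ab a b \<alpha> - (t + e / 2)\<bar> < e / 2"
        using near[of "t + e / 2" "e / 2"] t e by auto
      have "height_ab a b \<alpha> \<ge> \<Gamma>" using al(2) t\<Gamma> unfolding abs_less_iff by linarith
      moreover have "dist (height_ab a b \<alpha>) t < e" using al(2) e unfolding dist_real_def abs_less_iff by linarith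
      ultimately show "\<exists>y\<in>height_ab a b ` {\<alpha>. algebraic \<alpha>} \<inter> {\<Gamma>..}. dist y t < e"
        using al(1) by blast
    qed
  qed
  \<comment> \<open>Finitely many heights would leave a gap in the open interval from \<Gamma> to
    \<theta>, where approximation is possible everywhere.\<close>
  have inf: "infinite {\<alpha>. algebraic \<alpha> \<and> height_ab a b \<alpha> \<le> \<theta>}" if th: "\<theta> > \<Gamma>" for \<theta>
  proof
    assume "finite {\<alpha>. algebraic \<alpha> \<and> height_ab a b \<alpha> \<le> \<theta>}"
    then have fin: "finite (height_ab a b ` {\<alpha>. algebraic \<alpha> \<and> height_ab a b \<alpha> \<le> \<theta>})" (is "finite ?H")
      by (rule finite_imageI)
    have "infinite {\<Gamma><..<\<theta>}" using th by simp
    then have "\<not> {\<Gamma><..<\<theta>} \<subseteq> ?H" using finite_subset[OF _ fin] by blast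
    then obtain t where t: "t \<in> {\<Gamma><..<\<theta>}" "t \<notin> ?H" by blast
    have "closed ?H" using fin by (rule finite_imp_closed)
    then have "open ({\<Gamma><..<\<theta>} - ?H)" by (intro open_Diff open_greaterThanLessThan)
    moreover have "t \<in> {\<Gamma><..<\<theta>} - ?H" using t by blast
    ultimately obtain e where e: "e > 0" "ball t e \<subseteq> {\<Gamma><..<\<theta>} - ?H" by (rule openE)
    have "t \<ge> \<Gamma>" using t by simp
    then obtain \<alpha> where al: "algebraic \<alpha>" "\<bar>height_ab a b \<alpha> - t\<bar> < e" using near[OF _ e(1)] by blast
    then have "height_ab a b \<alpha> \<in> ball t e" unfolding mem_ball dist_real_def by (subst abs_minus_commute)
    then have "height_ab a b \<alpha> \<in> {\<Gamma><..<\<theta>} - ?H" using e(2) by blast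
    then show False using al(1) by auto
  qed
  \<comment> \<open>Infinitude is known strictly above \<Gamma>, so the bound is reached through
    \<Gamma> + e.\<close>
  show "mu_ess (height_ab a b) \<le> ereal (Gamma_ab a b x r)"
    unfolding \<Gamma>_def[symmetric]
  proof (rule ereal_le_epsilon2)
    fix e :: real assume "e > 0"
    then have "infinite {\<alpha>. algebraic \<alpha> \<and> height_ab a b \<alpha> \<le> \<Gamma> + e}" by (intro inf) simp
    then show "mu_ess (height_ab a b) \<le> ereal \<Gamma> + ereal e"
      unfolding mu_ess_def plus_ereal.simps by (intro Inf_lower imageI) simp
  qed
qed

end
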